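(* Suppose the total batch size satisfies $S\sim\mathrm{Log}(\rho)$, i.e. $$P(S=n)=-\frac{1}{\log(1-\rho)}\,\frac{\rho^n}{n},\qquad n\in\{1,2,\dots\},$$ with each customer independently assigned entry queue $j$ with probability $p_j$. Let $t\ge0$, $v\in\{2,\dots,J\}$, and let $n_1,\dots,n_v$ be non-negative integers with $n_v\ge1$. Then $$P\big[\mathbf{N}(t)=(n_1,\dots,n_v,0,\dots,0)\big]=\sum_{i_1=0}^{n_1}\cdots\sum_{i_{v-1}=0}^{n_{v-1}}\ \sum_{i_v=1}^{n_v}\Big[\frac{i_v}{n_v}\,P\big[\mathbf{N}(t)=(n_1-i_1,\dots,n_v-i_v,0,\dots,0)\big]$$ $$\cdot\int_0^t-\lambda(\tau)\,\frac{\rho^{\sum_{k=1}^v i_k}}{\log(1-\rho)}\Big(\prod_{k=1}^v\frac{q_k(t-\tau)^{i_k}}{i_k!}\Big)\frac{\big(-1+\sum_{k=1}^v i_k\big)!}{\big[1-\rho\big(1-\sum_{k=1}^J q_k(t-\tau)\big)\big]^{\sum_{k=1}^v i_k}}\,d\tau\Big],$$ with the convention $0^0=1$.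
   Context: Consider an open network of $J$ infinite server queues, indexed $1,\dots,J$, empty at time $0$. Batches arrive at the points $T_1,T_2,\dots$ of a non-homogeneous Poisson process on $[0,\infty)$ with rate function $\lambda(t)\ge 0$ (measurable, with $\int_0^t\lambda(\tau)\,d\tau<\infty$ for all $t$). At time $T_i$, $\Sigma_{ij}$ customers arrive at queue $j$, for $j=1,\dots,J$. The vectors $\mathbf{\Sigma}_i=(\Sigma_{i1},\dots,\Sigma_{iJ})$ are i.i.d. (and independent of the arrival times), with the same distribution as a generic vector $\mathbf{S}=(S_1,\dots,S_J)$ with non-negative integer components. It is assumed that $\mathbb{E}\big[\prod_{j=1}^J z_j^{S_j}\big]=G_S\big(\sum_{j=1}^J p_jz_j\big)$, where $p_j\ge0$, $\sum_j p_j=1$, and $G_S(z)=\mathbb{E}[z^S]$ is the probability generating function of a univariate non-negative integer-valued random variable $S$ (the total batch size). The $\ell$th customer entering queue $j$ at time $T_i$ carries a stochastic process $X^j_{i,\ell}(t)$, $t\ge 0$, where $X^j_{i,\ell}(t)=k\in\{1,\dots,J\}$ means that the customer is in queue $k$ at time $T_i+t$ (and $X^j_{i,\ell}(t)\notin\{1,\dots,J\}$ if the customer has left the network). These processes are mutually independent and independent of the arrival times and batch sizes (conditionally on the node of entry), with $P(X^j_{i,\ell}(t)=k)=q^j_k(t)$ (measurable in $t$). Put $q_k(t)=\sum_{j=1}^J p_j\,q^j_k(t)$, the probability that a customer is in queue $k$ a time $t$ after arrival. $\mathbf{N}(t)=(N_1(t),\dots,N_J(t))$, where $N_k(t)$ is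 the number of customers in queue $k$ at time $t$. In the vectors $(\cdot,\dots,\cdot,0,\dots,0)$, entries $v+1,\dots,J$ are zero. The parameter satisfies $0<\rho<1$.
   Formalization: Each customer's location process is additionally assumed jointly measurable in age and outcome for the sigma-algebra it generates (automatic for right-continuous paths); otherwise altering the location at the single age t−T_i keeps all assumptions but breaks the formula. *)

theory Defs
  imports "HOL-Probability.Probability"
begin

text \<open>
  Independence of two random variables, as in \<^const>\<open>prob_space.indep_var\<close>, but for
  variables with values in different types.
\<close>

definition (in prob_space) indep_rv ::
  "'b measure \<Rightarrow> ('a \<Rightarrow> 'b) \<Rightarrow> 'c measure \<Rightarrow> ('a \<Rightarrow> 'c) \<Rightarrow> bool" where
  "indep_rv N Y K Z \<longleftrightarrow> random_variable N Y \<and> random_variable K Z \<and>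
     indep_set {Y -` A \<inter> space M | A. A \<in> sets N} {Z -` B \<inter> space M | B. B \<in> sets K}"


text \<open>
  An arrival sequence is given by its ordered points \<open>T 0 \<le> T 1 \<le> \<dots>\<close>. They take values in
  \<open>[0, \<infinity>]\<close>: if the rate has finite total mass there are only finitely many points, and
  \<open>T i = \<infinity>\<close> means that there is no point number \<open>i\<close>.
\<close>

definition count_arrivals :: "(nat \<Rightarrow> 'a \<Rightarrow> ennreal) \<Rightarrow> real \<Rightarrow> real \<Rightarrow> 'a \<Rightarrow> nat" where
  "count_arrivals T s t \<omega> = card {i. ennreal s < T i \<omega> \<and> T i \<omega> \<le> ennreal t}"

text \<open>
  Local finiteness is required separately because \<^const>\<open>card\<close> is \<open>0\<close> on infinite sets.
  The Poisson probabilities are written out since \<^const>\<open>poisson_pmf\<close> excludes rate \<open>0\<close>.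
\<close>

definition (in prob_space) poisson_arrivals ::
  "(real \<Rightarrow> real) \<Rightarrow> (nat \<Rightarrow> 'a \<Rightarrow> ennreal) \<Rightarrow> bool" where
  "poisson_arrivals rate T \<longleftrightarrow>
     (\<forall>i. random_variable borel (T i)) \<and>
     (\<forall>i. \<forall>\<omega>\<in>space M. T i \<omega> \<le> T (Suc i) \<omega>) \<and>
     (AE \<omega> in M. \<forall>i. T i \<omega> \<noteq> 0) \<and>
     (\<forall>t\<ge>0. AE \<omega> in M. finite {i. T i \<omega> \<le> ennreal t}) \<and>
     (\<forall>s t k. 0 \<le> s \<longrightarrow> s \<le> t \<longrightarrow>
        prob {\<omega> \<in> space M. count_arrivals T s t \<omega> = k}
          = (LINT \<tau>:{s..t}|lborel. rate \<tau>) ^ k / fact k * exp (- (LINT \<tau>:{s..t}|lborel. rate \<tau>))) \<and>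
     (\<forall>n (s :: nat \<Rightarrow> real). 0 \<le> s 0 \<longrightarrow> mono s \<longrightarrow>
        indep_vars (\<lambda>_. count_space UNIV) (\<lambda>m. count_arrivals T (s m) (s (Suc m))) {..<n})"


text \<open>
  The queues are \<open>1, \<dots>, J\<close>; batches and customers are numbered from \<open>0\<close>, so the customers of
  batch \<open>i\<close> entering at queue \<open>j\<close> are those with number \<open>l < batch i j \<omega>\<close>. The location
  \<open>X i j l s \<omega>\<close> of such a customer, \<open>s\<close> time units after arrival, is a number outside
  \<open>{1..J}\<close> once the customer has left the network.
\<close>

abbreviation path_space :: "(real \<Rightarrow> nat) measure" where
  "path_space \<equiv> \<Pi>\<^sub>M s\<in>{0..}. count_space UNIV"

abbreviation path :: "(real \<Rightarrow> 'a \<Rightarrow> nat) \<Rightarrow> 'a \<Rightarrow> real \<Rightarrow> nat" where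
  "path Y \<omega> \<equiv> (\<lambda>s\<in>{0..}. Y s \<omega>)"

abbreviation batch_space :: "nat \<Rightarrow> (nat \<Rightarrow> nat) measure" where
  "batch_space J \<equiv> \<Pi>\<^sub>M j\<in>{1..J}. count_space UNIV"

abbreviation batch_vec :: "nat \<Rightarrow> (nat \<Rightarrow> 'a \<Rightarrow> nat) \<Rightarrow> 'a \<Rightarrow> nat \<Rightarrow> nat" where
  "batch_vec J b \<omega> \<equiv> (\<lambda>j\<in>{1..J}. b j \<omega>)"

text \<open>
  \<open>Svec\<close> is the law of the generic batch vector (only its components in \<open>{1..J}\<close> matter) and
  \<open>S\<close> that of the total batch size.

  Assumption \<open>path_measurable\<close> makes the location at the random age \<open>t - T i\<close> a random variable.
  Joint measurability is required with respect to the sigma-algebra generated by the process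
  itself (which is automatic for right-continuous paths). Joint measurability with respect
  to \<open>M\<close> would not be enough: modifying the location at the single age \<open>t - T i\<close> does not affect
  the independence of the process from \<open>T\<close> if \<open>T i\<close> has no atoms.
\<close>

locale infinite_server_network = prob_space M
  for M :: "'a measure" +
  fixes J :: nat
    and rate :: "real \<Rightarrow> real"
    and T :: "nat \<Rightarrow> 'a \<Rightarrow> ennreal"
    and p :: "nat \<Rightarrow> real"
    and S :: "nat pmf"
    and Svec :: "(nat \<Rightarrow> nat) pmf"
    and batch :: "nat \<Rightarrow> nat \<Rightarrow> 'a \<Rightarrow> nat"
    and X :: "nat \<Rightarrow> nat \<Rightarrow> nat \<Rightarrow> real \<Rightarrow> 'a \<Rightarrow> nat"
    and q :: "nat \<Rightarrow> nat \<Rightarrow> real \<Rightarrow> real"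
  assumes rate_nonneg: "\<And>\<tau>. 0 \<le> \<tau> \<Longrightarrow> 0 \<le> rate \<tau>"
    and rate_measurable: "set_borel_measurable borel {0..} rate"
    and rate_integrable: "\<And>t. 0 \<le> t \<Longrightarrow> set_integrable lborel {0..t} rate"
    and arrivals: "poisson_arrivals rate T"
    and p_nonneg: "\<And>j. j \<in> {1..J} \<Longrightarrow> 0 \<le> p j"
    and p_sum: "(\<Sum>j=1..J. p j) = 1"
    and Svec_pgf: "\<And>z. (\<And>j. j \<in> {1..J} \<Longrightarrow> z j \<in> {0..1::real}) \<Longrightarrow>
          measure_pmf.expectation Svec (\<lambda>x. \<Prod>j=1..J. z j ^ x j)
            = measure_pmf.expectation S (\<lambda>n. (\<Sum>j=1..J. p j * z j) ^ n)"
    and batch_indep: "indep_vars (\<lambda>_. batch_space J) (\<lambda>i. batch_vec J (batch i)) UNIV"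
    and batch_distr: "\<And>i. distr M (batch_space J) (batch_vec J (batch i))
          = distr (measure_pmf Svec) (batch_space J) (\<lambda>x. restrict x {1..J})"
    and arrivals_batch_indep:
          "indep_rv (\<Pi>\<^sub>M i\<in>UNIV. borel) (\<lambda>\<omega> i. T i \<omega>)
             (\<Pi>\<^sub>M i\<in>UNIV. batch_space J) (\<lambda>\<omega> i. batch_vec J (batch i) \<omega>)"
    and path_indep: "indep_vars (\<lambda>_. path_space) (\<lambda>(i, j, l). path (X i j l)) (UNIV \<times> {1..J} \<times> UNIV)"
    and path_arrivals_batch_indep:
          "indep_rv (\<Pi>\<^sub>M c\<in>UNIV \<times> {1..J} \<times> UNIV. path_space)
               (\<lambda>\<omega>. \<lambda>(i, j, l)\<in>UNIV \<times> {1..J} \<times> UNIV. path (X i j l) \<omega>)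
             ((\<Pi>\<^sub>M i\<in>UNIV. borel) \<Otimes>\<^sub>M (\<Pi>\<^sub>M i\<in>UNIV. batch_space J))
               (\<lambda>\<omega>. (\<lambda>i. T i \<omega>, \<lambda>i. batch_vec J (batch i) \<omega>))"
    and path_measurable: "\<And>i j l. j \<in> {1..J} \<Longrightarrow>
          (\<lambda>(s, \<omega>). X i j l s \<omega>)
            \<in> restrict_space borel {0..} \<Otimes>\<^sub>M vimage_algebra (space M) (path (X i j l)) path_space
                \<rightarrow>\<^sub>M count_space UNIV"
    and q_measurable: "\<And>j k. j \<in> {1..J} \<Longrightarrow> k \<in> {1..J} \<Longrightarrow> set_borel_measurable borel {0..} (q j k)"
    and path_prob: "\<And>i j l k s. j \<in> {1..J} \<Longrightarrow> k \<in> {1..J} \<Longrightarrow> 0 \<le> s \<Longrightarrow>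
          prob {\<omega> \<in> space M. X i j l s \<omega> = k} = q j k s"

definition queue_length ::
  "nat \<Rightarrow> (nat \<Rightarrow> 'a \<Rightarrow> ennreal) \<Rightarrow> (nat \<Rightarrow> nat \<Rightarrow> 'a \<Rightarrow> nat) \<Rightarrow>
   (nat \<Rightarrow> nat \<Rightarrow> nat \<Rightarrow> real \<Rightarrow> 'a \<Rightarrow> nat) \<Rightarrow> nat \<Rightarrow> real \<Rightarrow> 'a \<Rightarrow> nat" where
  "queue_length J T batch X k t \<omega> =
     card {(i, j, l). T i \<omega> \<le> ennreal t \<and> j \<in> {1..J} \<and> l < batch i j \<omega> \<and>
                      X i j l (t - enn2real (T i \<omega>)) \<omega> = k}"

definition state_prob ::
  "'a measure \<Rightarrow> nat \<Rightarrow> (nat \<Rightarrow> 'a \<Rightarrow> ennreal) \<Rightarrow> (nat \<Rightarrow> nat \<Rightarrow> 'a \<Rightarrow> nat) \<Rightarrow>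
   (nat \<Rightarrow> nat \<Rightarrow> nat \<Rightarrow> real \<Rightarrow> 'a \<Rightarrow> nat) \<Rightarrow> real \<Rightarrow> (nat \<Rightarrow> nat) \<Rightarrow> real" where
  "state_prob M J T batch X t m =
     measure M {\<omega> \<in> space M. \<forall>k\<in>{1..J}. queue_length J T batch X k t \<omega> = m k}"

definition location_prob :: "nat \<Rightarrow> (nat \<Rightarrow> real) \<Rightarrow> (nat \<Rightarrow> nat \<Rightarrow> real \<Rightarrow> real) \<Rightarrow> nat \<Rightarrow> real \<Rightarrow> real" where
  "location_prob J p q k s = (\<Sum>j=1..J. p j * q j k s)"

end

theory Submission
  imports Defs
begin

text \<open>
  Write \<open>F(z)\<close> for the generating function of \<open>N(t)\<close>. Given the arrival times and the batch sizes,
  the customers move independently, so a batch arriving at time \<open>\<tau>\<close> contributes on average the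
  factor \<open>g(\<tau>, z) = G(1 - (\<Sum>k. q\<^sub>k (t - \<tau>) * (1 - z\<^sub>k)))\<close>, with \<open>G\<close> the generating function of the
  total batch size. Multiplying over the points of the Poisson process gives
  \<open>F(z) = exp (- \<integral> rate \<tau> * (1 - g(\<tau>, z)))\<close>: this is \<open>queue_lengths_pgf\<close>, which rests on the
  Laplace functional of the process (\<open>laplace_functional\<close>).

  For the logarithmic law \<open>G(u) = ln (1 - \<rho> * u) / ln (1 - \<rho>)\<close>, so the exponent \<open>L(z)\<close> is an
  integral of logarithms of affine functions of \<open>z\<close>. Its coefficients \<open>c\<^sub>i\<close> at \<open>i \<noteq> 0\<close> are
  explicit, and they are the integrals in the statement (\<open>log_coeff\<close>). Queues that have to be
  empty are treated by putting \<open>z\<^sub>k = 0\<close> for \<open>k > v\<close>. The identity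
  \<open>z\<^sub>v * \<partial>F/\<partial>z\<^sub>v = (z\<^sub>v * \<partial>L/\<partial>z\<^sub>v) * F\<close> then reads
  \<open>n\<^sub>v * P n = (\<Sum>i. i\<^sub>v * c\<^sub>i * P (n - i))\<close> on the level of coefficients.

  Only \<open>z\<^sub>v\<close> is treated as a variable in which one differentiates. For fixed values of the other
  \<open>z\<^sub>k\<close> the functions \<open>F\<close> and \<open>L\<close> are power series in \<open>z\<^sub>v\<close> alone, and
  \<open>exp_powser_recurrence\<close> relates their coefficients \<open>A\<^sub>n\<close> and \<open>B\<^sub>j\<close>. These coefficients are in turn
  convergent series in the remaining \<open>z\<^sub>k\<close>, whose coefficients are the state probabilities
  (\<open>has_sum_state_prob\<close>) and the \<open>c\<^sub>i\<close> (\<open>has_sum_log_coeff\<close>, a negative multinomial expansion).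
  Series on both sides are then compared with \<open>multi_powser_coeffs_unique\<close>.

  Two points in the derivation of \<open>F\<close> need care. First, the process is given by the joint law of
  its counts in intervals. The Laplace functional is obtained for step functions from these counts,
  then for continuous functions by approximation. Applied to continuous approximations of the
  indicators of open sets, it shows that the points avoid a given null set almost surely, and this
  allows almost everywhere limits, hence all measurable functions. Second, a location at the random
  age \<open>t - T i\<close> is not a measurable function of path and age on the product space of
  paths. Independence is therefore used in the form of Fubini's theorem on two copies of the
  sample space, each with a sub-sigma-algebra (\<open>indep_rv_iterated_expectation\<close>).
\<close>

section \<open>The recurrence for the exponential of a power series\<close>

text \<open>
  Only the values on \<open>(0, 1)\<close> are available, since the arguments of probability generating
  functions lie there. After division by \<open>x ^ n\<close>, the limit at \<open>0\<close> from the right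
  isolates the first coefficient not yet known to vanish.
\<close>

lemma powser_coeffs_zero:
  fixes a :: "nat \<Rightarrow> real"
  assumes "\<And>x. 0 < x \<Longrightarrow> x < 1 \<Longrightarrow> (\<lambda>n. a n * x ^ n) sums 0"
  shows "a n = 0"
proof (induction n rule: less_induct)
  case (less n)
  have sums: "(\<lambda>m. a (m + n) * x ^ m) sums 0" if "0 < x" "x < 1" for x :: real
  proof -
    have "(\<lambda>m. a (m + n) * x ^ (m + n)) sums (0 - (\<Sum>i<n. a i * x ^ i))"
      by (rule sums_split_initial_segment[OF assms[OF that]])
    also have "(\<Sum>i<n. a i * x ^ i) = 0"
      using less by simp
    finally have "(\<lambda>m. a (m + n) * x ^ (m + n) / x ^ n) sums (0 / x ^ n)"
      by (intro sums_divide) simp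
    then show ?thesis
      using that by (simp add: power_add)
  qed
  have summable: "summable (\<lambda>m. a (m + n) * x ^ m)" if "x \<noteq> 0" "norm x < 1 / 2" for x :: real
    using powser_inside[OF sums_summable[OF sums[of "1 / 2"]], of x] that by simp
  have "((\<lambda>x. \<Sum>m. a (m + n) * x ^ m) \<longlongrightarrow> a (0 + n)) (at 0)"
    by (rule powser_limit_0_strong[of "1/2"]) (use summable in \<open>auto simp: summable_sums\<close>)
  then have "((\<lambda>x. \<Sum>m. a (m + n) * x ^ m) \<longlongrightarrow> a n) (at_right 0)"
    unfolding add_0 by (rule tendsto_within_subset) simp
  moreover have "((\<lambda>x. \<Sum>m. a (m + n) * x ^ m) \<longlongrightarrow> 0) (at_right 0)"
  proof (rule tendsto_eventually)
    have "eventually (\<lambda>x::real. 0 < x \<and> x < 1) (at_right 0)"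
      by (auto simp: eventually_at_right_field intro: exI[of _ 1])
    then show "\<forall>\<^sub>F x in at_right 0. (\<Sum>m. a (m + n) * x ^ m) = 0"
      by eventually_elim (metis sums sums_unique)
  qed
  ultimately show "a n = 0"
    by (rule tendsto_unique[rotated]) simp
qed

text \<open>
  Differentiating \<open>A = exp L\<close> gives \<open>x * A' = (x * L') * A\<close>, and the claim compares coefficients,
  the right-hand side being a Cauchy product. The constant term of \<open>L\<close> does not occur in \<open>L'\<close>,
  so the expansion of \<open>L x - L 0\<close> suffices.
\<close>

lemma exp_powser_recurrence:
  fixes a b :: "nat \<Rightarrow> real"
  assumes a: "\<And>x. 0 \<le> x \<Longrightarrow> x < 1 \<Longrightarrow> (\<lambda>n. a n * x ^ n) sums exp (L x)"
    and b: "\<And>x. 0 \<le> x \<Longrightarrow> x < 1 \<Longrightarrow> (\<lambda>n. b n * x ^ n) sums (L x - L 0)"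
  shows "real n * a n = (\<Sum>j\<le>n. real j * b j * a (n - j))"
proof -
  define A B where "A x = (\<Sum>n. a n * x ^ n)" and "B x = (\<Sum>n. b n * x ^ n)" for x :: real
  have sum_a: "summable (\<lambda>n. a n * x ^ n)" and sum_b: "summable (\<lambda>n. b n * x ^ n)"
    if "norm x < 1" for x :: real
  proof -
    obtain y where "norm x < y" "y < 1"
      using dense \<open>norm x < 1\<close> by blast
    moreover from this have "0 < y"
      using norm_ge_zero[of x] by linarith
    ultimately show "summable (\<lambda>n. a n * x ^ n)" "summable (\<lambda>n. b n * x ^ n)"
      using powser_inside[OF sums_summable[OF a[of y]], of x]
        powser_inside[OF sums_summable[OF b[of y]], of x]
      by auto
  qed
  have A_exp: "A x = exp (L 0) * exp (B x)" if "0 \<le> x" "x < 1" for x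
  proof -
    have "B x = L x - L 0"
      using sums_unique[OF b[OF that]] by (simp add: B_def)
    then have "exp (L 0) * exp (B x) = exp (L x)"
      unfolding exp_add[symmetric] by simp
    then show ?thesis
      using sums_unique[OF a[OF that]] by (simp only: A_def)
  qed
  have shift: "(\<lambda>n. real n * c n * x ^ n) sums (x * (\<Sum>n. diffs c n * x ^ n))"
    if "summable (\<lambda>n. diffs c n * x ^ n)" for c and x :: real
  proof -
    have "(\<lambda>n. x * (diffs c n * x ^ n)) sums (x * (\<Sum>n. diffs c n * x ^ n))"
      by (intro sums_mult summable_sums that)
    then have "(\<lambda>n. real (Suc n) * c (Suc n) * x ^ Suc n) sums (x * (\<Sum>n. diffs c n * x ^ n))"
      by (simp add: diffs_def mult_ac)
    then show ?thesis
      by (subst (asm) sums_Suc_iff) simp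
  qed
  have coeffs: "real n * a n - (\<Sum>j\<le>n. real j * b j * a (n - j)) = 0" for n
  proof (rule powser_coeffs_zero)
    fix x :: real assume x: "0 < x" "x < 1"
    have dA: "DERIV A x :> (\<Sum>n. diffs a n * x ^ n)"
      unfolding A_def by (rule termdiffs_strong'[of 1]) (use sum_a x in auto)
    have dB: "DERIV B x :> (\<Sum>n. diffs b n * x ^ n)"
      unfolding B_def by (rule termdiffs_strong'[of 1]) (use sum_b x in auto)
    have "DERIV (\<lambda>x. exp (L 0) * exp (B x)) x :> exp (L 0) * (exp (B x) * (\<Sum>n. diffs b n * x ^ n))"
      by (rule derivative_eq_intros dB refl)+ simp
    moreover have "eventually (\<lambda>y. A y = exp (L 0) * exp (B y)) (nhds x)"
      using eventually_nhds_in_open[of "{0<..<1}" x] x A_exp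
      by (auto elim!: eventually_mono)
    ultimately have "DERIV A x :> exp (L 0) * (exp (B x) * (\<Sum>n. diffs b n * x ^ n))"
      by (subst DERIV_cong_ev[OF refl _ refl])
    with dA have diff_eq: "(\<Sum>n. diffs a n * x ^ n) = A x * (\<Sum>n. diffs b n * x ^ n)"
      using A_exp[of x] x DERIV_unique by fastforce
    have ta: "summable (\<lambda>n. diffs a n * x ^ n)" and tb: "summable (\<lambda>n. diffs b n * x ^ n)"
      using termdiff_converges[of x 1 a] termdiff_converges[of x 1 b] sum_a sum_b x by auto
    have abs_a: "summable (\<lambda>n. norm (a n * x ^ n))"
    proof -
      have "summable (\<lambda>n. a n * ((1 + x) / 2) ^ n)"
        by (rule sum_a) (use x in auto)
      from powser_insidea[OF this, of x] show ?thesis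
        using x by auto
    qed
    have abs_b: "summable (\<lambda>n. norm (real n * b n * x ^ n))"
    proof -
      have "summable (\<lambda>n. real n * b n * ((1 + x) / 2) ^ n)"
        using shift[OF termdiff_converges[of "(1 + x) / 2" 1 b]] sum_b x
        by (auto simp: sums_iff)
      from powser_insidea[OF this, of x] show ?thesis
        using x by auto
    qed
    have "(\<lambda>k. \<Sum>i\<le>k. (real i * b i * x ^ i) * (a (k - i) * x ^ (k - i)))
        sums ((\<Sum>k. real k * b k * x ^ k) * (\<Sum>k. a k * x ^ k))"
      by (rule Cauchy_product_sums[OF abs_b abs_a])
    also have "(\<lambda>k. \<Sum>i\<le>k. (real i * b i * x ^ i) * (a (k - i) * x ^ (k - i)))
        = (\<lambda>k. (\<Sum>i\<le>k. real i * b i * a (k - i)) * x ^ k)"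
    proof (intro ext)
      fix k
      have "x ^ i * x ^ (k - i) = x ^ k" if "i \<le> k" for i
        using that by (simp flip: power_add)
      then show "(\<Sum>i\<le>k. (real i * b i * x ^ i) * (a (k - i) * x ^ (k - i)))
          = (\<Sum>i\<le>k. real i * b i * a (k - i)) * x ^ k"
        unfolding sum_distrib_right
        by (intro sum.cong refl) (simp add: mult_ac)
    qed
    also have "(\<Sum>k. real k * b k * x ^ k) * (\<Sum>k. a k * x ^ k) = x * (\<Sum>n. diffs a n * x ^ n)"
      using sums_unique[OF shift[OF tb]] diff_eq by (simp add: A_def)
    finally have "(\<lambda>n. real n * a n * x ^ n - (\<Sum>j\<le>n. real j * b j * a (n - j)) * x ^ n) sums 0"
      using sums_diff[OF shift[OF ta]] by fastforce
    then show "(\<lambda>n. (real n * a n - (\<Sum>j\<le>n. real j * b j * a (n - j))) * x ^ n) sums 0"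
      by (simp add: algebra_simps)
  qed
  show ?thesis
    using coeffs[of n] by simp
qed

section \<open>Power series in several variables\<close>

lemma has_sum_finite_sum:
  fixes f :: "'b \<Rightarrow> 'c \<Rightarrow> real"
  assumes "finite A" "\<And>a. a \<in> A \<Longrightarrow> (f a has_sum s a) C"
  shows "((\<lambda>c. \<Sum>a\<in>A. f a c) has_sum (\<Sum>a\<in>A. s a)) C"
  using assms by (induction A rule: finite_induct) (auto intro!: has_sum_add)

lemma has_sum_PiE_insert_iff:
  assumes "k \<notin> I"
  shows "(f has_sum s) (Pi\<^sub>E (insert k I) (\<lambda>_. UNIV))
    \<longleftrightarrow> ((\<lambda>(n, m). f (m(k := n))) has_sum s) (UNIV \<times> Pi\<^sub>E I (\<lambda>_. UNIV))"
proof -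
  have "inj_on (\<lambda>(n, m). m(k := n)) (UNIV \<times> Pi\<^sub>E I (\<lambda>_. UNIV))"
    by (rule inj_combinator[OF assms])
  then show ?thesis
    unfolding PiE_insert_eq by (subst has_sum_reindex) (simp_all add: o_def case_prod_unfold)
qed

text \<open>
  Induction on the set of variables: singling out one variable turns the series into a power series
  in that variable, whose coefficients, series in the other variables, all vanish.
\<close>

lemma multi_powser_coeffs_zero:
  fixes a :: "('k \<Rightarrow> nat) \<Rightarrow> real"
  assumes "finite I"
    and "\<And>z. (\<And>k. k \<in> I \<Longrightarrow> 0 < z k \<and> z k < 1)
        \<Longrightarrow> ((\<lambda>m. a m * (\<Prod>k\<in>I. z k ^ m k)) has_sum 0) (Pi\<^sub>E I (\<lambda>_. UNIV))"
    and "m \<in> Pi\<^sub>E I (\<lambda>_. UNIV)"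
  shows "a m = 0"
  using assms
proof (induction I arbitrary: a m rule: finite_induct)
  case empty
  from empty.prems(1)[of "\<lambda>_. 0"] empty.prems(2) show ?case
    by (simp add: has_sum_finite_iff)
next
  case (insert k I)
  have "a (m(k := n)) = 0" if m: "m \<in> Pi\<^sub>E I (\<lambda>_. UNIV)" for m n
  proof (rule insert.IH[of "\<lambda>m. a (m(k := n))", OF _ m])
    fix z :: "'k \<Rightarrow> real" assume z: "\<And>j. j \<in> I \<Longrightarrow> 0 < z j \<and> z j < 1"
    let ?f = "\<lambda>n m. a (m(k := n)) * (\<Prod>j\<in>I. z j ^ m j)"
    have double: "((\<lambda>(n, m). ?f n m * x ^ n) has_sum 0) (UNIV \<times> Pi\<^sub>E I (\<lambda>_. UNIV))"
      if "0 < x" "x < 1" for x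
    proof -
      have "((\<lambda>m. a m * (\<Prod>j\<in>insert k I. (z(k := x)) j ^ m j)) has_sum 0)
          (Pi\<^sub>E (insert k I) (\<lambda>_. UNIV))"
        by (rule insert.prems(1)) (use z that in auto)
      then have "((\<lambda>(n, m). a (m(k := n)) * (\<Prod>j\<in>insert k I. (z(k := x)) j ^ (m(k := n)) j))
          has_sum 0) (UNIV \<times> Pi\<^sub>E I (\<lambda>_. UNIV))"
        by (subst (asm) has_sum_PiE_insert_iff[OF insert.hyps(2)])
      also have "(\<lambda>(n, m). a (m(k := n)) * (\<Prod>j\<in>insert k I. (z(k := x)) j ^ (m(k := n)) j))
          = (\<lambda>(n, m). ?f n m * x ^ n)"
      proof (intro ext, clarify)
        fix n m
        have "(\<Prod>j\<in>insert k I. (z(k := x)) j ^ (m(k := n)) j)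
            = x ^ n * (\<Prod>j\<in>I. (z(k := x)) j ^ (m(k := n)) j)"
          using insert.hyps by simp
        also have "(\<Prod>j\<in>I. (z(k := x)) j ^ (m(k := n)) j) = (\<Prod>j\<in>I. z j ^ m j)"
          using insert.hyps by (intro prod.cong) auto
        finally show "a (m(k := n)) * (\<Prod>j\<in>insert k I. (z(k := x)) j ^ (m(k := n)) j)
            = ?f n m * x ^ n"
          by simp
      qed
      finally show ?thesis .
    qed
    have inner: "?f n summable_on Pi\<^sub>E I (\<lambda>_. UNIV)" for n
    proof -
      have "(\<lambda>m. ?f n m * (1/2) ^ n) summable_on Pi\<^sub>E I (\<lambda>_. UNIV)"
        using summable_on_SigmaD1[OF has_sum_imp_summable[OF double[of "1/2"]], of n] by simp
      then have "(\<lambda>m. ?f n m * (1/2) ^ n * 2 ^ n) summable_on Pi\<^sub>E I (\<lambda>_. UNIV)"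
        by (rule summable_on_cmult_left)
      then show ?thesis
        by (simp add: mult.assoc flip: power_mult_distrib)
    qed
    have "infsum (?f n) (Pi\<^sub>E I (\<lambda>_. UNIV)) = 0" for n
    proof (rule powser_coeffs_zero)
      fix x :: real assume x: "0 < x" "x < 1"
      have "((\<lambda>n. infsum (?f n) (Pi\<^sub>E I (\<lambda>_. UNIV)) * x ^ n) has_sum 0) UNIV"
        by (rule has_sum_SigmaD[OF double[OF x]])
          (simp add: has_sum_cmult_left has_sum_infsum[OF inner])
      then show "(\<lambda>n. infsum (?f n) (Pi\<^sub>E I (\<lambda>_. UNIV)) * x ^ n) sums 0"
        by (rule has_sum_imp_sums)
    qed
    then show "(?f n has_sum 0) (Pi\<^sub>E I (\<lambda>_. UNIV))"
      using has_sum_infsum[OF inner[of n]] by simp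
  qed
  from this[of "m(k := undefined)" "m k"] insert.prems(2) insert.hyps show ?case
    by (auto simp: PiE_def extensional_def)
qed

lemma multi_powser_coeffs_unique:
  fixes a b :: "('k \<Rightarrow> nat) \<Rightarrow> real"
  assumes "finite I"
    and "\<And>z. (\<And>k. k \<in> I \<Longrightarrow> 0 < z k \<and> z k < 1)
        \<Longrightarrow> ((\<lambda>m. a m * (\<Prod>k\<in>I. z k ^ m k)) has_sum f z) (Pi\<^sub>E I (\<lambda>_. UNIV))"
    and "\<And>z. (\<And>k. k \<in> I \<Longrightarrow> 0 < z k \<and> z k < 1)
        \<Longrightarrow> ((\<lambda>m. b m * (\<Prod>k\<in>I. z k ^ m k)) has_sum f z) (Pi\<^sub>E I (\<lambda>_. UNIV))"
    and "m \<in> Pi\<^sub>E I (\<lambda>_. UNIV)"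
  shows "a m = b m"
proof -
  have "a m - b m = 0"
  proof (rule multi_powser_coeffs_zero[OF assms(1) _ assms(4)])
    fix z :: "'k \<Rightarrow> real" assume z: "\<And>k. k \<in> I \<Longrightarrow> 0 < z k \<and> z k < 1"
    show "((\<lambda>m. (a m - b m) * (\<Prod>k\<in>I. z k ^ m k)) has_sum 0) (Pi\<^sub>E I (\<lambda>_. UNIV))"
      using has_sum_add[OF assms(2) has_sum_uminusI[OF assms(3)], of z z] z
      by (simp add: algebra_simps)
  qed
  then show ?thesis by simp
qed

text \<open>
  The Cauchy product: pairs \<open>(i, m)\<close> of multi-indices are grouped by their sum. The nonnegativity
  assumptions give the absolute convergence of the double series.
\<close>

lemma multi_powser_product:
  fixes a b :: "('k \<Rightarrow> nat) \<Rightarrow> real"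
  assumes I: "finite I" and z: "\<And>k. k \<in> I \<Longrightarrow> 0 \<le> z k"
    and nonneg: "\<And>m. a m \<ge> 0" "\<And>m. b m \<ge> 0"
    and a: "((\<lambda>m. a m * (\<Prod>k\<in>I. z k ^ m k)) has_sum s) (Pi\<^sub>E I (\<lambda>_. UNIV))"
    and b: "((\<lambda>m. b m * (\<Prod>k\<in>I. z k ^ m k)) has_sum t) (Pi\<^sub>E I (\<lambda>_. UNIV))"
  shows "((\<lambda>m. (\<Sum>i\<in>Pi\<^sub>E I (\<lambda>k. {0..m k}). a i * b (\<lambda>k\<in>I. m k - i k)) * (\<Prod>k\<in>I. z k ^ m k))
    has_sum (s * t)) (Pi\<^sub>E I (\<lambda>_. UNIV))"
proof -
  let ?C = "Pi\<^sub>E I (\<lambda>_. UNIV :: nat set)"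
  let ?f = "\<lambda>m. a m * (\<Prod>k\<in>I. z k ^ m k)" and ?g = "\<lambda>m. b m * (\<Prod>k\<in>I. z k ^ m k)"
  have pos: "?f m \<ge> 0" "?g m \<ge> 0" for m
    using nonneg z by (auto intro!: mult_nonneg_nonneg prod_nonneg)
  have "((\<lambda>(i, m). ?f i * ?g m) has_sum (s * t)) (?C \<times> ?C)"
  proof (rule has_sum_SigmaI)
    show "((\<lambda>m. (\<lambda>(i, m). ?f i * ?g m) (i, m)) has_sum (?f i * t)) ?C" for i
      using has_sum_cmult_right[OF b] by simp
    show "((\<lambda>i. ?f i * t) has_sum (s * t)) ?C"
      by (rule has_sum_cmult_left[OF a])
    show "(\<lambda>(i, m). ?f i * ?g m) summable_on ?C \<times> ?C"
      by (rule summable_on_SigmaI[OF _ has_sum_imp_summable[OF has_sum_cmult_left[OF a, of t]]])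
        (use has_sum_cmult_right[OF b] pos in \<open>simp_all only: split mult_nonneg_nonneg\<close>)
  qed
  also have "?this \<longleftrightarrow> ((\<lambda>(m, i). ?f i * ?g (\<lambda>k\<in>I. m k - i k)) has_sum (s * t))
      (SIGMA m:?C. Pi\<^sub>E I (\<lambda>k. {0..m k}))"
  proof -
    have cancel: "(\<lambda>k\<in>I. (\<lambda>k\<in>I. i k + m k) k - i k) = m" if "m \<in> ?C" for i m :: "'k \<Rightarrow> nat"
      using that by (auto simp: PiE_def extensional_def fun_eq_iff)
    have add: "(\<lambda>k\<in>I. i k + (\<lambda>k\<in>I. m k - i k) k) = m"
      if "m \<in> ?C" "i \<in> Pi\<^sub>E I (\<lambda>k. {0..m k})" for i m
      using that by (auto simp: PiE_iff extensional_def fun_eq_iff)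
    have le: "i \<in> Pi\<^sub>E I (\<lambda>k. {0..(\<lambda>k\<in>I. i k + m k) k})" if "i \<in> ?C" for i m
      using that by (auto simp: PiE_iff)
    have C: "i \<in> ?C" if "i \<in> Pi\<^sub>E I (\<lambda>k. {0..m k})" for i m
      using that by (auto simp: PiE_iff)
    show ?thesis
      by (rule has_sum_reindex_bij_witness[of _ "\<lambda>(m, i). (i, \<lambda>k\<in>I. m k - i k)"
            "\<lambda>(i, m). (\<lambda>k\<in>I. i k + m k, i)"])
        (clarsimp simp only: cancel add le C split mem_Sigma_iff Product_Type.prod.inject simp_thms
          restrict_PiE_iff UNIV_I ball_UNIV; (rule C, assumption)?)+
  qed
  finally have "((\<lambda>m. \<Sum>i\<in>Pi\<^sub>E I (\<lambda>k. {0..m k}). ?f i * ?g (\<lambda>k\<in>I. m k - i k)) has_sum (s * t)) ?C"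
    by (rule has_sum_SigmaD) (use I in \<open>auto intro!: has_sum_finiteI finite_PiE\<close>)
  moreover have summand: "?f i * ?g (\<lambda>k\<in>I. m k - i k) = a i * b (\<lambda>k\<in>I. m k - i k) * (\<Prod>k\<in>I. z k ^ m k)"
    if "i \<in> Pi\<^sub>E I (\<lambda>k. {0..m k})" for i m
  proof -
    have "(\<Prod>k\<in>I. z k ^ i k) * (\<Prod>k\<in>I. z k ^ (\<lambda>k\<in>I. m k - i k) k) = (\<Prod>k\<in>I. z k ^ m k)"
      unfolding prod.distrib[symmetric] power_add[symmetric]
      using that by (intro prod.cong refl) (auto simp: PiE_iff)
    then show ?thesis
      by (simp add: mult_ac)
  qed
  moreover have "(\<Sum>i\<in>Pi\<^sub>E I (\<lambda>k. {0..m k}). ?f i * ?g (\<lambda>k\<in>I. m k - i k))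
      = (\<Sum>i\<in>Pi\<^sub>E I (\<lambda>k. {0..m k}). a i * b (\<lambda>k\<in>I. m k - i k)) * (\<Prod>k\<in>I. z k ^ m k)" for m
    unfolding sum_distrib_right by (rule sum.cong[OF refl summand])
  ultimately show ?thesis
    by (simp only:)
qed

lemma negative_binomial_series:
  fixes x y :: real
  assumes "0 \<le> x" "x < y"
  shows "((\<lambda>n. fact (s + n) * (x ^ n / fact n) / y ^ Suc (s + n))
    has_sum (fact s / (y - x) ^ Suc s)) UNIV"
proof -
  have y: "y > 0" and u: "\<bar>x / y\<bar> < 1"
    using assms by auto
  have "(\<lambda>n. (- real (Suc s) gchoose n) * (- (x / y)) ^ n) sums (1 + - (x / y)) powr (- real (Suc s))"
    by (rule gen_binomial_real) (use u in simp)
  also have "(1 + - (x / y)) powr (- real (Suc s)) = 1 / (1 - x / y) ^ Suc s"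
    using u assms by (subst powr_minus, subst powr_realpow) (auto simp: divide_simps)
  also have "(\<lambda>n. (- real (Suc s) gchoose n) * (- (x / y)) ^ n)
      = (\<lambda>n. fact (s + n) / (fact s * fact n) * (x / y) ^ n)"
  proof
    fix n
    have "(- real (Suc s) gchoose n) = (- 1) ^ n * (real (Suc s) + real n - 1 gchoose n)"
      by (rule gbinomial_minus)
    also have "real (Suc s) + real n - 1 = real (s + n)"
      by simp
    also have "real (s + n) gchoose n = real ((s + n) choose n)"
      by (rule binomial_gbinomial[symmetric])
    also have "\<dots> = fact (s + n) / (fact s * fact n)"
      by (subst binomial_fact) (auto simp: mult_ac)
    finally have *: "(- real (Suc s) gchoose n) = (- 1) ^ n * (fact (s + n) / (fact s * fact n))" .
    have "(- (x / y)) ^ n = (- 1) ^ n * (x / y) ^ n"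
      by (rule power_minus)
    then show "(- real (Suc s) gchoose n) * (- (x / y)) ^ n
        = fact (s + n) / (fact s * fact n) * (x / y) ^ n"
      unfolding * by (simp add: mult_ac flip: power_mult_distrib)
  qed
  finally have "(\<lambda>n. fact s / y ^ Suc s * (fact (s + n) / (fact s * fact n) * (x / y) ^ n)) sums
      (fact s / y ^ Suc s * (1 / (1 - x / y) ^ Suc s))"
    by (rule sums_mult)
  also have "fact s / y ^ Suc s * (1 / (1 - x / y) ^ Suc s) = fact s / (y - x) ^ Suc s"
  proof -
    have "y ^ Suc s * (1 - x / y) ^ Suc s = (y - x) ^ Suc s"
    proof -
      have "y * (1 - x / y) = y - x"
        using y by (simp add: field_simps)
      then show ?thesis
        by (simp only: power_mult_distrib[symmetric])
    qed
    then show ?thesis by simp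
  qed
  also have "(\<lambda>n. fact s / y ^ Suc s * (fact (s + n) / (fact s * fact n) * (x / y) ^ n))
      = (\<lambda>n. fact (s + n) * (x ^ n / fact n) / y ^ Suc (s + n))"
    by (simp add: fun_eq_iff power_divide power_add)
  finally show ?thesis
    by (rule sums_nonneg_imp_has_sum) (use assms in simp)
qed

text \<open>
  The expansion of \<open>s! / (y - x\<^sub>1 - \<dots> - x\<^sub>r) ^ (s + 1)\<close> in all the \<open>x\<^sub>k\<close>. Summing over one index with
  \<open>negative_binomial_series\<close> replaces \<open>y\<close> by \<open>y - x\<^sub>k\<close> and leaves a series of the same form.
\<close>

lemma negative_multinomial_series:
  fixes x :: "'k \<Rightarrow> real"
  assumes "finite I" "\<And>k. k \<in> I \<Longrightarrow> 0 \<le> x k" "(\<Sum>k\<in>I. x k) < y"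
  shows "((\<lambda>i. fact (s + (\<Sum>k\<in>I. i k)) * (\<Prod>k\<in>I. x k ^ i k / fact (i k)) / y ^ Suc (s + (\<Sum>k\<in>I. i k)))
    has_sum (fact s / (y - (\<Sum>k\<in>I. x k)) ^ Suc s)) (Pi\<^sub>E I (\<lambda>_. UNIV))"
  using assms
proof (induction I arbitrary: y rule: finite_induct)
  case empty
  then show ?case by (simp add: has_sum_finite_iff)
next
  case (insert k I)
  let ?C = "Pi\<^sub>E I (\<lambda>_. UNIV :: nat set)"
  let ?h = "\<lambda>n i. fact (s + (n + (\<Sum>j\<in>I. i j))) * (x k ^ n / fact n * (\<Prod>j\<in>I. x j ^ i j / fact (i j)))
    / y ^ Suc (s + (n + (\<Sum>j\<in>I. i j)))"
  have xI: "\<And>j. j \<in> I \<Longrightarrow> 0 \<le> x j" and xk: "0 \<le> x k" "x k < y" and less: "(\<Sum>j\<in>I. x j) < y - x k"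
    using insert.prems insert.hyps sum_nonneg[of I x] by auto
  have h_nonneg: "0 \<le> ?h n i" for n i
    using xI xk by (auto intro!: divide_nonneg_nonneg mult_nonneg_nonneg prod_nonneg)
  have inner: "((\<lambda>n. ?h n i) has_sum
      (fact (s + (\<Sum>j\<in>I. i j)) * (\<Prod>j\<in>I. x j ^ i j / fact (i j)) / (y - x k) ^ Suc (s + (\<Sum>j\<in>I. i j)))) UNIV"
    for i
    using has_sum_cmult_left[OF negative_binomial_series[OF xk, of "s + (\<Sum>j\<in>I. i j)"],
        of "\<Prod>j\<in>I. x j ^ i j / fact (i j)"]
    by (simp add: mult_ac add_ac)
  have outer: "((\<lambda>i. fact (s + (\<Sum>j\<in>I. i j)) * (\<Prod>j\<in>I. x j ^ i j / fact (i j))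
      / (y - x k) ^ Suc (s + (\<Sum>j\<in>I. i j))) has_sum (fact s / (y - x k - (\<Sum>j\<in>I. x j)) ^ Suc s)) ?C"
    by (rule insert.IH) (use xI less in auto)
  have "((\<lambda>(i, n). ?h n i) has_sum (fact s / (y - x k - (\<Sum>j\<in>I. x j)) ^ Suc s)) (?C \<times> UNIV)"
  proof (rule has_sum_SigmaI)
    show "(\<lambda>(i, n). ?h n i) summable_on ?C \<times> UNIV"
      by (rule summable_on_SigmaI[OF _ has_sum_imp_summable[OF outer]]) (use inner h_nonneg in auto)
  qed (use inner outer in auto)
  then have "((\<lambda>(n, i). ?h n i) has_sum (fact s / (y - x k - (\<Sum>j\<in>I. x j)) ^ Suc s)) (UNIV \<times> ?C)"
    by (subst has_sum_swap) (simp add: case_prod_unfold)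
  moreover have "y - x k - (\<Sum>j\<in>I. x j) = y - (\<Sum>j\<in>insert k I. x j)"
    using insert.hyps by simp
  moreover have "fact (s + (\<Sum>j\<in>insert k I. (i(k := n)) j)) *
      (\<Prod>j\<in>insert k I. x j ^ (i(k := n)) j / fact ((i(k := n)) j)) /
      y ^ Suc (s + (\<Sum>j\<in>insert k I. (i(k := n)) j)) = ?h n i" for n i
  proof -
    have "(\<Sum>j\<in>I. (i(k := n)) j) = (\<Sum>j\<in>I. i j)"
      "(\<Prod>j\<in>I. x j ^ (i(k := n)) j / fact ((i(k := n)) j)) = (\<Prod>j\<in>I. x j ^ i j / fact (i j))"
      using insert.hyps by (intro sum.cong prod.cong; auto)+
    then show ?thesis
      using insert.hyps by simp
  qed
  ultimately show ?case
    by (subst has_sum_PiE_insert_iff[OF insert.hyps(2)]) simp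
qed

section \<open>Sums of integrals over a countable index set\<close>

text \<open>
  Monotone convergence for nonnegative terms over an arbitrary countable index set, such as a set of
  multi-indices.
\<close>

lemma has_sum_integral:
  fixes f :: "'c \<Rightarrow> 'b \<Rightarrow> real"
  assumes C: "countable C"
    and meas: "\<And>c. c \<in> C \<Longrightarrow> f c \<in> borel_measurable N"
    and nonneg: "\<And>c x. c \<in> C \<Longrightarrow> x \<in> space N \<Longrightarrow> 0 \<le> f c x"
    and sum: "\<And>x. x \<in> space N \<Longrightarrow> ((\<lambda>c. f c x) has_sum F x) C"
    and F: "integrable N F"
  shows "((\<lambda>c. \<integral>x. f c x \<partial>N) has_sum (\<integral>x. F x \<partial>N)) C"
proof -
  have le: "f c x \<le> F x" if "c \<in> C" "x \<in> space N" for c x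
    using finite_sum_le_has_sum[OF sum[OF that(2)], of "{c}"] nonneg that by auto
  have int: "integrable N (f c)" if "c \<in> C" for c
    by (rule Bochner_Integration.integrable_bound[OF F meas[OF that]])
      (use le nonneg that in \<open>fastforce intro: AE_I2\<close>)
  show ?thesis
  proof (cases "finite C")
    case True
    have "(\<integral>x. F x \<partial>N) = (\<integral>x. (\<Sum>c\<in>C. f c x) \<partial>N)"
      by (rule Bochner_Integration.integral_cong) (use sum True in \<open>auto simp: has_sum_finite_iff\<close>)
    also have "\<dots> = (\<Sum>c\<in>C. \<integral>x. f c x \<partial>N)"
      by (rule Bochner_Integration.integral_sum) (rule int)
    finally show ?thesis
      using True by (simp add: has_sum_finite_iff)
  next
    case False
    define e where "e = from_nat_into C"
    have e: "bij_betw e UNIV C"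
      unfolding e_def by (rule bij_betw_from_nat_into[OF C False])
    then have eC: "e n \<in> C" for n
      by (auto simp: bij_betw_def)
    have sums: "(\<lambda>n. f (e n) x) sums F x" if "x \<in> space N" for x
      by (rule has_sum_imp_sums, subst has_sum_reindex_bij_betw[OF e, of "\<lambda>c. f c x"], rule sum[OF that])
    have F_nonneg: "0 \<le> F x" if "x \<in> space N" for x
      using le[OF eC that] nonneg[OF eC that] by (meson order_trans)
    have summable_int: "summable (\<lambda>n. \<integral>x. norm (f (e n) x) \<partial>N)"
    proof (rule bounded_imp_summable)
      fix n
      have "(\<Sum>k\<le>n. \<integral>x. norm (f (e k) x) \<partial>N) = (\<integral>x. (\<Sum>k\<le>n. norm (f (e k) x)) \<partial>N)"
        by (rule Bochner_Integration.integral_sum[symmetric]) (use int eC in auto)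
      also have "\<dots> \<le> (\<integral>x. F x \<partial>N)"
      proof (rule integral_mono[OF _ F])
        show "integrable N (\<lambda>x. \<Sum>k\<le>n. norm (f (e k) x))"
          using int eC by auto
        fix x assume x: "x \<in> space N"
        have "(\<Sum>k\<in>{..n}. f (e k) x) \<le> F x"
          by (rule sum_le_suminf[of "\<lambda>k. f (e k) x" "{..n}",
                unfolded sums_unique[OF sums[OF x], symmetric]])
            (use sums[OF x] nonneg eC x in \<open>auto simp: sums_iff\<close>)
        then show "(\<Sum>k\<le>n. norm (f (e k) x)) \<le> F x"
          using nonneg eC x by simp
      qed
      finally show "(\<Sum>k\<le>n. \<integral>x. norm (f (e k) x) \<partial>N) \<le> (\<integral>x. F x \<partial>N)" .
    qed simp
    have "(\<lambda>n. \<integral>x. f (e n) x \<partial>N) sums (\<integral>x. (\<Sum>n. f (e n) x) \<partial>N)"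
    proof (rule sums_integral)
      show "AE x in N. summable (\<lambda>n. norm (f (e n) x))"
        using sums nonneg eC by (intro AE_I2) (auto simp: sums_iff)
    qed (use int eC summable_int in auto)
    also have "(\<integral>x. (\<Sum>n. f (e n) x) \<partial>N) = (\<integral>x. F x \<partial>N)"
      by (rule Bochner_Integration.integral_cong) (use sums in \<open>auto simp: sums_iff\<close>)
    finally have "((\<lambda>n. \<integral>x. f (e n) x \<partial>N) has_sum (\<integral>x. F x \<partial>N)) UNIV"
      by (rule sums_nonneg_imp_has_sum) (use nonneg eC in \<open>auto intro!: integral_nonneg_AE AE_I2\<close>)
    then show ?thesis
      by (subst (asm) has_sum_reindex_bij_betw[OF e, of "\<lambda>c. \<integral>x. f c x \<partial>N"])
  qed
qed

section \<open>The Laplace functional of a Poisson process\<close>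

lemma eventually_prod_truncated:
  fixes f :: "nat \<Rightarrow> real"
  assumes "finite {i. P i}"
  shows "\<forall>\<^sub>F n in sequentially. (\<Prod>i<n. if P i then f i else 1) = (\<Prod>i\<in>{i. P i}. f i)"
proof -
  obtain n0 where n0: "{i. P i} \<subseteq> {..<n0}"
    using finite_nat_bounded[OF assms] by auto
  have "(\<Prod>i<n. if P i then f i else 1) = (\<Prod>i\<in>{i. P i}. f i)" if "n \<ge> n0" for n
    using n0 that by (intro prod.mono_neutral_cong_right) auto
  then show ?thesis
    by (auto simp: eventually_sequentially)
qed

text \<open>
  On an infinite set \<^const>\<open>prod\<close> has the value \<open>1\<close>, and the event that the random set is infinite
  is measurable; elsewhere the product is the limit of the truncated products.
\<close>

lemma borel_measurable_prod_random_set: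
  fixes f :: "nat \<Rightarrow> 'a \<Rightarrow> real"
  assumes [measurable]: "\<And>i. Measurable.pred N (P i)" "\<And>i. f i \<in> borel_measurable N"
  shows "(\<lambda>\<omega>. \<Prod>i\<in>{i. P i \<omega>}. f i \<omega>) \<in> borel_measurable N"
proof -
  have "(\<Prod>i\<in>{i. P i \<omega>}. f i \<omega>) = (if \<exists>n. \<forall>i\<ge>n. \<not> P i \<omega>
      then lim (\<lambda>n. \<Prod>i<n. if P i \<omega> then f i \<omega> else 1) else 1)" for \<omega>
  proof (cases "finite {i. P i \<omega>}")
    case True
    then have "\<exists>n. \<forall>i\<ge>n. \<not> P i \<omega>"
      by (auto simp: finite_nat_iff_bounded not_less[symmetric])
    moreover have "lim (\<lambda>n. \<Prod>i<n. if P i \<omega> then f i \<omega> else 1) = (\<Prod>i\<in>{i. P i \<omega>}. f i \<omega>)"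
      by (rule limI, rule tendsto_eventually, rule eventually_prod_truncated[OF True])
    ultimately show ?thesis by simp
  next
    case False
    then have "\<not> (\<exists>n. \<forall>i\<ge>n. \<not> P i \<omega>)"
      by (metis (mono_tags, lifting) finite_nat_iff_bounded lessThan_iff mem_Collect_eq not_le subsetI)
    then show ?thesis
      by (simp only: prod.infinite[OF False] if_False)
  qed
  then show ?thesis by simp
qed

lemma (in prob_space) expectation_tendsto:
  assumes "\<And>n. f n \<in> borel_measurable M" "g \<in> borel_measurable M"
    and "\<And>n \<omega>. 0 \<le> f n \<omega> \<and> f n \<omega> \<le> (1::real)"
    and "AE \<omega> in M. (\<lambda>n. f n \<omega>) \<longlonglongrightarrow> g \<omega>"
  shows "(\<lambda>n. expectation (f n)) \<longlonglongrightarrow> expectation g"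
  by (rule integral_dominated_convergence[where w="\<lambda>_. 1"]) (use assms in auto)

locale poisson_points = prob_space M
  for M :: "'a measure" +
  fixes rate :: "real \<Rightarrow> real" and T :: "nat \<Rightarrow> 'a \<Rightarrow> ennreal" and t :: real
  assumes rate_nonneg: "\<And>\<tau>. 0 \<le> \<tau> \<Longrightarrow> 0 \<le> rate \<tau>"
    and rate_integrable: "set_integrable lborel {0..t} rate"
    and arrivals: "poisson_arrivals rate T"
    and t_nonneg: "0 \<le> t"
begin

lemma T_measurable [measurable]: "T i \<in> borel_measurable M"
  using arrivals by (simp add: poisson_arrivals_def)

lemma AE_T_pos: "AE \<omega> in M. \<forall>i. T i \<omega> \<noteq> 0"
  using arrivals by (simp add: poisson_arrivals_def)

lemma AE_finite: "AE \<omega> in M. finite {i. T i \<omega> \<le> ennreal t}"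
  using arrivals t_nonneg by (simp add: poisson_arrivals_def)

definition product_at_points :: "(real \<Rightarrow> real) \<Rightarrow> 'a \<Rightarrow> real" where
  "product_at_points h \<omega> = (\<Prod>i\<in>{i. T i \<omega> \<le> ennreal t}. h (enn2real (T i \<omega>)))"

definition laplace_formula :: "(real \<Rightarrow> real) \<Rightarrow> bool" where
  "laplace_formula h \<longleftrightarrow>
    expectation (product_at_points h) = exp (- (LINT \<tau>:{0..t}|lborel. rate \<tau> * (1 - h \<tau>)))"

lemma product_at_points_measurable [measurable]:
  "h \<in> borel_measurable borel \<Longrightarrow> product_at_points h \<in> borel_measurable M"
  unfolding product_at_points_def[abs_def]
  by (intro borel_measurable_prod_random_set measurable_compose[of "\<lambda>\<omega>. enn2real (T _ \<omega>)" M borel h]) measurable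

lemma product_at_points_bounds:
  "(\<And>x. 0 \<le> h x \<and> h x \<le> 1) \<Longrightarrow> 0 \<le> product_at_points h \<omega> \<and> product_at_points h \<omega> \<le> 1"
  unfolding product_at_points_def by (auto intro: prod_nonneg prod_le_1)

lemma rate_mult_integrable:
  assumes [measurable]: "h \<in> borel_measurable borel" and h: "\<And>x. 0 \<le> h x \<and> h x \<le> 1"
  shows "set_integrable lborel {0..t} (\<lambda>\<tau>. rate \<tau> * h \<tau>)"
proof -
  have int: "integrable lborel (\<lambda>\<tau>. indicator {0..t} \<tau> *\<^sub>R rate \<tau>)"
    using rate_integrable by (simp only: set_integrable_def)
  then have [measurable]: "(\<lambda>\<tau>. indicator {0..t} \<tau> *\<^sub>R rate \<tau>) \<in> borel_measurable lborel"
    by simp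
  have "integrable lborel (\<lambda>\<tau>. (indicator {0..t} \<tau> *\<^sub>R rate \<tau>) * h \<tau>)"
  proof (rule Bochner_Integration.integrable_bound[OF int])
    show "(\<lambda>\<tau>. (indicator {0..t} \<tau> *\<^sub>R rate \<tau>) * h \<tau>) \<in> borel_measurable lborel"
      by measurable
  qed (use h in \<open>auto simp: indicator_def abs_mult intro!: mult_left_le\<close>)
  then show ?thesis
    by (simp add: set_integrable_def mult.assoc)
qed

text \<open>
  Dominated convergence on both sides of the formula. Each of the extensions below, from step
  functions to measurable functions, is an instance of this closure property.
\<close>

lemma laplace_formula_limit:
  assumes meas [measurable]: "\<And>n. h n \<in> borel_measurable borel" "g \<in> borel_measurable borel"
    and h: "\<And>n x. 0 \<le> h n x \<and> h n x \<le> 1"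
    and lap: "\<And>n. laplace_formula (h n)"
    and pts: "AE \<omega> in M. \<forall>i. T i \<omega> \<le> ennreal t \<longrightarrow>
        (\<lambda>n. h n (enn2real (T i \<omega>))) \<longlonglongrightarrow> g (enn2real (T i \<omega>))"
    and ae: "AE \<tau> in lborel. \<tau> \<in> {0..t} \<longrightarrow> (\<lambda>n. h n \<tau>) \<longlonglongrightarrow> g \<tau>"
  shows "laplace_formula g"
proof -
  have "(\<lambda>n. expectation (product_at_points (h n))) \<longlonglongrightarrow> expectation (product_at_points g)"
  proof (rule expectation_tendsto)
    show "AE \<omega> in M. (\<lambda>n. product_at_points (h n) \<omega>) \<longlonglongrightarrow> product_at_points g \<omega>"
      using pts by eventually_elim (auto simp: product_at_points_def intro!: tendsto_prod)
  qed (use product_at_points_bounds h in auto)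
  moreover have "(\<lambda>n. LINT \<tau>:{0..t}|lborel. rate \<tau> * (1 - h n \<tau>))
      \<longlonglongrightarrow> (LINT \<tau>:{0..t}|lborel. rate \<tau> * (1 - g \<tau>))"
    unfolding set_lebesgue_integral_def
  proof (rule integral_dominated_convergence[where w="\<lambda>\<tau>. indicator {0..t} \<tau> * rate \<tau>"])
    have [measurable]: "(\<lambda>\<tau>. indicator {0..t} \<tau> *\<^sub>R rate \<tau>) \<in> borel_measurable lborel"
      using rate_integrable by (simp add: set_integrable_def)
    have *: "indicator {0..t} \<tau> *\<^sub>R (rate \<tau> * (1 - f \<tau>)) = (indicator {0..t} \<tau> *\<^sub>R rate \<tau>) * (1 - f \<tau>)"
      for f \<tau> by simp
    show "(\<lambda>\<tau>. indicator {0..t} \<tau> *\<^sub>R (rate \<tau> * (1 - g \<tau>))) \<in> borel_measurable lborel"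
      unfolding * by measurable
    show "(\<lambda>\<tau>. indicator {0..t} \<tau> *\<^sub>R (rate \<tau> * (1 - h n \<tau>))) \<in> borel_measurable lborel" for n
      unfolding * by measurable
    show "integrable lborel (\<lambda>\<tau>. indicator {0..t} \<tau> * rate \<tau>)"
      using rate_integrable by (simp add: set_integrable_def)
    show "AE \<tau> in lborel. (\<lambda>n. indicator {0..t} \<tau> *\<^sub>R (rate \<tau> * (1 - h n \<tau>)))
        \<longlonglongrightarrow> indicator {0..t} \<tau> *\<^sub>R (rate \<tau> * (1 - g \<tau>))"
      using ae by eventually_elim (auto simp: indicator_def intro!: tendsto_intros)
    show "AE \<tau> in lborel. norm (indicator {0..t} \<tau> *\<^sub>R (rate \<tau> * (1 - h n \<tau>)))
        \<le> indicator {0..t} \<tau> * rate \<tau>" for n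
      using h[of n] rate_nonneg
      by (intro AE_I2) (auto simp: indicator_def abs_mult intro!: mult_left_le)
  qed
  then have "(\<lambda>n. exp (- (LINT \<tau>:{0..t}|lborel. rate \<tau> * (1 - h n \<tau>))))
      \<longlonglongrightarrow> exp (- (LINT \<tau>:{0..t}|lborel. rate \<tau> * (1 - g \<tau>)))"
    by (intro tendsto_intros)
  ultimately show ?thesis
    using lap unfolding laplace_formula_def by (auto intro: LIMSEQ_unique)
qed

lemma count_arrivals_measurable [measurable]:
  "count_arrivals T a b \<in> measurable M (count_space UNIV)"
  unfolding count_arrivals_def[abs_def] by measurable

lemma count_arrivals_pgf:
  assumes ab: "0 \<le> a" "a \<le> b" and c: "0 \<le> c" "c \<le> 1"
  shows "expectation (\<lambda>\<omega>. c ^ count_arrivals T a b \<omega>)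
    = exp (- (1 - c) * (LINT \<tau>:{a..b}|lborel. rate \<tau>))"
proof -
  define \<Lambda> where "\<Lambda> = (LINT \<tau>:{a..b}|lborel. rate \<tau>)"
  let ?N = "count_arrivals T a b"
  have "((\<lambda>k. expectation (\<lambda>\<omega>. indicator {\<omega>\<in>space M. ?N \<omega> = k} \<omega> * c ^ k))
      has_sum expectation (\<lambda>\<omega>. c ^ ?N \<omega>)) UNIV"
  proof (rule has_sum_integral)
    show "((\<lambda>k. indicator {\<omega>\<in>space M. ?N \<omega> = k} \<omega> * c ^ k) has_sum c ^ ?N \<omega>) UNIV"
      if "\<omega> \<in> space M" for \<omega>
      using that by (intro has_sum_finite_neutralI[of "{?N \<omega>}"]) (auto simp: indicator_def)
    show "integrable M (\<lambda>\<omega>. c ^ ?N \<omega>)"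
      by (rule integrable_const_bound[of _ 1]) (use c in \<open>auto simp: power_le_one\<close>)
  qed (use c in auto)
  moreover have "expectation (\<lambda>\<omega>. indicator {\<omega>\<in>space M. ?N \<omega> = k} \<omega> * c ^ k)
      = exp (- \<Lambda>) * ((c * \<Lambda>) ^ k /\<^sub>R fact k)" for k
  proof -
    have "prob {\<omega>\<in>space M. ?N \<omega> = k} = \<Lambda> ^ k / fact k * exp (- \<Lambda>)"
      using arrivals ab by (simp add: poisson_arrivals_def \<Lambda>_def)
    then show ?thesis
      by (simp add: power_mult_distrib field_simps)
  qed
  ultimately have "(\<lambda>k. exp (- \<Lambda>) * ((c * \<Lambda>) ^ k /\<^sub>R fact k)) sums expectation (\<lambda>\<omega>. c ^ ?N \<omega>)"
    by (intro has_sum_imp_sums) simp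
  moreover have "(\<lambda>k. exp (- \<Lambda>) * ((c * \<Lambda>) ^ k /\<^sub>R fact k)) sums (exp (- \<Lambda>) * exp (c * \<Lambda>))"
    by (intro sums_mult exp_converges)
  ultimately have "expectation (\<lambda>\<omega>. c ^ ?N \<omega>) = exp (- \<Lambda>) * exp (c * \<Lambda>)"
    by (rule sums_unique2)
  then show ?thesis
    by (simp add: \<Lambda>_def algebra_simps flip: exp_add)
qed

text \<open>
  The product over the points groups into the powers \<open>c m ^ count\<close> over the intervals on which
  \<open>h\<close> is constant; the counts are independent and Poisson. Intervals are open on the left,
  like those of \<^const>\<open>count_arrivals\<close>, so that no point of the process is counted twice.
\<close>

lemma laplace_formula_step:
  assumes s: "s 0 = 0" "mono s" "s n = t"
    and c: "\<And>m. 0 \<le> c m \<and> c m \<le> 1"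
    and h: "\<And>m x. s m < x \<Longrightarrow> x \<le> s (Suc m) \<Longrightarrow> h x = c m"
    and meas [measurable]: "h \<in> borel_measurable borel" and h01: "\<And>x. 0 \<le> h x \<and> h x \<le> 1"
  shows "laplace_formula h"
proof -
  have s_nonneg: "0 \<le> s m" for m
    using monoD[OF s(2), of 0 m] s(1) by simp
  let ?N = "\<lambda>m. count_arrivals T (s m) (s (Suc m))"
  have "AE \<omega> in M. product_at_points h \<omega> = (\<Prod>m<n. c m ^ ?N m \<omega>)"
    using AE_T_pos AE_finite
  proof eventually_elim
    case (elim \<omega>)
    let ?A = "\<lambda>m. {i. T i \<omega> \<le> ennreal (s m)}"
    have "(\<Prod>i\<in>?A k. h (enn2real (T i \<omega>))) = (\<Prod>m<k. c m ^ ?N m \<omega>)" if "k \<le> n" for k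
      using that
    proof (induction k)
      case 0
      then show ?case
        using elim(1) s(1) by simp
    next
      case (Suc k)
      let ?B = "{i. ennreal (s k) < T i \<omega> \<and> T i \<omega> \<le> ennreal (s (Suc k))}"
      have le: "s k \<le> s (Suc k)" "s (Suc k) \<le> t"
        using monoD[OF s(2)] Suc.prems s(3) by auto
      have union: "?A (Suc k) = ?A k \<union> ?B"
        using ennreal_leI[OF le(1)] by (auto simp: not_le intro: order_trans)
      have fin: "finite (?A (Suc k))"
        by (rule finite_subset[OF _ elim(2)]) (use ennreal_leI[OF le(2)] in \<open>auto intro: order_trans\<close>)
      have hB: "h (enn2real (T i \<omega>)) = c k" if i: "i \<in> ?B" for i
      proof (rule h)
        obtain x where x: "T i \<omega> = ennreal x" "0 \<le> x"
          using i by (cases "T i \<omega>") (auto simp: top_unique)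
        then show "s k < enn2real (T i \<omega>)" "enn2real (T i \<omega>) \<le> s (Suc k)"
          using i s_nonneg by (auto simp: ennreal_less_iff)
      qed
      have "(\<Prod>i\<in>?A (Suc k). h (enn2real (T i \<omega>)))
          = (\<Prod>i\<in>?A k. h (enn2real (T i \<omega>))) * (\<Prod>i\<in>?B. h (enn2real (T i \<omega>)))"
        unfolding union by (rule prod.union_disjoint) (use fin union in auto)
      also have "(\<Prod>i\<in>?B. h (enn2real (T i \<omega>))) = c k ^ ?N k \<omega>"
        using hB by (simp add: count_arrivals_def)
      finally show ?case
        using Suc by simp
    qed
    from this[of n] show ?case
      using s(3) by (simp add: product_at_points_def)
  qed
  then have "expectation (product_at_points h) = expectation (\<lambda>\<omega>. \<Prod>m<n. c m ^ ?N m \<omega>)"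
    by (intro integral_cong_AE) auto
  also have "\<dots> = (\<Prod>m<n. expectation (\<lambda>\<omega>. c m ^ ?N m \<omega>))"
  proof (rule indep_vars_lebesgue_integral)
    have "indep_vars (\<lambda>_. count_space UNIV) ?N {..<n}"
      using arrivals s by (simp add: poisson_arrivals_def)
    then show "indep_vars (\<lambda>_. borel) (\<lambda>m \<omega>. c m ^ ?N m \<omega>) {..<n}"
      by (rule indep_vars_compose2) simp
    show "integrable M (\<lambda>\<omega>. c m ^ ?N m \<omega>)" for m
      by (rule integrable_const_bound[of _ 1]) (use c in \<open>auto simp: power_le_one\<close>)
  qed simp
  also have "\<dots> = (\<Prod>m<n. exp (- (1 - c m) * (LINT \<tau>:{s m..s (Suc m)}|lborel. rate \<tau>)))"
    by (intro prod.cong refl count_arrivals_pgf) (use c s_nonneg monoD[OF s(2)] in auto)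
  also have "\<dots> = exp (\<Sum>m<n. - (1 - c m) * (LINT \<tau>:{s m..s (Suc m)}|lborel. rate \<tau>))"
    by (simp add: exp_sum)
  also have "(\<Sum>m<n. - (1 - c m) * (LINT \<tau>:{s m..s (Suc m)}|lborel. rate \<tau>))
      = - (LINT \<tau>:{0..t}|lborel. rate \<tau> * (1 - h \<tau>))"
  proof -
    have int: "set_integrable lborel {0..t} (\<lambda>\<tau>. rate \<tau> * (1 - h \<tau>))"
      by (rule rate_mult_integrable) (use h01 in \<open>auto simp: algebra_simps\<close>)
    have "(LINT \<tau>:{0..s k}|lborel. rate \<tau> * (1 - h \<tau>))
        = (\<Sum>m<k. (1 - c m) * (LINT \<tau>:{s m..s (Suc m)}|lborel. rate \<tau>))" if "k \<le> n" for k
      using that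
    proof (induction k)
      case 0
      have "(LINT \<tau>:{0}|lborel. rate \<tau> * (1 - h \<tau>)) = 0"
        unfolding set_lebesgue_integral_def
        by (rule integral_eq_zero_AE) (use AE_lborel_singleton[of 0] in eventually_elim, auto)
      then show ?case
        using s(1) by simp
    next
      case (Suc k)
      have le: "s k \<le> s (Suc k)" "s (Suc k) \<le> t"
        using monoD[OF s(2)] Suc.prems s(3) by auto
      have sub: "set_integrable lborel A (\<lambda>\<tau>. rate \<tau> * (1 - h \<tau>))"
        if "A \<in> sets borel" "A \<subseteq> {0..t}" for A
        by (rule set_integrable_subset[OF int]) (use that in auto)
      have "{0..s (Suc k)} = {0..s k} \<union> {s k<..s (Suc k)}"
        using le s_nonneg[of k] by auto
      then have "(LINT \<tau>:{0..s (Suc k)}|lborel. rate \<tau> * (1 - h \<tau>))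
          = (LINT \<tau>:{0..s k}|lborel. rate \<tau> * (1 - h \<tau>))
            + (LINT \<tau>:{s k<..s (Suc k)}|lborel. rate \<tau> * (1 - h \<tau>))"
      proof (simp only:, intro set_integral_Un sub)
        show "{0..s k} \<subseteq> {0..t}" "{s k<..s (Suc k)} \<subseteq> {0..t}"
          using le s_nonneg[of k] by (auto simp: subset_eq)
      qed auto
      also have "(LINT \<tau>:{s k<..s (Suc k)}|lborel. rate \<tau> * (1 - h \<tau>))
          = (LINT \<tau>:{s k<..s (Suc k)}|lborel. (1 - c k) * rate \<tau>)"
        by (rule set_lebesgue_integral_cong) (use h in auto)
      also have "\<dots> = (1 - c k) * (LINT \<tau>:{s k<..s (Suc k)}|lborel. rate \<tau>)"
        by simp
      also have "(LINT \<tau>:{s k<..s (Suc k)}|lborel. rate \<tau>) = (LINT \<tau>:{s k..s (Suc k)}|lborel. rate \<tau>)"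
      proof (rule set_integral_cong_set)
        have "set_integrable lborel {s k<..s (Suc k)} rate" "set_integrable lborel {s k..s (Suc k)} rate"
          by (rule set_integrable_subset[OF rate_integrable]; use le s_nonneg[of k] in auto)+
        then show "set_borel_measurable lborel {s k<..s (Suc k)} rate"
          "set_borel_measurable lborel {s k..s (Suc k)} rate"
          by (auto simp: set_integrable_def set_borel_measurable_def)
        show "AE \<tau> in lborel. (\<tau> \<in> {s k..s (Suc k)}) = (\<tau> \<in> {s k<..s (Suc k)})"
          using AE_lborel_singleton[of "s k"] by eventually_elim auto
      qed
      finally show ?case
        using Suc by simp
    qed
    from this[of n] show ?thesis
      using s(3) by (simp only: mult_minus_left sum_negf)
  qed
  finally show ?thesis
    by (simp add: laplace_formula_def)
qed

lemma laplace_formula_continuous: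
  assumes cont: "continuous_on UNIV g" and g: "\<And>x. 0 \<le> g x \<and> g x \<le> 1"
  shows "laplace_formula g"
proof (cases "t = 0")
  case True
  have [measurable]: "g \<in> borel_measurable borel"
    by (rule borel_measurable_continuous_onI[OF cont])
  show ?thesis
    by (rule laplace_formula_step[of "\<lambda>_. 0" 0 "\<lambda>_. 1"]) (use True g in \<open>auto intro: monoI\<close>)
next
  case False
  then have t: "t > 0"
    using t_nonneg by simp
  have [measurable]: "g \<in> borel_measurable borel"
    by (rule borel_measurable_continuous_onI[OF cont])
  \<comment> \<open>rounding up to the grid of mesh \<open>t / (n + 1)\<close>\<close>
  define r where "r n x = t * of_int \<lceil>real (Suc n) * x / t\<rceil> / real (Suc n)" for n x
  have r: "\<bar>r n x - x\<bar> \<le> t * inverse (real (Suc n))" for n x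
  proof -
    define y where "y = real (Suc n) * x / t"
    have "r n x - x = t / real (Suc n) * (of_int \<lceil>y\<rceil> - y)"
      using t unfolding r_def y_def by (simp add: field_simps del: of_nat_Suc)
    moreover have "0 \<le> of_int \<lceil>y\<rceil> - y" "of_int \<lceil>y\<rceil> - y \<le> 1"
      by linarith+
    ultimately show ?thesis
      using t mult_left_le[of "of_int \<lceil>y\<rceil> - y" "t / real (Suc n)"]
      by (simp add: abs_mult divide_inverse del: of_nat_Suc)
  qed
  have lim: "(\<lambda>n. r n x) \<longlonglongrightarrow> x" for x
  proof -
    have "(\<lambda>n. t * inverse (real (Suc n))) \<longlonglongrightarrow> 0"
      by (intro tendsto_mult_right_zero LIMSEQ_inverse_real_of_nat)
    then have "(\<lambda>n. r n x - x) \<longlonglongrightarrow> 0"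
      by (rule Lim_null_comparison[rotated]) (use r in auto)
    then show ?thesis
      by (rule LIM_zero_cancel)
  qed
  have g_lim: "(\<lambda>n. g (r n x)) \<longlonglongrightarrow> g x" for x
    by (rule continuous_on_tendsto_compose[OF cont lim]) auto
  show ?thesis
  proof (rule laplace_formula_limit[of "\<lambda>n x. g (r n x)"])
    show [measurable]: "(\<lambda>x. g (r n x)) \<in> borel_measurable borel" for n
      unfolding r_def by measurable
    show "laplace_formula (\<lambda>x. g (r n x))" for n
    proof (rule laplace_formula_step[of "\<lambda>m. t * real m / real (Suc n)" "Suc n"
            "\<lambda>m. g (t * real (Suc m) / real (Suc n))"])
      show "mono (\<lambda>m. t * real m / real (Suc n))"
        using t by (intro monoI divide_right_mono mult_left_mono) auto
      fix m x assume x: "t * real m / real (Suc n) < x" "x \<le> t * real (Suc m) / real (Suc n)"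
      have "\<lceil>real (Suc n) * x / t\<rceil> = int (Suc m)"
      proof (rule ceiling_unique)
        show "of_int (int (Suc m)) - 1 < real (Suc n) * x / t"
          using x(1) t by (simp add: pos_less_divide_eq pos_divide_less_eq mult_ac del: of_nat_Suc) simp
        show "real (Suc n) * x / t \<le> of_int (int (Suc m))"
          using x(2) t by (simp add: pos_divide_le_eq pos_le_divide_eq mult_ac del: of_nat_Suc)
      qed
      then show "g (r n x) = g (t * real (Suc m) / real (Suc n))"
        by (simp add: r_def)
    qed (use t g in \<open>auto simp del: of_nat_Suc\<close>)
  qed (use g g_lim in auto)
qed

text \<open>
  For open \<open>U\<close>, the Laplace functional of the indicator of the complement of \<open>U\<close> is the probability
  that no point falls into \<open>U\<close>. Hence some point falls into \<open>U\<close> with probability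
  \<open>1 - exp (- m) \<le> m\<close>, where \<open>m\<close> is the integral of the rate over \<open>U\<close>. By outer regularity, open
  sets \<open>U\<close> covering a null set can be chosen with arbitrarily small \<open>m\<close>.
\<close>

lemma AE_points_avoid_null_set:
  assumes N: "N \<in> null_sets lborel"
  shows "AE \<omega> in M. \<forall>i. T i \<omega> \<le> ennreal t \<longrightarrow> enn2real (T i \<omega>) \<notin> N"
proof -
  have [measurable]: "N \<in> sets borel"
    using N by auto
  define \<mu> where "\<mu> = density lborel (\<lambda>\<tau>. ennreal (indicator {0..t} \<tau> * rate \<tau>))"
  have rate_meas [measurable]: "(\<lambda>\<tau>. indicator {0..t} \<tau> * rate \<tau>) \<in> borel_measurable borel"
    using rate_integrable by (simp add: set_integrable_def borel_measurable_integrable)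
  have nonneg: "0 \<le> indicator {0..t} \<tau> * rate \<tau>" for \<tau>
    using rate_nonneg by (auto simp: indicator_def)
  have \<mu>_eq: "emeasure \<mu> U = ennreal (LINT \<tau>:{0..t}|lborel. rate \<tau> * indicator U \<tau>)"
    if [measurable]: "U \<in> sets borel" for U
  proof -
    have "emeasure \<mu> U = (\<integral>\<^sup>+\<tau>. ennreal (indicator {0..t} \<tau> * rate \<tau> * indicator U \<tau>) \<partial>lborel)"
      unfolding \<mu>_def
      by (subst emeasure_density, use rate_meas in simp, simp)
        (auto intro!: nn_integral_cong simp: indicator_def split: if_splits)
    also have "\<dots> = ennreal (\<integral>\<tau>. indicator {0..t} \<tau> * rate \<tau> * indicator U \<tau> \<partial>lborel)"
      by (rule nn_integral_eq_integral)
        (use rate_mult_integrable[of "indicator U"] rate_nonneg in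
          \<open>auto simp: set_integrable_def mult.assoc indicator_def intro!: AE_I2\<close>)
    finally show ?thesis
      by (simp add: set_lebesgue_integral_def mult.assoc)
  qed
  let ?bad = "\<lambda>U. {\<omega>\<in>space M. \<exists>i. T i \<omega> \<le> ennreal t \<and> enn2real (T i \<omega>) \<in> U}"
  have prob_le: "emeasure M (?bad N) \<le> emeasure \<mu> U" if U: "open U" "N \<subseteq> U" for U
  proof -
    have [measurable]: "U \<in> sets borel"
      using U by simp
    define m where "m = (LINT \<tau>:{0..t}|lborel. rate \<tau> * indicator U \<tau>)"
    have "laplace_formula (indicator (- U))"
    proof (cases "- U = {}")
      case True
      show ?thesis
        unfolding True by (rule laplace_formula_continuous) auto
    next
      \<comment> \<open>the distance to the empty set is \<open>0\<close>, so the approximation needs a nonempty complement\<close>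
      case ne: False
      show ?thesis
      proof (rule laplace_formula_limit[of "\<lambda>n x. max 0 (1 - real n * infdist x (- U))"])
        have cont: "continuous_on UNIV (\<lambda>x. max 0 (1 - real n * infdist x (- U)))" for n
          by (intro continuous_intros)
        show "(\<lambda>x. max 0 (1 - real n * infdist x (- U))) \<in> borel_measurable borel" for n
          by (rule borel_measurable_continuous_onI[OF cont])
        show "laplace_formula (\<lambda>x. max 0 (1 - real n * infdist x (- U)))" for n
          by (rule laplace_formula_continuous[OF cont]) (auto intro!: mult_nonneg_nonneg infdist_nonneg)
        have lim: "(\<lambda>n. max 0 (1 - real n * infdist x (- U))) \<longlonglongrightarrow> indicator (- U) x"
          for x
        proof (cases "x \<in> U")
          case False
          then show ?thesis
            by (auto simp: indicator_def)
        next
          case True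
          have "infdist x (- U) > 0"
            using True U ne by (simp add: infdist_pos_not_in_closed closed_Compl)
          then obtain n0 where n0: "1 / infdist x (- U) < real n0"
            using reals_Archimedean2 by blast
          have "max 0 (1 - real n * infdist x (- U)) = 0" if "n \<ge> n0" for n
          proof -
            have "1 / infdist x (- U) < real n"
              using n0 that by linarith
            then show ?thesis
              using \<open>infdist x (- U) > 0\<close> by (simp add: field_simps)
          qed
          then have "\<forall>\<^sub>F n in sequentially. max 0 (1 - real n * infdist x (- U)) = 0"
            by (auto simp: eventually_sequentially)
          then show ?thesis
            using True by (simp add: tendsto_eventually)
        qed
        show "AE \<omega> in M. \<forall>i. T i \<omega> \<le> ennreal t \<longrightarrow>
            (\<lambda>n. max 0 (1 - real n * infdist (enn2real (T i \<omega>)) (- U)))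
            \<longlonglongrightarrow> indicator (- U) (enn2real (T i \<omega>))"
          using lim by simp
        show "AE \<tau> in lborel. \<tau> \<in> {0..t} \<longrightarrow>
            (\<lambda>n. max 0 (1 - real n * infdist \<tau> (- U))) \<longlonglongrightarrow> indicator (- U) \<tau>"
          using lim by simp
      qed (auto simp: infdist_nonneg)
    qed
    then have lap: "expectation (product_at_points (indicator (- U))) = exp (- m)"
      by (simp add: laplace_formula_def m_def indicator_compl)
    have "AE \<omega> in M. product_at_points (indicator (- U)) \<omega> = 1 - indicator (?bad U) \<omega>"
      using AE_finite AE_space
    proof eventually_elim
      case (elim \<omega>)
      show ?case
      proof (cases "\<omega> \<in> ?bad U")
        case True
        then obtain i where "T i \<omega> \<le> ennreal t" "enn2real (T i \<omega>) \<in> U"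
          by auto
        then have "\<exists>i\<in>{i. T i \<omega> \<le> ennreal t}. indicator (- U) (enn2real (T i \<omega>)) = (0 :: real)"
          by auto
        then have "product_at_points (indicator (- U)) \<omega> = 0"
          unfolding product_at_points_def by (subst prod_zero_iff[OF elim(1)])
        then show ?thesis
          using True by simp
      next
        case False
        then show ?thesis
          using elim by (auto simp: product_at_points_def intro!: prod.neutral)
      qed
    qed
    then have "expectation (product_at_points (indicator (- U))) = expectation (\<lambda>\<omega>. 1 - indicator (?bad U) \<omega>)"
      by (intro integral_cong_AE) auto
    also have "\<dots> = 1 - prob (?bad U)"
      by (subst Bochner_Integration.integral_diff)
        (auto simp: prob_space intro!: integrable_real_indicator simp: less_top[symmetric])
    finally have "prob (?bad U) \<le> m"
      using lap exp_ge_add_one_self[of "- m"] by simp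
    moreover have "prob (?bad N) \<le> prob (?bad U)"
      using U by (intro finite_measure_mono) auto
    ultimately show ?thesis
      unfolding \<mu>_eq[OF \<open>U \<in> sets borel\<close>] m_def[symmetric] emeasure_eq_measure
      by (intro ennreal_leI) simp
  qed
  have "emeasure M (?bad N) \<le> (INF U\<in>{U. N \<subseteq> U \<and> open U}. emeasure \<mu> U)"
    using prob_le by (intro INF_greatest) auto
  also have "\<dots> = emeasure \<mu> N"
    by (rule outer_regular[symmetric]) (use \<mu>_eq[of UNIV] in \<open>auto simp: \<mu>_def\<close>)
  also have "\<dots> = 0"
    using N absolutely_continuousI_density[of "\<lambda>\<tau>. ennreal (indicator {0..t} \<tau> * rate \<tau>)" lborel] rate_meas
    by (auto simp: \<mu>_def absolutely_continuous_def)
  finally have "?bad N \<in> null_sets M"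
    by (auto simp: null_sets_def)
  then show ?thesis
    by (intro AE_I'[of "?bad N"]) auto
qed

text \<open>
  A Borel function is the almost everywhere limit of continuous functions; truncation to \<open>[0, 1]\<close>
  keeps them within the range covered by the formula, and the exceptional null set contains
  no point of the process.
\<close>

theorem laplace_functional:
  assumes [measurable]: "h \<in> borel_measurable borel" and h: "\<And>x. 0 \<le> h x \<and> h x \<le> 1"
  shows "expectation (product_at_points h) = exp (- (LINT \<tau>:{0..t}|lborel. rate \<tau> * (1 - h \<tau>)))"
proof -
  have "h measurable_on UNIV"
    by (rule lebesgue_measurable_imp_measurable_on) (auto intro: measurable_completion)
  then obtain N g where N: "negligible N" and cont: "\<And>n. continuous_on UNIV (g n)"
    and lim: "\<And>x. x \<notin> N \<Longrightarrow> (\<lambda>n. g n x) \<longlonglongrightarrow> h x"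
    unfolding measurable_on_def by auto
  obtain N' where N': "N' \<in> null_sets lborel" "N \<subseteq> N'"
    using N by (auto simp: negligible_iff_null_sets null_sets_completion_iff2)
  have lim': "(\<lambda>n. max 0 (min 1 (g n x))) \<longlonglongrightarrow> h x" if "x \<notin> N'" for x
  proof -
    have "(\<lambda>n. max 0 (min 1 (g n x))) \<longlonglongrightarrow> max 0 (min 1 (h x))"
      using lim that N'(2) by (intro tendsto_intros) auto
    then show ?thesis
      using h[of x] by simp
  qed
  have "laplace_formula h"
  proof (rule laplace_formula_limit[of "\<lambda>n x. max 0 (min 1 (g n x))"])
    have cont': "continuous_on UNIV (\<lambda>x. max 0 (min 1 (g n x)))" for n
      by (intro continuous_intros cont)
    show "laplace_formula (\<lambda>x. max 0 (min 1 (g n x)))" for n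
      by (rule laplace_formula_continuous[OF cont']) auto
    show "(\<lambda>x. max 0 (min 1 (g n x))) \<in> borel_measurable borel" for n
      by (rule borel_measurable_continuous_onI[OF cont'])
    show "AE \<omega> in M. \<forall>i. T i \<omega> \<le> ennreal t \<longrightarrow>
        (\<lambda>n. max 0 (min 1 (g n (enn2real (T i \<omega>))))) \<longlonglongrightarrow> h (enn2real (T i \<omega>))"
      using AE_points_avoid_null_set[OF N'(1)] by eventually_elim (use lim' in auto)
    show "AE \<tau> in lborel. \<tau> \<in> {0..t} \<longrightarrow> (\<lambda>n. max 0 (min 1 (g n \<tau>))) \<longlonglongrightarrow> h \<tau>"
      using AE_not_in[OF N'(1)] by eventually_elim (use lim' in auto)
  qed (use h in auto)
  then show ?thesis
    by (simp add: laplace_formula_def)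
qed

end

section \<open>The generating function of the queue lengths\<close>

text \<open>
  Fubini's theorem for independent sigma-algebras: the law of \<open>\<omega> \<mapsto> (\<omega>, \<omega>)\<close> on the product of the
  two sigma-algebras is the product of the restrictions of the probability measure. In contrast to a
  statement about functions of the two random variables, this applies to any jointly measurable
  \<open>f\<close> on the sample space, such as the location of a customer at a random age.
\<close>

lemma (in prob_space) indep_rv_iterated_expectation:
  fixes f :: "'a \<times> 'a \<Rightarrow> real"
  assumes indep: "indep_rv N Y K Z"
    and f: "f \<in> borel_measurable (vimage_algebra (space M) Y N \<Otimes>\<^sub>M vimage_algebra (space M) Z K)"
    and bound: "\<And>x. norm (f x) \<le> b"
  shows "expectation (\<lambda>\<omega>. f (\<omega>, \<omega>)) = expectation (\<lambda>\<omega>2. expectation (\<lambda>\<omega>1. f (\<omega>1, \<omega>2)))"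
proof -
  let ?A = "vimage_algebra (space M) Y N" and ?B = "vimage_algebra (space M) Z K"
  have Y: "random_variable N Y" and Z: "random_variable K Z"
    and YZ: "indep_set {Y -` A \<inter> space M | A. A \<in> sets N} {Z -` B \<inter> space M | B. B \<in> sets K}"
    using indep by (auto simp: indep_rv_def)
  have id_A [measurable]: "random_variable ?A (\<lambda>\<omega>. \<omega>)" and id_B [measurable]: "random_variable ?B (\<lambda>\<omega>. \<omega>)"
    using Y Z by (auto intro!: measurable_vimage_algebra2)
  have gen: "sigma_sets (space M) {(\<lambda>\<omega>. \<omega>) -` A \<inter> space M | A. A \<in> sets (vimage_algebra (space M) W L)}
      = {W -` A \<inter> space M | A. A \<in> sets L}" if "random_variable L W" for W and L :: "'d measure"
  proof -
    have "(\<lambda>\<omega>. \<omega>) -` A \<inter> space M = A" if "A \<in> sets (vimage_algebra (space M) W L)" for A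
      using sets.sets_into_space[OF that] by auto
    then have "{(\<lambda>\<omega>. \<omega>) -` A \<inter> space M | A. A \<in> sets (vimage_algebra (space M) W L)}
        = sets (vimage_algebra (space M) W L)"
      unfolding Setcompr_eq_image by simp
    moreover have "sigma_sets (space M) (sets (vimage_algebra (space M) W L)) = sets (vimage_algebra (space M) W L)"
      using sets.sigma_sets_eq[of "vimage_algebra (space M) W L"] by simp
    moreover have "sets (vimage_algebra (space M) W L) = {W -` A \<inter> space M | A. A \<in> sets L}"
      by (rule sets_vimage_algebra2) (use measurable_space[OF that] in auto)
    ultimately show ?thesis
      by simp
  qed
  have "indep_var ?A (\<lambda>\<omega>. \<omega>) ?B (\<lambda>\<omega>. \<omega>)"
    unfolding indep_var_eq gen[OF Y] gen[OF Z] using YZ id_A id_B by simp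
  then have joint: "distr M ?A (\<lambda>\<omega>. \<omega>) \<Otimes>\<^sub>M distr M ?B (\<lambda>\<omega>. \<omega>) = distr M (?A \<Otimes>\<^sub>M ?B) (\<lambda>\<omega>. (\<omega>, \<omega>))"
    unfolding indep_var_distribution_eq by simp
  interpret PA: prob_space "distr M ?A (\<lambda>\<omega>. \<omega>)" by (rule prob_space_distr) simp
  interpret PB: prob_space "distr M ?B (\<lambda>\<omega>. \<omega>)" by (rule prob_space_distr) simp
  interpret P: pair_prob_space "distr M ?A (\<lambda>\<omega>. \<omega>)" "distr M ?B (\<lambda>\<omega>. \<omega>)" ..
  have f' [measurable]: "(\<lambda>(x, y). f (x, y)) \<in> borel_measurable (?A \<Otimes>\<^sub>M ?B)"
    using f by simp
  have int: "integrable (distr M ?A (\<lambda>\<omega>. \<omega>) \<Otimes>\<^sub>M distr M ?B (\<lambda>\<omega>. \<omega>)) (\<lambda>(x, y). f (x, y))"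
  proof (rule P.integrable_const_bound[of _ b])
    show "(\<lambda>(x, y). f (x, y)) \<in> borel_measurable (distr M ?A (\<lambda>\<omega>. \<omega>) \<Otimes>\<^sub>M distr M ?B (\<lambda>\<omega>. \<omega>))"
      by (subst measurable_cong_sets[OF sets_pair_measure_cong[OF sets_distr sets_distr] refl]) (rule f')
  qed (use bound in auto)
  have section_meas: "(\<lambda>x. f (x, y)) \<in> borel_measurable ?A" if "y \<in> space M" for y
    using measurable_Pair2[OF f, of y] that by (simp add: measurable_Pair2)
  have "(\<lambda>y. \<integral>x. f (x, y) \<partial>distr M ?A (\<lambda>\<omega>. \<omega>)) \<in> borel_measurable ?B"
    by (rule PA.borel_measurable_lebesgue_integral) measurable
  then have "expectation (\<lambda>\<omega>2. \<integral>x. f (x, \<omega>2) \<partial>distr M ?A (\<lambda>\<omega>. \<omega>))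
      = (\<integral>y. (\<integral>x. f (x, y) \<partial>distr M ?A (\<lambda>\<omega>. \<omega>)) \<partial>distr M ?B (\<lambda>\<omega>. \<omega>))"
    by (subst integral_distr) auto
  also have "\<dots> = (\<integral>xy. f xy \<partial>(distr M ?A (\<lambda>\<omega>. \<omega>) \<Otimes>\<^sub>M distr M ?B (\<lambda>\<omega>. \<omega>)))"
    using P.integral_snd[OF int] by simp
  also have "\<dots> = expectation (\<lambda>\<omega>. f (\<omega>, \<omega>))"
    unfolding joint by (subst integral_distr) (use f in auto)
  also have "expectation (\<lambda>\<omega>2. \<integral>x. f (x, \<omega>2) \<partial>distr M ?A (\<lambda>\<omega>. \<omega>))
      = expectation (\<lambda>\<omega>2. expectation (\<lambda>\<omega>1. f (\<omega>1, \<omega>2)))"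
    by (rule Bochner_Integration.integral_cong[OF refl])
      (use section_meas in \<open>auto intro!: integral_distr\<close>)
  finally show ?thesis ..
qed

lemma (in prob_space) indep_rv_commute: "indep_rv N Y K Z \<Longrightarrow> indep_rv K Z N Y"
proof -
  have "indep_set B A" if "indep_set A B" for A B
    using indep_setD[OF that]
    by (intro indep_setI indep_setD_ev1[OF that] indep_setD_ev2[OF that])
      (metis Int_commute mult.commute)
  then show "indep_rv N Y K Z \<Longrightarrow> indep_rv K Z N Y"
    by (simp add: indep_rv_def)
qed

lemma prod_power_card_fibre:
  fixes z :: "'k \<Rightarrow> 'b :: comm_monoid_mult"
  assumes "finite A" "finite K"
  shows "(\<Prod>k\<in>K. z k ^ card {a\<in>A. f a = k}) = (\<Prod>a\<in>A. if f a \<in> K then z (f a) else 1)"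
proof -
  have "(\<Prod>k\<in>K. z k ^ card {a\<in>A. f a = k}) = (\<Prod>k\<in>K. \<Prod>a\<in>A. if f a = k then z k else 1)"
    using assms(1) by (intro prod.cong refl) (simp add: prod.inter_filter[symmetric])
  also have "\<dots> = (\<Prod>a\<in>A. \<Prod>k\<in>K. if f a = k then z k else 1)"
    by (rule prod.swap)
  also have "\<dots> = (\<Prod>a\<in>A. if f a \<in> K then z (f a) else 1)"
    using assms(2) by (intro prod.cong refl) simp
  finally show ?thesis .
qed

lemma measurable_card_countable:
  fixes A :: "'a \<Rightarrow> 'c :: countable set"
  assumes [measurable]: "\<And>c. Measurable.pred N (\<lambda>\<omega>. c \<in> A \<omega>)"
  shows "(\<lambda>\<omega>. card (A \<omega>)) \<in> measurable N (count_space UNIV)"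
proof -
  have "card (A \<omega>) = card {n. n \<in> range (to_nat :: 'c \<Rightarrow> nat) \<and> from_nat n \<in> A \<omega>}" for \<omega>
  proof -
    have "{n. n \<in> range (to_nat :: 'c \<Rightarrow> nat) \<and> from_nat n \<in> A \<omega>} = to_nat ` A \<omega>"
      by auto
    then show ?thesis
      by (simp add: card_image)
  qed
  then show ?thesis
    by simp
qed

lemma measurable_prod_random_bound:
  fixes f :: "nat \<Rightarrow> 'a \<Rightarrow> real"
  assumes "\<And>l. f l \<in> borel_measurable N" "b \<in> measurable N (count_space UNIV)"
  shows "(\<lambda>x. \<Prod>l<b x. f l x) \<in> borel_measurable N"
  by (rule measurable_compose_countable[where f="\<lambda>n x. \<Prod>l<n. f l x"]) (use assms in auto)

lemma (in infinite_server_network) q_max_measurable: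
  assumes "j \<in> {1..J}" "k \<in> {1..J}"
  shows "(\<lambda>s. q j k (max 0 s)) \<in> borel_measurable borel"
proof -
  have [measurable]: "(\<lambda>s. indicator {0..} s *\<^sub>R q j k s) \<in> borel_measurable borel"
    using q_measurable[OF assms] by (simp add: set_borel_measurable_def)
  have "(\<lambda>s::real. indicator {0..} (max 0 s) *\<^sub>R q j k (max 0 s)) \<in> borel_measurable borel"
    by (rule measurable_compose[of "\<lambda>s. max 0 s" borel borel "\<lambda>s. indicator {0..} s *\<^sub>R q j k s"]) measurable
  then show ?thesis
    by (simp add: indicator_def)
qed

locale network_pgf = infinite_server_network M J rate T p S Svec batch X q
  for M :: "'a measure" and J rate T p S Svec batch X q +
  fixes t :: real and z :: "nat \<Rightarrow> real"
  assumes t: "0 \<le> t" and z: "\<And>k. k \<in> {1..J} \<Longrightarrow> 0 \<le> z k \<and> z k \<le> 1"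
begin

sublocale poisson_points M rate T t
  by unfold_locales (use rate_nonneg rate_integrable arrivals t in auto)

text \<open>
  The truncation at \<open>0\<close> matters only for batches that arrive after time \<open>t\<close>; it keeps ages in the
  domain of the paths.
\<close>

definition age :: "nat \<Rightarrow> 'a \<Rightarrow> real" where
  "age i \<omega> = max 0 (t - enn2real (T i \<omega>))"

definition weight :: "nat \<Rightarrow> real" where
  "weight k = (if k \<in> {1..J} then z k else 1)"

text \<open>
  The mean factor contributed at age \<open>s\<close> by a customer who entered at queue \<open>j\<close>
  (\<open>expectation_weight\<close>).
\<close>

definition entry_pgf :: "nat \<Rightarrow> real \<Rightarrow> real" where
  "entry_pgf j s = 1 - (\<Sum>k=1..J. q j k s * (1 - z k))"

text \<open>
  The mean factor contributed at age \<open>s\<close> by a whole batch: the assumption on \<open>Svec\<close> reduces the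
  generating function of the batch vector to that of the total size.
\<close>

definition batch_pgf :: "real \<Rightarrow> real" where
  "batch_pgf s = measure_pmf.expectation S (\<lambda>n. (\<Sum>j=1..J. p j * entry_pgf j s) ^ n)"

text \<open>
  The factor contributed by the first \<open>n\<close> batches if the paths are those of \<open>\<omega>1\<close> and the arrival
  times and batch sizes those of \<open>\<omega>2\<close>. The diagonal values tend to the random variable whose mean
  is the generating function (\<open>batch_weights_tendsto\<close>); two separate sample points make it possible to
  integrate over one source of randomness at a time.
\<close>

definition batch_weights :: "nat \<Rightarrow> 'a \<Rightarrow> 'a \<Rightarrow> real" where
  "batch_weights n \<omega>1 \<omega>2 = (\<Prod>i<n. if T i \<omega>2 \<le> ennreal t
     then \<Prod>j=1..J. \<Prod>l<batch i j \<omega>2. weight (X i j l (age i \<omega>2) \<omega>1) else 1)"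

abbreviation customers :: "(nat \<times> nat \<times> nat) set" where
  "customers \<equiv> UNIV \<times> {1..J} \<times> UNIV"

abbreviation all_paths :: "'a \<Rightarrow> nat \<times> nat \<times> nat \<Rightarrow> real \<Rightarrow> nat" where
  "all_paths \<equiv> \<lambda>\<omega>. \<lambda>(i, j, l)\<in>customers. path (X i j l) \<omega>"

abbreviation arrivals_batches :: "'a \<Rightarrow> (nat \<Rightarrow> ennreal) \<times> (nat \<Rightarrow> nat \<Rightarrow> nat)" where
  "arrivals_batches \<equiv> \<lambda>\<omega>. (\<lambda>i. T i \<omega>, \<lambda>i. batch_vec J (batch i) \<omega>)"

text \<open>
  These are constants rather than abbreviations so that rewriting does not reach the index sets
  inside the sigma-algebras.
\<close>

definition path_algebra :: "'a measure" where
  "path_algebra = vimage_algebra (space M) all_paths (\<Pi>\<^sub>M c\<in>customers. path_space)"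

definition arrivals_batches_algebra :: "'a measure" where
  "arrivals_batches_algebra = vimage_algebra (space M) arrivals_batches
     ((\<Pi>\<^sub>M i\<in>UNIV. borel) \<Otimes>\<^sub>M (\<Pi>\<^sub>M i\<in>UNIV. batch_space J))"

lemma weight_bounds: "0 \<le> weight k \<and> weight k \<le> 1"
  using z by (simp add: weight_def)

lemma batch_weights_bounds: "0 \<le> batch_weights n \<omega>1 \<omega>2 \<and> batch_weights n \<omega>1 \<omega>2 \<le> 1"
proof -
  have "0 \<le> (\<Prod>j=1..J. \<Prod>l<batch i j \<omega>2. weight (X i j l (age i \<omega>2) \<omega>1))
      \<and> (\<Prod>j=1..J. \<Prod>l<batch i j \<omega>2. weight (X i j l (age i \<omega>2) \<omega>1)) \<le> 1" for i
    using weight_bounds by (auto intro!: prod_nonneg prod_le_1)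
  then show ?thesis
    unfolding batch_weights_def by (auto intro!: prod_nonneg prod_le_1)
qed

subsection \<open>Measurability\<close>

lemma all_paths_measurable: "all_paths \<in> measurable M (\<Pi>\<^sub>M c\<in>customers. path_space)"
  and arrivals_batches_measurable:
    "arrivals_batches \<in> measurable M ((\<Pi>\<^sub>M i\<in>UNIV. borel) \<Otimes>\<^sub>M (\<Pi>\<^sub>M i\<in>UNIV. batch_space J))"
  using path_arrivals_batch_indep by (simp_all only: indep_rv_def)

lemma path_measurable_path_algebra:
  assumes "j \<in> {1..J}"
  shows "(\<lambda>\<omega>. \<omega>) \<in> measurable path_algebra (vimage_algebra (space M) (path (X i j l)) path_space)"
  unfolding path_algebra_def
proof (rule measurable_vimage_algebra2)
  let ?A = "vimage_algebra (space M) all_paths (\<Pi>\<^sub>M c\<in>customers. path_space)"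
  have "(\<lambda>\<omega>. all_paths \<omega> (i, j, l)) \<in> measurable ?A path_space"
  proof (rule measurable_compose[OF measurable_vimage_algebra1 measurable_component_singleton])
    show "all_paths \<in> space M \<rightarrow> space (\<Pi>\<^sub>M c\<in>customers. path_space)"
      by (intro funcsetI measurable_space[OF all_paths_measurable])
  qed (use assms in auto)
  then show "(\<lambda>\<omega>. path (X i j l) \<omega>) \<in> measurable ?A path_space"
    using assms by simp
qed (rule funcsetI, simp)

lemma arrivals_batches_measurable_algebra:
  "arrivals_batches \<in> measurable arrivals_batches_algebra
     ((\<Pi>\<^sub>M i\<in>UNIV. borel) \<Otimes>\<^sub>M (\<Pi>\<^sub>M i\<in>UNIV. batch_space J))"
  unfolding arrivals_batches_algebra_def
  by (intro measurable_vimage_algebra1 funcsetI measurable_space[OF arrivals_batches_measurable])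

lemma T_measurable_algebra [measurable]: "T i \<in> borel_measurable arrivals_batches_algebra"
proof -
  have "(\<lambda>\<omega>. fst (arrivals_batches \<omega>) i) \<in> borel_measurable arrivals_batches_algebra"
    by (rule measurable_compose[OF measurable_compose[OF arrivals_batches_measurable_algebra measurable_fst]
          measurable_component_singleton]) simp
  then show ?thesis by simp
qed

lemma batch_measurable_algebra:
  assumes "j \<in> {1..J}"
  shows "batch i j \<in> measurable arrivals_batches_algebra (count_space UNIV)"
proof -
  have "(\<lambda>\<omega>. snd (arrivals_batches \<omega>) i j) \<in> measurable arrivals_batches_algebra (count_space UNIV)"
    by (rule measurable_compose[OF measurable_compose[OF
          measurable_compose[OF arrivals_batches_measurable_algebra measurable_snd]
          measurable_component_singleton] measurable_component_singleton]) (use assms in auto)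
  then show ?thesis
    using assms by simp
qed

lemma location_measurable:
  assumes j: "j \<in> {1..J}"
  shows "(\<lambda>(\<omega>1, \<omega>2). X i j l (age i \<omega>2) \<omega>1)
    \<in> measurable (path_algebra \<Otimes>\<^sub>M arrivals_batches_algebra) (count_space UNIV)"
proof -
  have "(\<lambda>\<omega>. age i (snd \<omega>))
      \<in> measurable (path_algebra \<Otimes>\<^sub>M arrivals_batches_algebra) (restrict_space borel {0..})"
    by (rule measurable_restrict_space2) (auto simp: age_def)
  moreover have "fst \<in> measurable (path_algebra \<Otimes>\<^sub>M arrivals_batches_algebra)
      (vimage_algebra (space M) (path (X i j l)) path_space)"
    by (rule measurable_compose[OF measurable_fst path_measurable_path_algebra[OF j]])
  ultimately have "(\<lambda>\<omega>. (age i (snd \<omega>), fst \<omega>)) \<in> measurable (path_algebra \<Otimes>\<^sub>M arrivals_batches_algebra)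
      (restrict_space borel {0..} \<Otimes>\<^sub>M vimage_algebra (space M) (path (X i j l)) path_space)"
    by (rule measurable_Pair)
  from measurable_compose[OF this path_measurable[OF j]] show ?thesis
    by (simp add: case_prod_unfold)
qed

lemma batch_weights_measurable:
  "(\<lambda>(\<omega>1, \<omega>2). batch_weights n \<omega>1 \<omega>2)
    \<in> borel_measurable (path_algebra \<Otimes>\<^sub>M arrivals_batches_algebra)"
proof -
  have "(\<lambda>\<omega>. \<Prod>l<batch i j (snd \<omega>). weight (X i j l (age i (snd \<omega>)) (fst \<omega>)))
      \<in> borel_measurable (path_algebra \<Otimes>\<^sub>M arrivals_batches_algebra)" if "j \<in> {1..J}" for i j
  proof (rule measurable_prod_random_bound)
    show "(\<lambda>\<omega>. weight (X i j l (age i (snd \<omega>)) (fst \<omega>)))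
        \<in> borel_measurable (path_algebra \<Otimes>\<^sub>M arrivals_batches_algebra)" for l
      using measurable_compose[OF location_measurable[OF that], of weight borel]
      by (simp add: case_prod_unfold)
    show "(\<lambda>\<omega>. batch i j (snd \<omega>)) \<in> measurable (path_algebra \<Otimes>\<^sub>M arrivals_batches_algebra) (count_space UNIV)"
      by (rule measurable_compose[OF measurable_snd batch_measurable_algebra[OF that]])
  qed
  then show ?thesis
    unfolding batch_weights_def case_prod_unfold by measurable
qed

lemma id_path_algebra: "(\<lambda>\<omega>. \<omega>) \<in> measurable M path_algebra"
  and id_arrivals_batches_algebra: "(\<lambda>\<omega>. \<omega>) \<in> measurable M arrivals_batches_algebra"
  unfolding path_algebra_def arrivals_batches_algebra_def
  by (intro measurable_vimage_algebra2 funcsetI all_paths_measurable arrivals_batches_measurable; assumption)+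

lemma diagonal_measurable: "(\<lambda>\<omega>. (\<omega>, \<omega>)) \<in> measurable M (path_algebra \<Otimes>\<^sub>M arrivals_batches_algebra)"
  by (rule measurable_Pair[OF id_path_algebra id_arrivals_batches_algebra])

lemma batch_measurable: "j \<in> {1..J} \<Longrightarrow> batch i j \<in> measurable M (count_space UNIV)"
  using measurable_compose[OF id_arrivals_batches_algebra batch_measurable_algebra] by simp

lemma queue_length_eq:
  "queue_length J T batch X k t \<omega> =
     card {(i, j, l). T i \<omega> \<le> ennreal t \<and> j \<in> {1..J} \<and> l < batch i j \<omega> \<and> X i j l (age i \<omega>) \<omega> = k}"
proof -
  have age: "age i \<omega> = t - enn2real (T i \<omega>)" if "T i \<omega> \<le> ennreal t" for i
  proof -
    have "enn2real (T i \<omega>) \<le> enn2real (ennreal t)"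
      using that by (intro enn2real_mono) auto
    then show ?thesis
      using t by (simp add: age_def)
  qed
  have "(T i \<omega> \<le> ennreal t \<and> j \<in> {1..J} \<and> l < batch i j \<omega> \<and> X i j l (t - enn2real (T i \<omega>)) \<omega> = k) \<longleftrightarrow>
      (T i \<omega> \<le> ennreal t \<and> j \<in> {1..J} \<and> l < batch i j \<omega> \<and> X i j l (age i \<omega>) \<omega> = k)" for i j l
    by (cases "T i \<omega> \<le> ennreal t") (simp_all only: age simp_thms)
  then show ?thesis
    unfolding queue_length_def by (simp only:)
qed

lemma queue_length_measurable:
  "queue_length J T batch X k t \<in> measurable M (count_space UNIV)"
proof -
  let ?A = "\<lambda>\<omega>. {(i, j, l). T i \<omega> \<le> ennreal t \<and> j \<in> {1..J} \<and> l < batch i j \<omega> \<and> X i j l (age i \<omega>) \<omega> = k}"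
  have pred: "Measurable.pred M
      (\<lambda>\<omega>. T i \<omega> \<le> ennreal t \<and> j \<in> {1..J} \<and> l < batch i j \<omega> \<and> X i j l (age i \<omega>) \<omega> = k)" for i j l
  proof (cases "j \<in> {1..J}")
    case True
    have [measurable]: "(\<lambda>\<omega>. X i j l (age i \<omega>) \<omega>) \<in> measurable M (count_space UNIV)"
      using measurable_compose[OF diagonal_measurable location_measurable[OF True]] by (simp only: split)
    have [measurable]: "batch i j \<in> measurable M (count_space UNIV)"
      by (rule batch_measurable[OF True])
    show ?thesis by measurable
  next
    case False
    then show ?thesis by (simp only: simp_thms) simp
  qed
  have "(\<lambda>\<omega>. card (?A \<omega>)) \<in> measurable M (count_space UNIV)"
  proof (rule measurable_card_countable)
    fix c :: "nat \<times> nat \<times> nat"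
    show "Measurable.pred M (\<lambda>\<omega>. c \<in> ?A \<omega>)"
      using pred by (cases c) (simp only: mem_Collect_eq split)
  qed
  then show ?thesis
    by (simp only: queue_length_eq[abs_def])
qed

subsection \<open>Conditional expectations\<close>

lemma location_measurable_fixed_age:
  assumes "j \<in> {1..J}" "0 \<le> s"
  shows "(\<lambda>\<omega>. X i j l s \<omega>) \<in> measurable M (count_space UNIV)"
proof -
  have "path (X i j l) \<in> measurable M path_space"
    using path_indep assms unfolding indep_vars_def by fastforce
  then have "(\<lambda>\<omega>. path (X i j l) \<omega> s) \<in> measurable M (count_space UNIV)"
    by (rule measurable_compose[OF _ measurable_component_singleton]) (use assms in simp)
  then show ?thesis
    using assms by simp
qed

lemma expectation_weight:
  assumes j: "j \<in> {1..J}" and s: "0 \<le> s"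
  shows "expectation (\<lambda>\<omega>. weight (X i j l s \<omega>)) = entry_pgf j s"
proof -
  have [measurable]: "(\<lambda>\<omega>. X i j l s \<omega>) \<in> measurable M (count_space UNIV)"
    by (rule location_measurable_fixed_age[OF assms])
  have "weight (X i j l s \<omega>) = 1 - (\<Sum>k=1..J. indicator {\<omega>\<in>space M. X i j l s \<omega> = k} \<omega> * (1 - z k))"
    if "\<omega> \<in> space M" for \<omega>
  proof -
    have "(\<Sum>k=1..J. indicator {\<omega>\<in>space M. X i j l s \<omega> = k} \<omega> * (1 - z k))
        = (\<Sum>k=1..J. if k = X i j l s \<omega> then 1 - z k else 0)"
      using that by (intro sum.cong) auto
    then show ?thesis
      by (simp add: weight_def)
  qed
  then have "expectation (\<lambda>\<omega>. weight (X i j l s \<omega>))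
      = expectation (\<lambda>\<omega>. 1 - (\<Sum>k=1..J. indicator {\<omega>\<in>space M. X i j l s \<omega> = k} \<omega> * (1 - z k)))"
    by (intro Bochner_Integration.integral_cong) auto
  also have "\<dots> = 1 - (\<Sum>k=1..J. prob {\<omega>\<in>space M. X i j l s \<omega> = k} * (1 - z k))"
  proof -
    let ?I = "\<lambda>k \<omega>. indicator {\<omega>\<in>space M. X i j l s \<omega> = k} \<omega> * (1 - z k)"
    have int: "integrable M (?I k)" for k
      by (intro integrable_mult_left integrable_real_indicator) (auto simp: less_top[symmetric])
    have "expectation (\<lambda>\<omega>. 1 - (\<Sum>k=1..J. ?I k \<omega>)) = expectation (\<lambda>_. 1) - expectation (\<lambda>\<omega>. \<Sum>k=1..J. ?I k \<omega>)"
      by (intro Bochner_Integration.integral_diff Bochner_Integration.integrable_sum int integrable_const)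
    also have "expectation (\<lambda>\<omega>. \<Sum>k=1..J. ?I k \<omega>) = (\<Sum>k=1..J. expectation (?I k))"
      by (rule Bochner_Integration.integral_sum[OF int])
    finally show ?thesis
      by (simp add: prob_space)
  qed
  also have "(\<Sum>k=1..J. prob {\<omega>\<in>space M. X i j l s \<omega> = k} * (1 - z k)) = (\<Sum>k=1..J. q j k s * (1 - z k))"
    by (intro sum.cong refl) (use path_prob[OF j _ s] in simp)
  finally show ?thesis
    by (simp add: entry_pgf_def)
qed

lemma entry_pgf_bounds:
  assumes "j \<in> {1..J}" "0 \<le> s"
  shows "0 \<le> entry_pgf j s \<and> entry_pgf j s \<le> 1"
proof -
  have [measurable]: "(\<lambda>\<omega>. X 0 j 0 s \<omega>) \<in> measurable M (count_space UNIV)"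
    by (rule location_measurable_fixed_age[OF assms])
  have "integrable M (\<lambda>\<omega>. weight (X 0 j 0 s \<omega>))"
    by (rule integrable_const_bound[of _ 1]) (use weight_bounds in auto)
  then show ?thesis
    unfolding expectation_weight[OF assms, of 0 0, symmetric]
    using weight_bounds by (auto intro!: integral_le_const integral_nonneg_AE AE_I2)
qed

lemma expectation_batch_weights_given_arrivals:
  "expectation (\<lambda>\<omega>1. batch_weights n \<omega>1 \<omega>2)
    = (\<Prod>i<n. if T i \<omega>2 \<le> ennreal t then \<Prod>j=1..J. entry_pgf j (age i \<omega>2) ^ batch i j \<omega>2 else 1)"
proof -
  define C where "C = (SIGMA i:{i\<in>{..<n}. T i \<omega>2 \<le> ennreal t}. SIGMA j:{1..J}. {..<batch i j \<omega>2})"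
  have C: "C \<subseteq> customers" "finite C"
    by (auto simp: C_def)
  have nested: "(\<Prod>i<n. if T i \<omega>2 \<le> ennreal t then \<Prod>j=1..J. \<Prod>l<batch i j \<omega>2. f i j l else 1)
      = (\<Prod>(i, j, l)\<in>C. f i j l)" for f :: "nat \<Rightarrow> nat \<Rightarrow> nat \<Rightarrow> real"
    unfolding C_def by (simp add: prod.Sigma[symmetric] prod.inter_filter[symmetric])
  have "expectation (\<lambda>\<omega>1. batch_weights n \<omega>1 \<omega>2)
      = expectation (\<lambda>\<omega>1. \<Prod>c\<in>C. case c of (i, j, l) \<Rightarrow> weight (X i j l (age i \<omega>2) \<omega>1))"
    unfolding batch_weights_def nested ..
  also have "\<dots> = (\<Prod>c\<in>C. expectation (\<lambda>\<omega>1. case c of (i, j, l) \<Rightarrow> weight (X i j l (age i \<omega>2) \<omega>1)))"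
  proof (rule indep_vars_lebesgue_integral[OF C(2)])
    have "indep_vars (\<lambda>_. path_space) (\<lambda>(i, j, l). path (X i j l)) C"
      by (rule indep_vars_subset[OF path_indep C(1)])
    then have "indep_vars (\<lambda>_. borel) (\<lambda>c \<omega>. weight ((case c of (i, j, l) \<Rightarrow> path (X i j l)) \<omega> (age (fst c) \<omega>2))) C"
    proof (rule indep_vars_compose2)
      have "(\<lambda>x. x (age i \<omega>2)) \<in> measurable path_space (count_space UNIV)" for i
        by (rule measurable_component_singleton) (simp add: age_def)
      then show "(\<lambda>x. weight (x (age (fst c) \<omega>2))) \<in> borel_measurable path_space" for c :: "nat \<times> nat \<times> nat"
        by (rule measurable_compose) simp
    qed
    then show "indep_vars (\<lambda>_. borel) (\<lambda>c \<omega>. case c of (i, j, l) \<Rightarrow> weight (X i j l (age i \<omega>2) \<omega>)) C"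
      by (rule indep_vars_cong[THEN iffD1, rotated 3]) (auto simp: age_def fun_eq_iff)
    fix c assume c: "c \<in> C"
    obtain i j l where ijl: "c = (i, j, l)" "j \<in> {1..J}"
      using c by (cases c) (auto simp: C_def)
    have [measurable]: "(\<lambda>\<omega>. X i j l (age i \<omega>2) \<omega>) \<in> measurable M (count_space UNIV)"
      by (rule location_measurable_fixed_age) (use ijl in \<open>auto simp: age_def\<close>)
    show "integrable M (\<lambda>\<omega>. case c of (i, j, l) \<Rightarrow> weight (X i j l (age i \<omega>2) \<omega>))"
      unfolding ijl(1) prod.case by (rule integrable_const_bound[of _ 1]) (use weight_bounds in auto)
  qed
  also have "\<dots> = (\<Prod>c\<in>C. case c of (i, j, l) \<Rightarrow> entry_pgf j (age i \<omega>2))"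
    by (intro prod.cong refl) (auto simp: C_def age_def intro!: expectation_weight)
  also have "\<dots> = (\<Prod>i<n. if T i \<omega>2 \<le> ennreal t
      then \<Prod>j=1..J. \<Prod>l<batch i j \<omega>2. entry_pgf j (age i \<omega>2) else 1)"
    by (rule nested[symmetric])
  finally show ?thesis
    by (simp only: prod_constant card_lessThan cong: if_cong)
qed

lemma expectation_batches:
  assumes s: "\<And>i. 0 \<le> s i"
  shows "expectation (\<lambda>\<omega>. \<Prod>i<n. if b i then \<Prod>j=1..J. entry_pgf j (s i) ^ batch i j \<omega> else 1)
    = (\<Prod>i<n. if b i then batch_pgf (s i) else 1)"
proof -
  let ?I = "{i\<in>{..<n}. b i}" and ?f = "\<lambda>i x. \<Prod>j=1..J. entry_pgf j (s i) ^ x j"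
  have f_meas: "?f i \<in> borel_measurable (batch_space J)" for i
  proof (intro borel_measurable_prod)
    fix j assume "j \<in> {1..J}"
    from measurable_compose[OF measurable_component_singleton[OF this, of "\<lambda>_. count_space UNIV"],
        of "\<lambda>m. entry_pgf j (s i) ^ m" borel]
    show "(\<lambda>x. entry_pgf j (s i) ^ x j) \<in> borel_measurable (batch_space J)"
      by simp
  qed
  have f_bounds: "0 \<le> ?f i x \<and> ?f i x \<le> 1" for i x
    using entry_pgf_bounds[OF _ s] by (auto intro!: prod_nonneg prod_le_1 power_le_one)
  have batch_rv: "random_variable (batch_space J) (batch_vec J (batch i))" for i
    using batch_indep by (simp add: indep_vars_def)
  have "expectation (\<lambda>\<omega>. \<Prod>i<n. if b i then \<Prod>j=1..J. entry_pgf j (s i) ^ batch i j \<omega> else 1)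
      = expectation (\<lambda>\<omega>. \<Prod>i\<in>?I. ?f i (batch_vec J (batch i) \<omega>))"
  proof -
    have "?f i (batch_vec J (batch i) \<omega>) = (\<Prod>j=1..J. entry_pgf j (s i) ^ batch i j \<omega>)" for i \<omega>
      by (intro prod.cong) auto
    then show ?thesis
      by (simp only: prod.inter_filter finite_lessThan)
  qed
  also have "\<dots> = (\<Prod>i\<in>?I. expectation (\<lambda>\<omega>. ?f i (batch_vec J (batch i) \<omega>)))"
  proof (rule indep_vars_lebesgue_integral)
    show "indep_vars (\<lambda>_. borel) (\<lambda>i \<omega>. ?f i (batch_vec J (batch i) \<omega>)) ?I"
      by (rule indep_vars_compose2[OF indep_vars_subset[OF batch_indep]]) (use f_meas in auto)
    show "integrable M (\<lambda>\<omega>. ?f i (batch_vec J (batch i) \<omega>))" for i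
      by (rule integrable_const_bound[of _ 1])
        (use f_bounds measurable_compose[OF batch_rv f_meas] in auto)
  qed simp
  also have "\<dots> = (\<Prod>i\<in>?I. batch_pgf (s i))"
  proof (rule prod.cong[OF refl])
    fix i
    have "expectation (\<lambda>\<omega>. ?f i (batch_vec J (batch i) \<omega>))
        = (\<integral>x. ?f i x \<partial>distr M (batch_space J) (batch_vec J (batch i)))"
      by (rule integral_distr[symmetric, OF batch_rv f_meas])
    also have "\<dots> = measure_pmf.expectation Svec (\<lambda>x. ?f i (restrict x {1..J}))"
      unfolding batch_distr by (rule integral_distr[OF _ f_meas]) (simp add: space_PiM)
    also have "\<dots> = measure_pmf.expectation Svec (\<lambda>x. \<Prod>j=1..J. entry_pgf j (s i) ^ x j)"
      by simp
    also have "\<dots> = batch_pgf (s i)"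
      unfolding batch_pgf_def by (rule Svec_pgf) (use entry_pgf_bounds[OF _ s] in auto)
    finally show "expectation (\<lambda>\<omega>. ?f i (batch_vec J (batch i) \<omega>)) = batch_pgf (s i)" .
  qed
  finally show ?thesis
    by (simp only: prod.inter_filter finite_lessThan)
qed

lemma entry_pgf_mean:
  "(\<Sum>j=1..J. p j * entry_pgf j s) = 1 - (\<Sum>k=1..J. location_prob J p q k s * (1 - z k))"
proof -
  have "(\<Sum>j=1..J. p j * entry_pgf j s)
      = (\<Sum>j=1..J. p j) - (\<Sum>j=1..J. \<Sum>k=1..J. p j * q j k s * (1 - z k))"
    by (simp add: entry_pgf_def right_diff_distrib sum_subtractf sum_distrib_left mult.assoc)
  also have "(\<Sum>j=1..J. \<Sum>k=1..J. p j * q j k s * (1 - z k))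
      = (\<Sum>k=1..J. location_prob J p q k s * (1 - z k))"
    by (subst sum.swap) (simp add: location_prob_def sum_distrib_right)
  finally show ?thesis
    using p_sum by simp
qed

lemma entry_pgf_measurable:
  assumes "j \<in> {1..J}"
  shows "(\<lambda>s. entry_pgf j (max 0 s)) \<in> borel_measurable borel"
  unfolding entry_pgf_def using assms q_max_measurable
  by (intro borel_measurable_diff borel_measurable_sum borel_measurable_times) auto

lemma mean_entry_pgf_bounds:
  "0 \<le> s \<Longrightarrow> 0 \<le> (\<Sum>j=1..J. p j * entry_pgf j s) \<and> (\<Sum>j=1..J. p j * entry_pgf j s) \<le> 1"
proof -
  assume s: "0 \<le> s"
  have "(\<Sum>j=1..J. p j * entry_pgf j s) \<le> (\<Sum>j=1..J. p j * 1)"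
    by (intro sum_mono mult_left_mono) (use entry_pgf_bounds s p_nonneg in auto)
  moreover have "0 \<le> (\<Sum>j=1..J. p j * entry_pgf j s)"
    by (intro sum_nonneg mult_nonneg_nonneg) (use entry_pgf_bounds s p_nonneg in auto)
  ultimately show ?thesis
    using p_sum by simp
qed

lemma batch_pgf_measurable: "(\<lambda>s. batch_pgf (max 0 s)) \<in> borel_measurable borel"
proof -
  let ?u = "\<lambda>s. \<Sum>j=1..J. p j * entry_pgf j (max 0 s)"
  have u: "?u \<in> borel_measurable borel"
    using entry_pgf_measurable by (intro borel_measurable_sum borel_measurable_times) auto
  have "(\<lambda>x. ?u (fst x) ^ snd x) \<in> borel_measurable (borel \<Otimes>\<^sub>M measure_pmf S)"
  proof (rule measurable_compose_countable[where f="\<lambda>n x. ?u (fst x) ^ n"])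
    show "(\<lambda>x. ?u (fst x) ^ n) \<in> borel_measurable (borel \<Otimes>\<^sub>M measure_pmf S)" for n
      by (intro borel_measurable_power measurable_compose[OF measurable_fst u])
    show "snd \<in> measurable (borel \<Otimes>\<^sub>M measure_pmf S) (count_space UNIV)"
      using measurable_snd[of borel "measure_pmf S"]
      by (simp cong: measurable_cong_sets)
  qed
  then show ?thesis
    unfolding batch_pgf_def
    by (intro sigma_finite_measure.borel_measurable_lebesgue_integral measure_pmf.sigma_finite_measure_axioms)
      (simp add: case_prod_unfold)
qed

lemma batch_pgf_bounds: "0 \<le> s \<Longrightarrow> 0 \<le> batch_pgf s \<and> batch_pgf s \<le> 1"
proof -
  assume s: "0 \<le> s"
  note u = mean_entry_pgf_bounds[OF s]
  have "integrable (measure_pmf S) (\<lambda>n. (\<Sum>j=1..J. p j * entry_pgf j s) ^ n)"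
    by (rule measure_pmf.integrable_const_bound[of _ 1]) (use u in \<open>auto simp: power_le_one abs_le_iff\<close>)
  then show ?thesis
    unfolding batch_pgf_def
    using u by (auto intro!: measure_pmf.integral_le_const integral_nonneg_AE AE_I2 power_le_one)
qed

text \<open>
  The randomness is integrated out in two stages: first the paths, given arrival times and batch
  sizes, then the batch sizes, given the arrival times.
\<close>

lemma expectation_batch_weights:
  "expectation (\<lambda>\<omega>. batch_weights n \<omega> \<omega>)
    = expectation (\<lambda>\<omega>. \<Prod>i<n. if T i \<omega> \<le> ennreal t then batch_pgf (age i \<omega>) else 1)"
proof -
  let ?g = "\<lambda>\<omega>1 \<omega>2. \<Prod>i<n. if T i \<omega>2 \<le> ennreal t
     then \<Prod>j=1..J. entry_pgf j (age i \<omega>2) ^ batch i j \<omega>1 else 1"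
  define A where "A = vimage_algebra (space M) (\<lambda>\<omega> i. T i \<omega>) (\<Pi>\<^sub>M i\<in>UNIV. borel)"
  define B where "B = vimage_algebra (space M) (\<lambda>\<omega> i. batch_vec J (batch i) \<omega>) (\<Pi>\<^sub>M i\<in>UNIV. batch_space J)"
  have T_A [measurable]: "T i \<in> borel_measurable A" for i
    using measurable_compose[OF measurable_vimage_algebra1 measurable_component_singleton,
        of "\<lambda>\<omega> i. T i \<omega>" "space M" UNIV "\<lambda>_. borel" i]
    by (simp add: A_def space_PiM)
  have batch_B: "batch i j \<in> measurable B (count_space UNIV)" if j: "j \<in> {1..J}" for i j
  proof -
    have rv: "(\<lambda>\<omega> i. batch_vec J (batch i) \<omega>) \<in> measurable M (\<Pi>\<^sub>M i\<in>UNIV. batch_space J)"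
      using arrivals_batch_indep by (simp only: indep_rv_def)
    have "(\<lambda>\<omega> i. batch_vec J (batch i) \<omega>) \<in> measurable B (\<Pi>\<^sub>M i\<in>UNIV. batch_space J)"
      unfolding B_def by (intro measurable_vimage_algebra1 funcsetI measurable_space[OF rv])
    from measurable_compose[OF measurable_compose[OF this measurable_component_singleton[OF UNIV_I]]
        measurable_component_singleton[OF j]]
    show ?thesis
      using j by simp
  qed
  have power_meas: "(\<lambda>x. entry_pgf j (age i (snd x)) ^ batch i j (fst x)) \<in> borel_measurable (B \<Otimes>\<^sub>M A)"
    if j: "j \<in> {1..J}" for i j
  proof (rule measurable_compose_countable[where f="\<lambda>m x. entry_pgf j (age i (snd x)) ^ m"])
    show "(\<lambda>x. batch i j (fst x)) \<in> measurable (B \<Otimes>\<^sub>M A) (count_space UNIV)"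
      by (rule measurable_compose[OF measurable_fst batch_B[OF j]])
    have "(\<lambda>x. entry_pgf j (age i (snd x))) \<in> borel_measurable (B \<Otimes>\<^sub>M A)"
      unfolding age_def by (rule measurable_compose[OF _ entry_pgf_measurable[OF j]]) measurable
    then show "(\<lambda>x. entry_pgf j (age i (snd x)) ^ m) \<in> borel_measurable (B \<Otimes>\<^sub>M A)" for m
      by (rule borel_measurable_power)
  qed
  have g_meas: "(\<lambda>x. ?g (fst x) (snd x)) \<in> borel_measurable (B \<Otimes>\<^sub>M A)"
  proof (intro borel_measurable_prod measurable_If)
    show "{x \<in> space (B \<Otimes>\<^sub>M A). T i (snd x) \<le> ennreal t} \<in> sets (B \<Otimes>\<^sub>M A)" for i
      by measurable
  qed (use power_meas in auto)
  have g_bounds: "norm (?g \<omega>1 \<omega>2) \<le> 1" for \<omega>1 \<omega>2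
  proof -
    have "0 \<le> (\<Prod>j=1..J. entry_pgf j (age i \<omega>2) ^ batch i j \<omega>1)
        \<and> (\<Prod>j=1..J. entry_pgf j (age i \<omega>2) ^ batch i j \<omega>1) \<le> 1" for i
      using entry_pgf_bounds[of _ "age i \<omega>2"]
      by (auto simp: age_def intro!: prod_nonneg prod_le_1 power_le_one)
    then have "0 \<le> ?g \<omega>1 \<omega>2 \<and> ?g \<omega>1 \<omega>2 \<le> 1"
      by (auto intro!: prod_nonneg prod_le_1)
    then show ?thesis by simp
  qed
  have "expectation (\<lambda>\<omega>. batch_weights n \<omega> \<omega>) = expectation (\<lambda>\<omega>2. expectation (\<lambda>\<omega>1. batch_weights n \<omega>1 \<omega>2))"
    using indep_rv_iterated_expectation[OF path_arrivals_batch_indep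
        batch_weights_measurable[of n, unfolded path_algebra_def arrivals_batches_algebra_def], of 1]
      batch_weights_bounds by auto
  also have "\<dots> = expectation (\<lambda>\<omega>. ?g \<omega> \<omega>)"
    unfolding expectation_batch_weights_given_arrivals ..
  also have "\<dots> = expectation (\<lambda>\<omega>2. expectation (\<lambda>\<omega>1. ?g \<omega>1 \<omega>2))"
    using indep_rv_iterated_expectation[OF indep_rv_commute[OF arrivals_batch_indep]
        g_meas[unfolded A_def B_def] g_bounds]
    by (simp only: fst_conv snd_conv)
  also have "\<dots> = expectation (\<lambda>\<omega>. \<Prod>i<n. if T i \<omega> \<le> ennreal t then batch_pgf (age i \<omega>) else 1)"
    by (subst expectation_batches) (auto simp: age_def)
  finally show ?thesis .
qed

text \<open>
  Almost surely only finitely many batches arrive before \<open>t\<close>, so the truncated product is eventually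
  constant; collecting the customers by location gives the powers of the \<open>z k\<close>.
\<close>

lemma batch_weights_tendsto:
  "AE \<omega> in M. (\<lambda>n. batch_weights n \<omega> \<omega>) \<longlonglongrightarrow> (\<Prod>k=1..J. z k ^ queue_length J T batch X k t \<omega>)"
  using AE_finite
proof eventually_elim
  case (elim \<omega>)
  define C where "C = (SIGMA i:{i. T i \<omega> \<le> ennreal t}. SIGMA j:{1..J}. {..<batch i j \<omega>})"
  have "finite C"
    using elim by (auto simp: C_def)
  let ?f = "\<lambda>(i, j, l). X i j l (age i \<omega>) \<omega>"
  have "(\<Prod>k=1..J. z k ^ queue_length J T batch X k t \<omega>) = (\<Prod>k\<in>{1..J}. z k ^ card {c\<in>C. ?f c = k})"
    unfolding queue_length_eq
    by (intro prod.cong refl arg_cong2[where f="(^)"] arg_cong[where f=card]) (auto simp: C_def)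
  also have "\<dots> = (\<Prod>c\<in>C. weight (?f c))"
    unfolding weight_def by (rule prod_power_card_fibre) (use \<open>finite C\<close> in auto)
  also have "\<dots> = (\<Prod>i\<in>{i. T i \<omega> \<le> ennreal t}. \<Prod>j=1..J. \<Prod>l<batch i j \<omega>. weight (X i j l (age i \<omega>) \<omega>))"
    using elim unfolding C_def by (simp add: prod.Sigma case_prod_unfold)
  finally show ?case
    unfolding batch_weights_def by (simp only: tendsto_eventually[OF eventually_prod_truncated[OF elim]])
qed

theorem queue_lengths_pgf:
  "expectation (\<lambda>\<omega>. \<Prod>k=1..J. z k ^ queue_length J T batch X k t \<omega>)
    = exp (- (LINT \<tau>:{0..t}|lborel. rate \<tau> *
        (1 - measure_pmf.expectation S (\<lambda>n. (1 - (\<Sum>k=1..J. location_prob J p q k (t - \<tau>) * (1 - z k))) ^ n))))"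
proof -
  let ?h = "\<lambda>x. batch_pgf (max 0 (t - x))"
  have [measurable]: "?h \<in> borel_measurable borel"
    by (rule measurable_compose[OF _ batch_pgf_measurable]) simp
  have h: "0 \<le> ?h x \<and> ?h x \<le> 1" for x
    by (rule batch_pgf_bounds) simp
  let ?r = "\<lambda>n \<omega>. \<Prod>i<n. if T i \<omega> \<le> ennreal t then batch_pgf (age i \<omega>) else 1"
  have [measurable]: "(\<lambda>\<omega>. batch_pgf (age i \<omega>)) \<in> borel_measurable M" for i
    unfolding age_def by (rule measurable_compose[OF _ batch_pgf_measurable]) simp
  have "(\<lambda>n. expectation (?r n)) \<longlonglongrightarrow> expectation (product_at_points ?h)"
  proof (rule expectation_tendsto)
    show "0 \<le> ?r n \<omega> \<and> ?r n \<omega> \<le> 1" for n \<omega>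
      using h by (auto simp: age_def intro!: prod_nonneg prod_le_1)
    show "AE \<omega> in M. (\<lambda>n. ?r n \<omega>) \<longlonglongrightarrow> product_at_points ?h \<omega>"
      using AE_finite
    proof eventually_elim
      case (elim \<omega>)
      show ?case
        using eventually_prod_truncated[OF elim, of "\<lambda>i. batch_pgf (age i \<omega>)"]
        by (simp add: product_at_points_def age_def tendsto_eventually)
    qed
  qed auto
  moreover have "(\<lambda>n. expectation (?r n))
      \<longlonglongrightarrow> expectation (\<lambda>\<omega>. \<Prod>k=1..J. z k ^ queue_length J T batch X k t \<omega>)"
    unfolding expectation_batch_weights[symmetric]
  proof (rule expectation_tendsto)
    show "(\<lambda>\<omega>. batch_weights n \<omega> \<omega>) \<in> borel_measurable M" for n
      using measurable_compose[OF diagonal_measurable batch_weights_measurable] by simp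
    show "(\<lambda>\<omega>. \<Prod>k=1..J. z k ^ queue_length J T batch X k t \<omega>) \<in> borel_measurable M"
    proof (intro borel_measurable_prod)
      show "(\<lambda>\<omega>. z k ^ queue_length J T batch X k t \<omega>) \<in> borel_measurable M" for k
        by (rule measurable_compose[OF queue_length_measurable]) simp
    qed
  qed (use batch_weights_bounds batch_weights_tendsto in auto)
  ultimately have "expectation (\<lambda>\<omega>. \<Prod>k=1..J. z k ^ queue_length J T batch X k t \<omega>)
      = expectation (product_at_points ?h)"
    by (rule LIMSEQ_unique[rotated])
  also have "\<dots> = exp (- (LINT \<tau>:{0..t}|lborel. rate \<tau> * (1 - ?h \<tau>)))"
    by (rule laplace_functional[OF _ h]) simp
  also have "(LINT \<tau>:{0..t}|lborel. rate \<tau> * (1 - ?h \<tau>)) = (LINT \<tau>:{0..t}|lborel. rate \<tau> *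
        (1 - measure_pmf.expectation S (\<lambda>n. (1 - (\<Sum>k=1..J. location_prob J p q k (t - \<tau>) * (1 - z k))) ^ n)))"
    unfolding batch_pgf_def entry_pgf_mean
    by (rule set_lebesgue_integral_cong) (auto simp: max_absorb2)
  finally show ?thesis .
qed

end

section \<open>Logarithmic batch sizes\<close>

text \<open>
  The law is prescribed on \<open>{1, 2, \<dots>}\<close> only. The logarithmic series at \<open>u = 1\<close> shows that it has total
  mass one there, which forces \<open>pmf S 0 = 0\<close>.
\<close>

lemma log_pgf:
  fixes S :: "nat pmf"
  assumes \<rho>: "0 < \<rho>" "\<rho> < 1"
    and S: "\<And>m. m \<ge> 1 \<Longrightarrow> pmf S m = - (1 / ln (1 - \<rho>)) * (\<rho> ^ m / real m)"
    and u: "0 \<le> u" "u \<le> 1"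
  shows "measure_pmf.expectation S (\<lambda>n. u ^ n) = ln (1 - \<rho> * u) / ln (1 - \<rho>)"
proof -
  have ln_neg: "ln (1 - \<rho>) < 0"
    using \<rho> by simp
  have expansion: "measure_pmf.expectation S (\<lambda>n. x ^ n) = ln (1 - \<rho> * x) / ln (1 - \<rho>) + pmf S 0"
    if x: "0 \<le> x" "x \<le> 1" for x :: real
  proof -
    have "((\<lambda>n. measure_pmf.expectation S (\<lambda>m. indicator {n} m * x ^ n))
        has_sum measure_pmf.expectation S (\<lambda>n. x ^ n)) UNIV"
    proof (rule has_sum_integral)
      show "((\<lambda>n. indicator {n} m * x ^ n) has_sum x ^ m) UNIV" for m :: nat
        by (rule has_sum_finite_neutralI[of "{m}"]) (auto simp: indicator_def)
      show "integrable (measure_pmf S) (\<lambda>n. x ^ n)"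
        by (rule measure_pmf.integrable_const_bound[of _ 1]) (use x in \<open>auto simp: power_le_one\<close>)
    qed (use x in auto)
    then have "(\<lambda>n. pmf S n * x ^ n) sums measure_pmf.expectation S (\<lambda>n. x ^ n)"
      by (intro has_sum_imp_sums) (simp add: pmf.rep_eq)
    moreover have "(\<lambda>n. (1 / ln (1 - \<rho>)) * (- ((- (- (\<rho> * x))) ^ n) / real n)) sums ((1 / ln (1 - \<rho>)) * ln (1 + - (\<rho> * x)))"
    proof (intro sums_mult ln_series')
      have "\<rho> * x \<le> \<rho>" "0 \<le> \<rho> * x"
        using \<rho> x by (simp_all add: mult_left_le)
      then show "\<bar>- (\<rho> * x)\<bar> < 1"
        using \<rho> by linarith
    qed
    ultimately have "(\<lambda>n. pmf S n * x ^ n - (1 / ln (1 - \<rho>)) * (- ((- (- (\<rho> * x))) ^ n) / real n)) sums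
        (measure_pmf.expectation S (\<lambda>n. x ^ n) - (1 / ln (1 - \<rho>)) * ln (1 + - (\<rho> * x)))"
      by (rule sums_diff)
    also have "(\<lambda>n. pmf S n * x ^ n - (1 / ln (1 - \<rho>)) * (- ((- (- (\<rho> * x))) ^ n) / real n))
        = (\<lambda>n. if n = 0 then pmf S 0 else 0)"
    proof
      fix n
      show "pmf S n * x ^ n - (1 / ln (1 - \<rho>)) * (- ((- (- (\<rho> * x))) ^ n) / real n)
          = (if n = 0 then pmf S 0 else 0)"
        using S[of n] by (cases "n = 0") (auto simp: power_mult_distrib)
    qed
    finally have "measure_pmf.expectation S (\<lambda>n. x ^ n) - (1 / ln (1 - \<rho>)) * ln (1 + - (\<rho> * x)) = pmf S 0"
      using sums_single[of 0 "\<lambda>_. pmf S 0"] by (rule sums_unique2)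
    then show ?thesis
      by simp
  qed
  have "pmf S 0 = 0"
    using expansion[of 1] ln_neg by simp
  then show ?thesis
    using expansion[OF u] by simp
qed

lemma (in infinite_server_network) location_prob_bounds:
  assumes s: "0 \<le> s"
  shows "k \<in> {1..J} \<Longrightarrow> 0 \<le> location_prob J p q k s"
    and "(\<Sum>k=1..J. location_prob J p q k s) \<le> 1"
proof -
  show "0 \<le> location_prob J p q k s" if k: "k \<in> {1..J}"
    unfolding location_prob_def
  proof (intro sum_nonneg mult_nonneg_nonneg p_nonneg)
    show "0 \<le> q j k s" if "j \<in> {1..J}" for j
      using path_prob[OF that k s, of 0 0] measure_nonneg by metis
  qed auto
  interpret network_pgf M J rate T p S Svec batch X q 0 "\<lambda>_. 0"
    by unfold_locales auto
  show "(\<Sum>k=1..J. location_prob J p q k s) \<le> 1"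
    using mean_entry_pgf_bounds[OF s] unfolding entry_pgf_mean by simp
qed

lemma (in infinite_server_network) location_prob_measurable:
  assumes k: "k \<in> {1..J}"
  shows "(\<lambda>s. location_prob J p q k (max 0 s)) \<in> borel_measurable borel"
  unfolding location_prob_def using k q_max_measurable
  by (intro borel_measurable_sum borel_measurable_times) auto

text \<open>
  The queue \<open>v\<close> is the one whose variable is singled out; the queues above it are required to be
  empty.
\<close>

locale log_network = infinite_server_network M J rate T p S Svec batch X q
  for M :: "'a measure" and J rate T p S Svec batch X q +
  fixes \<rho> t :: real and v :: nat
  assumes \<rho>: "0 < \<rho>" "\<rho> < 1"
    and S_Log: "\<And>m. m \<ge> 1 \<Longrightarrow> pmf S m = - (1 / ln (1 - \<rho>)) * (\<rho> ^ m / real m)"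
    and t: "0 \<le> t"
    and v: "v \<in> {1..J}"
begin

abbreviation "N k \<omega> \<equiv> queue_length J T batch X k t \<omega>"

text \<open>
  Integrals against the rate become integrals over a finite measure, for which bounded functions are
  integrable.
\<close>

definition rate_measure :: "real measure" where
  "rate_measure = density lborel (\<lambda>\<tau>. ennreal (indicator {0..t} \<tau> * rate \<tau>))"

text \<open>
  The probability that a customer arriving at time \<open>\<tau>\<close> is in queue \<open>k\<close> at time \<open>t\<close>, extended
  constantly beyond \<open>t\<close> so as to be Borel measurable on the whole line.
\<close>

definition Q :: "nat \<Rightarrow> real \<Rightarrow> real" where
  "Q k \<tau> = location_prob J p q k (max 0 (t - \<tau>))"

definition denom :: "real \<Rightarrow> real" where
  "denom \<tau> = 1 - \<rho> * (1 - (\<Sum>k=1..J. Q k \<tau>))"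

text \<open>
  With \<open>z v = x\<close> and \<open>z k = 0\<close> for \<open>k > v\<close>, the argument of the logarithm in the exponent of the
  generating function is \<open>marginal_denom z \<tau> - \<rho> * Q v \<tau> * x\<close>.
\<close>

definition marginal_denom :: "(nat \<Rightarrow> real) \<Rightarrow> real \<Rightarrow> real" where
  "marginal_denom z \<tau> = denom \<tau> - (\<Sum>k\<in>{1..<v}. \<rho> * Q k \<tau> * z k)"

definition \<kappa> :: real where
  "\<kappa> = - (1 / ln (1 - \<rho>))"

lemma \<kappa>_pos: "0 < \<kappa>"
  using \<rho> by (simp add: \<kappa>_def divide_less_0_iff)

lemma rate_density_measurable: "(\<lambda>\<tau>. indicator {0..t} \<tau> * rate \<tau>) \<in> borel_measurable borel"
  using rate_integrable[OF t] by (simp add: set_integrable_def borel_measurable_integrable)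

lemma rate_density_nonneg: "0 \<le> indicator {0..t} \<tau> * rate \<tau>"
  using rate_nonneg by (auto simp: indicator_def)

lemma sets_rate_measure [measurable_cong]: "sets rate_measure = sets borel"
  by (simp add: rate_measure_def)

lemma space_rate_measure [simp]: "space rate_measure = UNIV"
  by (simp add: rate_measure_def)

lemma finite_rate_measure: "finite_measure rate_measure"
proof
  have "emeasure rate_measure UNIV = (\<integral>\<^sup>+\<tau>. ennreal (indicator {0..t} \<tau> * rate \<tau>) \<partial>lborel)"
    unfolding rate_measure_def by (subst emeasure_density) (use rate_density_measurable in auto)
  also have "\<dots> = ennreal (\<integral>\<tau>. indicator {0..t} \<tau> * rate \<tau> \<partial>lborel)"
    by (rule nn_integral_eq_integral)
      (use rate_integrable[OF t] rate_density_nonneg in \<open>auto simp: set_integrable_def\<close>)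
  finally show "emeasure rate_measure (space rate_measure) \<noteq> \<infinity>"
    by simp
qed

lemma rate_integral:
  assumes "f \<in> borel_measurable borel"
  shows "(LINT \<tau>:{0..t}|lborel. rate \<tau> * f \<tau>) = (\<integral>\<tau>. f \<tau> \<partial>rate_measure)"
  unfolding rate_measure_def set_lebesgue_integral_def
  by (subst integral_density) (use assms rate_density_measurable rate_density_nonneg in \<open>auto simp: mult.assoc\<close>)

lemma Q_measurable: "k \<in> {1..J} \<Longrightarrow> Q k \<in> borel_measurable borel"
  unfolding Q_def[abs_def] by (rule measurable_compose[OF _ location_prob_measurable]) auto

lemma Q_v_measurable [measurable]: "Q v \<in> borel_measurable borel"
  by (rule Q_measurable[OF v])

lemma Q_nonneg: "k \<in> {1..J} \<Longrightarrow> 0 \<le> Q k \<tau>"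
  unfolding Q_def by (rule location_prob_bounds) auto

lemma Q_sum: "(\<Sum>k=1..J. Q k \<tau>) \<le> 1"
  unfolding Q_def by (rule location_prob_bounds) auto

lemma denom_measurable [measurable]: "denom \<in> borel_measurable borel"
proof -
  have "(\<lambda>\<tau>. \<Sum>k=1..J. Q k \<tau>) \<in> borel_measurable borel"
    by (intro borel_measurable_sum Q_measurable)
  then show ?thesis
    unfolding denom_def[abs_def] by measurable
qed

lemma denom_pos: "0 < denom \<tau>"
proof -
  have "0 \<le> (\<Sum>k=1..J. Q k \<tau>)"
    by (intro sum_nonneg Q_nonneg)
  then have "\<rho> * (1 - (\<Sum>k=1..J. Q k \<tau>)) \<le> \<rho>"
    using \<rho> by (intro mult_left_le) auto
  then show ?thesis
    using \<rho> unfolding denom_def by linarith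
qed

lemma marginal_denom_measurable [measurable]: "marginal_denom z \<in> borel_measurable borel"
proof -
  have "(\<lambda>\<tau>. \<Sum>k\<in>{1..<v}. \<rho> * Q k \<tau> * z k) \<in> borel_measurable borel"
    using v by (intro borel_measurable_sum borel_measurable_times Q_measurable) auto
  then show ?thesis
    unfolding marginal_denom_def[abs_def] by measurable
qed

text \<open>
  The lower bound keeps the argument of the logarithm above \<open>1 - \<rho>\<close> for all \<open>x\<close> in \<open>[0, 1]\<close>, and makes
  the ratio \<open>\<rho> * Q v \<tau> / marginal_denom z \<tau>\<close> at most \<open>1\<close>.
\<close>

lemma marginal_denom_bounds:
  assumes z: "\<And>k. k \<in> {1..<v} \<Longrightarrow> 0 \<le> z k \<and> z k \<le> 1"
  shows "1 - \<rho> + \<rho> * Q v \<tau> \<le> marginal_denom z \<tau>" "marginal_denom z \<tau> \<le> 1"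
proof -
  have z_le: "(\<Sum>k\<in>{1..<v}. \<rho> * Q k \<tau> * z k) \<le> (\<Sum>k\<in>{1..<v}. \<rho> * Q k \<tau>)"
    using z v \<rho> Q_nonneg by (intro sum_mono mult_left_le) auto
  have "(\<Sum>k\<in>{1..<v}. Q k \<tau>) + Q v \<tau> = (\<Sum>k\<in>{1..v}. Q k \<tau>)"
    using v by (simp add: sum.last_plus)
  moreover have "(\<Sum>k\<in>{1..v}. Q k \<tau>) \<le> (\<Sum>k=1..J. Q k \<tau>)"
    using v by (intro sum_mono2) (auto intro: Q_nonneg)
  ultimately have "(\<Sum>k\<in>{1..<v}. Q k \<tau>) \<le> (\<Sum>k=1..J. Q k \<tau>) - Q v \<tau>"
    by linarith
  then have "\<rho> * (\<Sum>k\<in>{1..<v}. Q k \<tau>) \<le> \<rho> * ((\<Sum>k=1..J. Q k \<tau>) - Q v \<tau>)"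
    using \<rho> by (intro mult_left_mono) auto
  with z_le have "(\<Sum>k\<in>{1..<v}. \<rho> * Q k \<tau> * z k) \<le> \<rho> * ((\<Sum>k=1..J. Q k \<tau>) - Q v \<tau>)"
    unfolding sum_distrib_left[symmetric] by linarith
  then show "1 - \<rho> + \<rho> * Q v \<tau> \<le> marginal_denom z \<tau>"
    by (simp add: marginal_denom_def denom_def algebra_simps)
  have "0 \<le> (\<Sum>k\<in>{1..<v}. \<rho> * Q k \<tau> * z k)"
    using z v \<rho> by (intro sum_nonneg mult_nonneg_nonneg) (auto intro: Q_nonneg)
  moreover have "0 \<le> \<rho> * (1 - (\<Sum>k=1..J. Q k \<tau>))"
    using \<rho> Q_sum by simp
  ultimately show "marginal_denom z \<tau> \<le> 1"
    by (simp add: marginal_denom_def denom_def)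
qed

text \<open>
  The coefficient at \<open>i \<noteq> 0\<close> of the logarithm of the generating function, as a power series in
  \<open>z 1, \<dots>, z v\<close>. It is also the mean number of batches arriving before \<open>t\<close> of which, at time \<open>t\<close>,
  exactly \<open>i k\<close> customers are in queue \<open>k\<close> for each \<open>k \<le> v\<close>, and none in the other queues.
\<close>

definition log_coeff :: "(nat \<Rightarrow> nat) \<Rightarrow> real" where
  "log_coeff i = (\<integral>\<tau>. \<kappa> * (\<rho> ^ (\<Sum>k=1..v. i k) * (\<Prod>k=1..v. Q k \<tau> ^ i k / fact (i k)) *
     (fact ((\<Sum>k=1..v. i k) - 1) / denom \<tau> ^ (\<Sum>k=1..v. i k))) \<partial>rate_measure)"

text \<open>
  The coefficient at \<open>x ^ j\<close> of the same logarithm as a power series in \<open>x = z v\<close> alone, for fixed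
  \<open>z 1, \<dots>, z (v - 1)\<close>; at \<open>j = 0\<close> division by zero makes it \<open>0\<close>, as is right for the logarithm minus
  its value at \<open>x = 0\<close>.
\<close>

definition log_coeff_marginal :: "(nat \<Rightarrow> real) \<Rightarrow> nat \<Rightarrow> real" where
  "log_coeff_marginal z j = (\<integral>\<tau>. \<kappa> * ((\<rho> * Q v \<tau> / marginal_denom z \<tau>) ^ j / real j) \<partial>rate_measure)"

text \<open>
  The coefficient at \<open>x ^ n\<close> of the generating function itself, for fixed \<open>z 1, \<dots>, z (v - 1)\<close>.
\<close>

definition state_marginal :: "(nat \<Rightarrow> real) \<Rightarrow> nat \<Rightarrow> real" where
  "state_marginal z n = expectation (\<lambda>\<omega>. (\<Prod>k\<in>{1..<v}. z k ^ N k \<omega>) *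
     indicator {\<omega>\<in>space M. N v \<omega> = n \<and> (\<forall>k\<in>{v<..J}. N k \<omega> = 0)} \<omega>)"

abbreviation P :: "(nat \<Rightarrow> nat) \<Rightarrow> real" where
  "P m \<equiv> state_prob M J T batch X t (\<lambda>k. if k \<le> v then m k else 0)"

lemma log_coeff_nonneg: "0 \<le> log_coeff i"
proof -
  have "0 \<le> \<kappa> * (\<rho> ^ (\<Sum>k=1..v. i k) * (\<Prod>k=1..v. Q k \<tau> ^ i k / fact (i k)) *
     (fact ((\<Sum>k=1..v. i k) - 1) / denom \<tau> ^ (\<Sum>k=1..v. i k)))" for \<tau>
    using \<rho> v \<kappa>_pos denom_pos[of \<tau>]
    by (intro mult_nonneg_nonneg divide_nonneg_nonneg prod_nonneg)
      (auto intro!: zero_le_power Q_nonneg)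
  then show ?thesis
    unfolding log_coeff_def by (intro integral_nonneg_AE AE_I2)
qed

lemma N_measurable [measurable]: "queue_length J T batch X k t \<in> measurable M (count_space UNIV)"
proof -
  interpret network_pgf M J rate T p S Svec batch X q t "\<lambda>_. 0"
    by unfold_locales (use t in auto)
  show ?thesis
    by (rule queue_length_measurable)
qed

lemma insert_v: "{1..v} = insert v {1..<v}" "v \<notin> {1..<v}"
  using v by auto

text \<open>
  Under the integral this is the negative multinomial series with parameter \<open>s = j - 1\<close>, arguments
  \<open>\<rho> * Q k \<tau> * z k\<close> and \<open>y = denom \<tau>\<close>.
\<close>

lemma has_sum_log_coeff:
  assumes z: "\<And>k. k \<in> {1..<v} \<Longrightarrow> 0 \<le> z k \<and> z k \<le> 1" and j: "j \<ge> 1"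
  shows "((\<lambda>i. log_coeff (i(v := j)) * (\<Prod>k\<in>{1..<v}. z k ^ i k)) has_sum log_coeff_marginal z j)
    (Pi\<^sub>E {1..<v} (\<lambda>_. UNIV))"
proof -
  let ?I = "{1..<v}"
  let ?f = "\<lambda>i \<tau>. \<kappa> * (\<rho> ^ (\<Sum>k=1..v. (i(v := j)) k) * (\<Prod>k=1..v. Q k \<tau> ^ (i(v := j)) k / fact ((i(v := j)) k)) *
     (fact ((\<Sum>k=1..v. (i(v := j)) k) - 1) / denom \<tau> ^ (\<Sum>k=1..v. (i(v := j)) k)))"
  have f_eq: "?f i \<tau> * (\<Prod>k\<in>?I. z k ^ i k) = (fact (j - 1 + (\<Sum>k\<in>?I. i k)) *
      (\<Prod>k\<in>?I. (\<rho> * Q k \<tau> * z k) ^ i k / fact (i k)) / denom \<tau> ^ Suc (j - 1 + (\<Sum>k\<in>?I. i k)))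
      * (\<kappa> * (\<rho> * Q v \<tau>) ^ j / fact j)" for i \<tau>
  proof -
    have sum: "(\<Sum>k=1..v. (i(v := j)) k) = j + (\<Sum>k\<in>?I. i k)"
      unfolding insert_v(1) using insert_v(2) by (subst sum.insert) (auto intro!: sum.cong)
    have prod: "(\<Prod>k=1..v. Q k \<tau> ^ (i(v := j)) k / fact ((i(v := j)) k))
        = Q v \<tau> ^ j / fact j * (\<Prod>k\<in>?I. Q k \<tau> ^ i k / fact (i k))"
      unfolding insert_v(1) using insert_v(2) by (subst prod.insert) (auto intro!: prod.cong)
    have split: "(\<Prod>k\<in>?I. (\<rho> * Q k \<tau> * z k) ^ i k / fact (i k))
        = \<rho> ^ (\<Sum>k\<in>?I. i k) * (\<Prod>k\<in>?I. Q k \<tau> ^ i k / fact (i k)) * (\<Prod>k\<in>?I. z k ^ i k)"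
      by (simp add: power_mult_distrib prod.distrib power_sum prod_dividef)
    have index: "Suc (j - 1 + (\<Sum>k\<in>?I. i k)) = j + (\<Sum>k\<in>?I. i k)"
      "j + (\<Sum>k\<in>?I. i k) - 1 = j - 1 + (\<Sum>k\<in>?I. i k)"
      using j by auto
    show ?thesis
      unfolding sum prod split index by (simp add: power_add power_mult_distrib mult_ac)
  qed
  have sum: "((\<lambda>i. ?f i \<tau> * (\<Prod>k\<in>?I. z k ^ i k)) has_sum \<kappa> * ((\<rho> * Q v \<tau> / marginal_denom z \<tau>) ^ j / real j))
      (Pi\<^sub>E ?I (\<lambda>_. UNIV))" for \<tau>
  proof -
    have marginal_denom_pos: "0 < marginal_denom z \<tau>"
      using marginal_denom_bounds(1)[of z \<tau>, OF z] \<rho> Q_nonneg[OF v, of \<tau>]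
      by (smt (verit) mult_nonneg_nonneg)
    have "((\<lambda>i. fact (j - 1 + (\<Sum>k\<in>?I. i k)) * (\<Prod>k\<in>?I. (\<rho> * Q k \<tau> * z k) ^ i k / fact (i k))
        / denom \<tau> ^ Suc (j - 1 + (\<Sum>k\<in>?I. i k))) has_sum
        (fact (j - 1) / (denom \<tau> - (\<Sum>k\<in>?I. \<rho> * Q k \<tau> * z k)) ^ Suc (j - 1))) (Pi\<^sub>E ?I (\<lambda>_. UNIV))"
    proof (rule negative_multinomial_series)
      show "(\<Sum>k\<in>?I. \<rho> * Q k \<tau> * z k) < denom \<tau>"
        using marginal_denom_pos by (simp add: marginal_denom_def)
    qed (use z v \<rho> Q_nonneg in auto)
    from has_sum_cmult_left[OF this, of "\<kappa> * (\<rho> * Q v \<tau>) ^ j / fact j"]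
    have "((\<lambda>i. ?f i \<tau> * (\<Prod>k\<in>?I. z k ^ i k)) has_sum
        (fact (j - 1) / marginal_denom z \<tau> ^ Suc (j - 1) * (\<kappa> * (\<rho> * Q v \<tau>) ^ j / fact j))) (Pi\<^sub>E ?I (\<lambda>_. UNIV))"
      by (simp only: f_eq marginal_denom_def)
    also have "fact (j - 1) / marginal_denom z \<tau> ^ Suc (j - 1) * (\<kappa> * (\<rho> * Q v \<tau>) ^ j / fact j)
        = \<kappa> * ((\<rho> * Q v \<tau> / marginal_denom z \<tau>) ^ j / real j)"
      using j marginal_denom_pos by (cases j) (simp_all add: power_divide del: power_Suc)
    finally show ?thesis .
  qed
  have "((\<lambda>i. \<integral>\<tau>. ?f i \<tau> * (\<Prod>k\<in>?I. z k ^ i k) \<partial>rate_measure) has_sum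
      (\<integral>\<tau>. \<kappa> * ((\<rho> * Q v \<tau> / marginal_denom z \<tau>) ^ j / real j) \<partial>rate_measure)) (Pi\<^sub>E ?I (\<lambda>_. UNIV))"
  proof (rule has_sum_integral[OF _ _ _ sum])
    show "countable (Pi\<^sub>E ?I (\<lambda>_. UNIV :: nat set))"
      by (rule countable_PiE) auto
    show "(\<lambda>\<tau>. ?f i \<tau> * (\<Prod>k\<in>?I. z k ^ i k)) \<in> borel_measurable rate_measure" for i
    proof -
      have "(\<lambda>\<tau>. \<Prod>k=1..v. Q k \<tau> ^ (i(v := j)) k / fact ((i(v := j)) k)) \<in> borel_measurable borel"
        using v by (intro borel_measurable_prod borel_measurable_divide borel_measurable_power Q_measurable) auto
      then show ?thesis
        by measurable
    qed
    show "0 \<le> ?f i \<tau> * (\<Prod>k\<in>?I. z k ^ i k)" for i \<tau>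
      unfolding f_eq using z v \<rho> \<kappa>_pos Q_nonneg denom_pos[of \<tau>]
      by (intro mult_nonneg_nonneg divide_nonneg_nonneg prod_nonneg) (auto intro!: zero_le_power mult_nonneg_nonneg)
    show "integrable rate_measure (\<lambda>\<tau>. \<kappa> * ((\<rho> * Q v \<tau> / marginal_denom z \<tau>) ^ j / real j))"
    proof (rule finite_measure.integrable_const_bound[OF finite_rate_measure, of _ "\<kappa> * (1 / real j)"])
      have "norm (\<kappa> * ((\<rho> * Q v \<tau> / marginal_denom z \<tau>) ^ j / real j)) \<le> \<kappa> * (1 / real j)" for \<tau>
      proof -
        have "0 \<le> \<rho> * Q v \<tau> / marginal_denom z \<tau> \<and> \<rho> * Q v \<tau> / marginal_denom z \<tau> \<le> 1"
          using marginal_denom_bounds(1)[of z \<tau>, OF z] \<rho> Q_nonneg[OF v, of \<tau>]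
          by (smt (verit) divide_le_eq_1 mult_nonneg_nonneg divide_nonneg_nonneg)
        then show ?thesis
          using \<kappa>_pos j by (simp add: abs_mult power_le_one divide_right_mono)
      qed
      then show "AE \<tau> in rate_measure. norm (\<kappa> * ((\<rho> * Q v \<tau> / marginal_denom z \<tau>) ^ j / real j)) \<le> \<kappa> * (1 / real j)"
        by simp
      show "(\<lambda>\<tau>. \<kappa> * ((\<rho> * Q v \<tau> / marginal_denom z \<tau>) ^ j / real j)) \<in> borel_measurable rate_measure"
        by measurable
    qed
  qed
  then show ?thesis
    by (simp only: log_coeff_def log_coeff_marginal_def integral_mult_left_zero)
qed

lemma has_sum_state_prob:
  assumes z: "\<And>k. k \<in> {1..<v} \<Longrightarrow> 0 \<le> z k \<and> z k \<le> 1"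
  shows "((\<lambda>m. P (m(v := n)) * (\<Prod>k\<in>{1..<v}. z k ^ m k)) has_sum state_marginal z n)
    (Pi\<^sub>E {1..<v} (\<lambda>_. UNIV))"
proof -
  let ?I = "{1..<v}"
  let ?rest = "\<lambda>\<omega>. N v \<omega> = n \<and> (\<forall>k\<in>{v<..J}. N k \<omega> = 0)"
  let ?state = "\<lambda>m. {\<omega>\<in>space M. \<forall>k\<in>{1..J}. N k \<omega> = (if k \<le> v then (m(v := n)) k else 0)}"
  let ?F = "\<lambda>\<omega>. (\<Prod>k\<in>?I. z k ^ N k \<omega>) * indicator {\<omega>\<in>space M. ?rest \<omega>} \<omega>"
  have state_iff: "\<omega> \<in> ?state m \<longleftrightarrow> \<omega> \<in> space M \<and> ?rest \<omega> \<and> m = (\<lambda>k\<in>?I. N k \<omega>)"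
    if "m \<in> Pi\<^sub>E ?I (\<lambda>_. UNIV)" for m \<omega>
  proof -
    have "(\<forall>k\<in>{1..J}. N k \<omega> = (if k \<le> v then (m(v := n)) k else 0))
        \<longleftrightarrow> ?rest \<omega> \<and> (\<forall>k\<in>?I. m k = N k \<omega>)"
      using v by (auto simp: not_le)
    moreover have "(\<forall>k\<in>?I. m k = N k \<omega>) \<longleftrightarrow> m = (\<lambda>k\<in>?I. N k \<omega>)"
      using that by (auto simp: PiE_def extensional_def fun_eq_iff)
    ultimately show ?thesis by blast
  qed
  have state_meas [measurable]: "?state m \<in> sets M" for m
    by measurable
  have "((\<lambda>m. expectation (\<lambda>\<omega>. indicator (?state m) \<omega> * (\<Prod>k\<in>?I. z k ^ m k))) has_sum expectation ?F)
      (Pi\<^sub>E ?I (\<lambda>_. UNIV))"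
  proof (rule has_sum_integral)
    show "countable (Pi\<^sub>E ?I (\<lambda>_. UNIV :: nat set))"
      by (rule countable_PiE) auto
    show "((\<lambda>m. indicator (?state m) \<omega> * (\<Prod>k\<in>?I. z k ^ m k)) has_sum ?F \<omega>) (Pi\<^sub>E ?I (\<lambda>_. UNIV))"
      if "\<omega> \<in> space M" for \<omega>
    proof (rule has_sum_finite_neutralI[of "{\<lambda>k\<in>?I. N k \<omega>}"])
      have sum_singleton: "(\<Sum>m\<in>{a}. g m) = g a" for a and g :: "(nat \<Rightarrow> nat) \<Rightarrow> real"
        by simp
      let ?g = "\<lambda>m. indicator (?state m) \<omega> * (\<Prod>k\<in>?I. z k ^ m k) :: real"
      show "?g m = 0" if "m \<in> Pi\<^sub>E ?I (\<lambda>_. UNIV) - {\<lambda>k\<in>?I. N k \<omega>}" for m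
      proof -
        have "\<omega> \<notin> ?state m"
          using that by (subst state_iff) auto
        then show ?thesis
          by (simp only: indicator_simps(2) mult_zero_left not_False_eq_True)
      qed
      have "indicator (?state (\<lambda>k\<in>?I. N k \<omega>)) \<omega> = (indicator {\<omega>\<in>space M. ?rest \<omega>} \<omega> :: real)"
        unfolding indicator_def of_bool_eq_iff by (subst state_iff) auto
      moreover have "(\<Prod>k\<in>?I. z k ^ (\<lambda>k\<in>?I. N k \<omega>) k) = (\<Prod>k\<in>?I. z k ^ N k \<omega>)"
        by (intro prod.cong) auto
      ultimately have "?F \<omega> = ?g (\<lambda>k\<in>?I. N k \<omega>)"
        by (simp only: mult.commute)
      also have "\<dots> = (\<Sum>m\<in>{\<lambda>k\<in>?I. N k \<omega>}. ?g m)"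
        by (rule sum_singleton[symmetric])
      finally show "?F \<omega> = (\<Sum>m\<in>{\<lambda>k\<in>?I. N k \<omega>}. ?g m)" .
    qed auto
    show "integrable M ?F"
    proof (rule integrable_const_bound[of _ 1])
      have "0 \<le> (\<Prod>k\<in>?I. z k ^ N k \<omega>) \<and> (\<Prod>k\<in>?I. z k ^ N k \<omega>) \<le> 1" for \<omega>
        using z by (auto intro!: prod_nonneg prod_le_1 power_le_one)
      then show "AE \<omega> in M. norm (?F \<omega>) \<le> 1"
        by (intro AE_I2) (auto simp: indicator_def)
    qed measurable
    show "0 \<le> indicator (?state m) \<omega> * (\<Prod>k\<in>?I. z k ^ m k)" for m \<omega>
      using z by (auto intro!: mult_nonneg_nonneg prod_nonneg)
  qed measurable
  then show ?thesis
    unfolding state_marginal_def state_prob_def by simp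
qed

text \<open>
  The generating function of the queue lengths at \<open>(z 1, \<dots>, z (v - 1), x, 0, \<dots>, 0)\<close>: the zeros
  select the event that the queues above \<open>v\<close> are empty, by \<open>0 ^ 0 = 1\<close>.
\<close>

lemma state_marginal_powser:
  assumes z01: "\<And>k. k \<in> {1..<v} \<Longrightarrow> 0 \<le> z k \<and> z k \<le> 1" and x: "0 \<le> x" "x \<le> 1"
  shows "(\<lambda>n. state_marginal z n * x ^ n) sums exp (- (\<integral>\<tau>. 1 + \<kappa> * ln (marginal_denom z \<tau> - \<rho> * Q v \<tau> * x) \<partial>rate_measure))"
proof -
  let ?I = "{1..<v}"
  define w where "w k = (if k < v then z k else if k = v then x else 0)" for k
  interpret network_pgf M J rate T p S Svec batch X q t w
    by unfold_locales (use t z01 x in \<open>auto simp: w_def\<close>)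
  let ?rest = "\<lambda>n \<omega>. N v \<omega> = n \<and> (\<forall>k\<in>{v<..J}. N k \<omega> = 0)"
  have J: "{1..J} = insert v (?I \<union> {v<..J})"
    using v by auto
  have prod_w: "(\<Prod>k=1..J. w k ^ N k \<omega>)
      = (\<Prod>k\<in>?I. z k ^ N k \<omega>) * x ^ N v \<omega> * of_bool (\<forall>k\<in>{v<..J}. N k \<omega> = 0)" for \<omega>
  proof -
    have "(\<Prod>k=1..J. w k ^ N k \<omega>) = w v ^ N v \<omega> * ((\<Prod>k\<in>?I. w k ^ N k \<omega>) * (\<Prod>k\<in>{v<..J}. w k ^ N k \<omega>))"
      unfolding J by (subst prod.insert, simp, simp, subst prod.union_disjoint) auto
    moreover have "(\<Prod>k\<in>?I. w k ^ N k \<omega>) = (\<Prod>k\<in>?I. z k ^ N k \<omega>)"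
      by (intro prod.cong) (auto simp: w_def)
    moreover have "(\<Prod>k\<in>{v<..J}. w k ^ N k \<omega>) = of_bool (\<forall>k\<in>{v<..J}. N k \<omega> = 0)"
    proof (cases "\<forall>k\<in>{v<..J}. N k \<omega> = 0")
      case False
      then obtain k where "k \<in> {v<..J}" "N k \<omega> \<noteq> 0" by blast
      then have "\<exists>k\<in>{v<..J}. w k ^ N k \<omega> = 0"
        by (intro bexI[of _ k]) (auto simp: w_def)
      then show ?thesis
        using False by simp
    qed (auto intro!: prod.neutral)
    ultimately show ?thesis
      by (simp add: w_def)
  qed
  have "((\<lambda>n. expectation (\<lambda>\<omega>. ((\<Prod>k\<in>?I. z k ^ N k \<omega>) * indicator {\<omega>\<in>space M. ?rest n \<omega>} \<omega>) * x ^ n))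
      has_sum expectation (\<lambda>\<omega>. \<Prod>k=1..J. w k ^ N k \<omega>)) UNIV"
  proof (rule has_sum_integral)
    show "((\<lambda>n. ((\<Prod>k\<in>?I. z k ^ N k \<omega>) * indicator {\<omega>\<in>space M. ?rest n \<omega>} \<omega>) * x ^ n)
        has_sum (\<Prod>k=1..J. w k ^ N k \<omega>)) UNIV" if "\<omega> \<in> space M" for \<omega>
      unfolding prod_w using that
      by (intro has_sum_finite_neutralI[of "{N v \<omega>}"]) (auto simp: indicator_def)
    show "integrable M (\<lambda>\<omega>. \<Prod>k=1..J. w k ^ N k \<omega>)"
    proof (rule integrable_const_bound[of _ 1])
      have "0 \<le> (\<Prod>k=1..J. w k ^ N k \<omega>) \<and> (\<Prod>k=1..J. w k ^ N k \<omega>) \<le> 1" for \<omega>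
        using z01 x by (auto simp: w_def intro!: prod_nonneg prod_le_1 power_le_one)
      then show "AE \<omega> in M. norm (\<Prod>k=1..J. w k ^ N k \<omega>) \<le> 1"
        by (intro AE_I2) simp
    qed measurable
    show "0 \<le> ((\<Prod>k\<in>?I. z k ^ N k \<omega>) * indicator {\<omega>\<in>space M. ?rest n \<omega>} \<omega>) * x ^ n" for n \<omega>
      using z01 x by (auto intro!: mult_nonneg_nonneg prod_nonneg)
  qed measurable
  then have "(\<lambda>n. state_marginal z n * x ^ n) sums expectation (\<lambda>\<omega>. \<Prod>k=1..J. w k ^ N k \<omega>)"
    unfolding state_marginal_def by (intro has_sum_imp_sums) simp
  also have "expectation (\<lambda>\<omega>. \<Prod>k=1..J. w k ^ N k \<omega>) = exp (- (LINT \<tau>:{0..t}|lborel. rate \<tau> *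
        (1 - measure_pmf.expectation S (\<lambda>n. (1 - (\<Sum>k=1..J. location_prob J p q k (t - \<tau>) * (1 - w k))) ^ n))))"
    by (rule queue_lengths_pgf)
  also have "(LINT \<tau>:{0..t}|lborel. rate \<tau> *
        (1 - measure_pmf.expectation S (\<lambda>n. (1 - (\<Sum>k=1..J. location_prob J p q k (t - \<tau>) * (1 - w k))) ^ n)))
      = (LINT \<tau>:{0..t}|lborel. rate \<tau> * (1 + \<kappa> * ln (marginal_denom z \<tau> - \<rho> * Q v \<tau> * x)))"
  proof (rule set_lebesgue_integral_cong)
    show "\<forall>\<tau>. \<tau> \<in> {0..t} \<longrightarrow> rate \<tau> *
        (1 - measure_pmf.expectation S (\<lambda>n. (1 - (\<Sum>k=1..J. location_prob J p q k (t - \<tau>) * (1 - w k))) ^ n))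
        = rate \<tau> * (1 + \<kappa> * ln (marginal_denom z \<tau> - \<rho> * Q v \<tau> * x))"
    proof (intro allI impI)
      fix \<tau> assume \<tau>: "\<tau> \<in> {0..t}"
      define u where "u = 1 - (\<Sum>k=1..J. location_prob J p q k (t - \<tau>) * (1 - w k))"
      have Q_eq: "location_prob J p q k (t - \<tau>) = Q k \<tau>" for k
        using \<tau> by (simp add: Q_def max_absorb2)
      have "0 \<le> u \<and> u \<le> 1"
        using mean_entry_pgf_bounds[of "t - \<tau>"] \<tau> unfolding entry_pgf_mean u_def by simp
      then have "measure_pmf.expectation S (\<lambda>n. u ^ n) = ln (1 - \<rho> * u) / ln (1 - \<rho>)"
        by (intro log_pgf[OF \<rho> S_Log]) auto
      moreover have "1 - \<rho> * u = marginal_denom z \<tau> - \<rho> * Q v \<tau> * x"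
      proof -
        have "(\<Sum>k=1..J. Q k \<tau> * w k) = Q v \<tau> * w v + ((\<Sum>k\<in>?I. Q k \<tau> * w k) + (\<Sum>k\<in>{v<..J}. Q k \<tau> * w k))"
          unfolding J by (subst sum.insert, simp, simp, subst sum.union_disjoint) auto
        also have "(\<Sum>k\<in>{v<..J}. Q k \<tau> * w k) = 0"
          by (intro sum.neutral) (auto simp: w_def)
        also have "(\<Sum>k\<in>?I. Q k \<tau> * w k) = (\<Sum>k\<in>?I. Q k \<tau> * z k)"
          by (intro sum.cong) (auto simp: w_def)
        finally have sum_w: "(\<Sum>k=1..J. Q k \<tau> * w k) = Q v \<tau> * x + (\<Sum>k\<in>?I. Q k \<tau> * z k)"
          by (simp add: w_def)
        have factor: "(\<Sum>k\<in>?I. \<rho> * Q k \<tau> * z k) = \<rho> * (\<Sum>k\<in>?I. Q k \<tau> * z k)"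
          by (simp add: sum_distrib_left mult.assoc)
        have u_eq: "u = 1 - (\<Sum>k=1..J. Q k \<tau>) + (\<Sum>k=1..J. Q k \<tau> * w k)"
          unfolding u_def Q_eq by (simp add: right_diff_distrib sum_subtractf)
        show ?thesis
          unfolding marginal_denom_def denom_def factor u_eq sum_w by (simp add: algebra_simps)
      qed
      ultimately show "rate \<tau> *
          (1 - measure_pmf.expectation S (\<lambda>n. (1 - (\<Sum>k=1..J. location_prob J p q k (t - \<tau>) * (1 - w k))) ^ n))
          = rate \<tau> * (1 + \<kappa> * ln (marginal_denom z \<tau> - \<rho> * Q v \<tau> * x))"
        unfolding u_def[symmetric] by (simp add: \<kappa>_def)
    qed
  qed simp
  also have "\<dots> = (\<integral>\<tau>. 1 + \<kappa> * ln (marginal_denom z \<tau> - \<rho> * Q v \<tau> * x) \<partial>rate_measure)"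
    by (intro rate_integral) measurable
  finally show ?thesis .
qed

text \<open>
  The logarithmic series of \<open>ln (1 - y)\<close> at \<open>y = \<rho> * Q v \<tau> / marginal_denom z \<tau> * x\<close>, integrated
  over \<open>\<tau>\<close>. The two exponents occur separately, as \<open>L x\<close> and \<open>L 0\<close> in \<open>exp_powser_recurrence\<close>.
\<close>

lemma log_coeff_marginal_powser:
  assumes z: "\<And>k. k \<in> {1..<v} \<Longrightarrow> 0 \<le> z k \<and> z k \<le> 1" and x: "0 \<le> x" "x < 1"
  shows "(\<lambda>j. log_coeff_marginal z j * x ^ j) sums
    (- (\<integral>\<tau>. 1 + \<kappa> * ln (marginal_denom z \<tau> - \<rho> * Q v \<tau> * x) \<partial>rate_measure)
     - - (\<integral>\<tau>. 1 + \<kappa> * ln (marginal_denom z \<tau> - \<rho> * Q v \<tau> * 0) \<partial>rate_measure))"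
proof -
  let ?L = "\<lambda>x \<tau>. 1 + \<kappa> * ln (marginal_denom z \<tau> - \<rho> * Q v \<tau> * x)"
  have int: "integrable rate_measure (?L y)" if y: "0 \<le> y" "y \<le> 1" for y
  proof (rule finite_measure.integrable_const_bound[OF finite_rate_measure, of _ "1 + \<kappa> * \<bar>ln (1 - \<rho>)\<bar>"])
    have "norm (?L y \<tau>) \<le> 1 + \<kappa> * \<bar>ln (1 - \<rho>)\<bar>" for \<tau>
    proof -
      have "0 \<le> \<rho> * Q v \<tau> * y" "\<rho> * Q v \<tau> * y \<le> \<rho> * Q v \<tau>"
        using \<rho> y Q_nonneg[OF v, of \<tau>] by (auto intro!: mult_nonneg_nonneg mult_left_le)
      then have "1 - \<rho> \<le> marginal_denom z \<tau> - \<rho> * Q v \<tau> * y" "marginal_denom z \<tau> - \<rho> * Q v \<tau> * y \<le> 1"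
        using marginal_denom_bounds[of z \<tau>, OF z] by auto
      then have "ln (1 - \<rho>) \<le> ln (marginal_denom z \<tau> - \<rho> * Q v \<tau> * y)" "ln (marginal_denom z \<tau> - \<rho> * Q v \<tau> * y) \<le> 0"
        using \<rho> by auto
      then have "\<bar>ln (marginal_denom z \<tau> - \<rho> * Q v \<tau> * y)\<bar> \<le> \<bar>ln (1 - \<rho>)\<bar>"
        by linarith
      then have "\<kappa> * \<bar>ln (marginal_denom z \<tau> - \<rho> * Q v \<tau> * y)\<bar> \<le> \<kappa> * \<bar>ln (1 - \<rho>)\<bar>"
        using \<kappa>_pos by (intro mult_left_mono) auto
      moreover have "\<bar>\<kappa> * ln (marginal_denom z \<tau> - \<rho> * Q v \<tau> * y)\<bar> = \<kappa> * \<bar>ln (marginal_denom z \<tau> - \<rho> * Q v \<tau> * y)\<bar>"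
        using \<kappa>_pos by (simp add: abs_mult)
      ultimately show ?thesis
        unfolding real_norm_def by linarith
    qed
    then show "AE \<tau> in rate_measure. norm (?L y \<tau>) \<le> 1 + \<kappa> * \<bar>ln (1 - \<rho>)\<bar>"
      by simp
    show "?L y \<in> borel_measurable rate_measure"
      by measurable
  qed
  have ratio: "0 \<le> \<rho> * Q v \<tau> / marginal_denom z \<tau> \<and> \<rho> * Q v \<tau> / marginal_denom z \<tau> \<le> 1 \<and> 0 < marginal_denom z \<tau>" for \<tau>
    using marginal_denom_bounds(1)[of z \<tau>, OF z] \<rho> Q_nonneg[OF v, of \<tau>]
    by (smt (verit) divide_le_eq_1 mult_nonneg_nonneg divide_nonneg_nonneg)
  have "((\<lambda>j. \<integral>\<tau>. \<kappa> * ((\<rho> * Q v \<tau> / marginal_denom z \<tau>) ^ j / real j) * x ^ j \<partial>rate_measure) has_sum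
      (\<integral>\<tau>. ?L 0 \<tau> - ?L x \<tau> \<partial>rate_measure)) UNIV"
  proof (rule has_sum_integral)
    fix \<tau>
    define y where "y = \<rho> * Q v \<tau> / marginal_denom z \<tau> * x"
    have "0 \<le> y" "y \<le> 1 * x"
      unfolding y_def by (intro mult_nonneg_nonneg mult_right_mono; use ratio[of \<tau>] x in blast)+
    then have y: "0 \<le> y" "y < 1"
      using x by simp_all
    have "(\<lambda>j. - \<kappa> * (- ((- (- y)) ^ j) / of_nat j)) sums (- \<kappa> * ln (1 + - y))"
      by (intro sums_mult ln_series') (use y in auto)
    moreover have "- \<kappa> * ln (1 + - y) = ?L 0 \<tau> - ?L x \<tau>"
    proof -
      have "marginal_denom z \<tau> - \<rho> * Q v \<tau> * x = marginal_denom z \<tau> * (1 - y)"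
        using ratio[of \<tau>] by (simp add: y_def field_simps)
      then have "ln (marginal_denom z \<tau> - \<rho> * Q v \<tau> * x) = ln (marginal_denom z \<tau>) + ln (1 - y)"
        using ratio[of \<tau>] y by (simp add: ln_mult)
      then show ?thesis
        by (simp add: algebra_simps)
    qed
    moreover have "(\<lambda>j. - \<kappa> * (- ((- (- y)) ^ j) / of_nat j))
        = (\<lambda>j. \<kappa> * ((\<rho> * Q v \<tau> / marginal_denom z \<tau>) ^ j / real j) * x ^ j)"
    proof -
      have "y ^ j = (\<rho> * Q v \<tau> / marginal_denom z \<tau>) ^ j * x ^ j" for j
        unfolding y_def by (rule power_mult_distrib)
      then show ?thesis
        by (simp add: fun_eq_iff)
    qed
    ultimately have "(\<lambda>j. \<kappa> * ((\<rho> * Q v \<tau> / marginal_denom z \<tau>) ^ j / real j) * x ^ j) sums (?L 0 \<tau> - ?L x \<tau>)"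
      by simp
    then show "((\<lambda>j. \<kappa> * ((\<rho> * Q v \<tau> / marginal_denom z \<tau>) ^ j / real j) * x ^ j) has_sum (?L 0 \<tau> - ?L x \<tau>)) UNIV"
      by (rule sums_nonneg_imp_has_sum) (use ratio[of \<tau>] \<kappa>_pos x in auto)
  next
    show "integrable rate_measure (\<lambda>\<tau>. ?L 0 \<tau> - ?L x \<tau>)"
      using int[of 0] int[of x] x by (intro Bochner_Integration.integrable_diff) auto
    show "(\<lambda>\<tau>. \<kappa> * ((\<rho> * Q v \<tau> / marginal_denom z \<tau>) ^ j / real j) * x ^ j) \<in> borel_measurable rate_measure" for j
      by measurable
    show "0 \<le> \<kappa> * ((\<rho> * Q v \<tau> / marginal_denom z \<tau>) ^ j / real j) * x ^ j" for j \<tau>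
      using ratio[of \<tau>] \<kappa>_pos x by auto
  qed simp
  then have "(\<lambda>j. log_coeff_marginal z j * x ^ j) sums (\<integral>\<tau>. ?L 0 \<tau> - ?L x \<tau> \<partial>rate_measure)"
    unfolding log_coeff_marginal_def by (intro has_sum_imp_sums) simp
  also have "(\<integral>\<tau>. ?L 0 \<tau> - ?L x \<tau> \<partial>rate_measure) = (\<integral>\<tau>. ?L 0 \<tau> \<partial>rate_measure) - (\<integral>\<tau>. ?L x \<tau> \<partial>rate_measure)"
    by (intro Bochner_Integration.integral_diff int) (use x in simp_all)
  finally show ?thesis
    by simp
qed

text \<open>
  For fixed \<open>z\<close> the one-variable recurrence is an equation between series in \<open>z 1, \<dots>, z (v - 1)\<close>;
  comparing their coefficients at \<open>m\<close> gives the claim. Multi-indices are split into the entry at \<open>v\<close>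
  and the restriction to \<open>{1..<v}\<close>.
\<close>

lemma state_prob_recurrence_fibre:
  assumes m: "m \<in> Pi\<^sub>E {1..<v} (\<lambda>_. UNIV)"
  shows "real n * P (m(v := n)) = (\<Sum>j=1..n. \<Sum>i\<in>Pi\<^sub>E {1..<v} (\<lambda>k. {0..m k}).
    real j * log_coeff (i(v := j)) * P ((\<lambda>k\<in>{1..<v}. m k - i k)(v := n - j)))"
proof (rule multi_powser_coeffs_unique[where I="{1..<v}" and a="\<lambda>m. real n * P (m(v := n))"
      and f="\<lambda>z. real n * state_marginal z n" and m=m
      and b="\<lambda>m. \<Sum>j=1..n. \<Sum>i\<in>Pi\<^sub>E {1..<v} (\<lambda>k. {0..m k}).
        real j * log_coeff (i(v := j)) * P ((\<lambda>k\<in>{1..<v}. m k - i k)(v := n - j))"])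
  let ?I = "{1..<v}"
  fix z :: "nat \<Rightarrow> real" assume "\<And>k. k \<in> ?I \<Longrightarrow> 0 < z k \<and> z k < 1"
  then have z: "\<And>k. k \<in> ?I \<Longrightarrow> 0 \<le> z k \<and> z k \<le> 1"
    by (auto intro: less_imp_le)
  show "((\<lambda>m. real n * P (m(v := n)) * (\<Prod>k\<in>?I. z k ^ m k)) has_sum (real n * state_marginal z n))
      (Pi\<^sub>E ?I (\<lambda>_. UNIV))"
    using has_sum_cmult_right[OF has_sum_state_prob[of z n, OF z], where c="real n"] by (simp add: mult.assoc)
  have "((\<lambda>m. (\<Sum>i\<in>Pi\<^sub>E ?I (\<lambda>k. {0..m k}). real j * log_coeff (i(v := j)) * P ((\<lambda>k\<in>?I. m k - i k)(v := n - j)))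
      * (\<Prod>k\<in>?I. z k ^ m k)) has_sum (real j * log_coeff_marginal z j * state_marginal z (n - j)))
      (Pi\<^sub>E ?I (\<lambda>_. UNIV))" if "j \<in> {1..n}" for j
  proof (rule multi_powser_product[where a="\<lambda>i. real j * log_coeff (i(v := j))" and b="\<lambda>m. P (m(v := n - j))"])
    show "((\<lambda>m. real j * log_coeff (m(v := j)) * (\<Prod>k\<in>?I. z k ^ m k)) has_sum real j * log_coeff_marginal z j)
        (Pi\<^sub>E ?I (\<lambda>_. UNIV))"
      using has_sum_cmult_right[OF has_sum_log_coeff[of z j, OF z], where c="real j"] that by (simp add: mult.assoc)
    show "((\<lambda>m. P (m(v := n - j)) * (\<Prod>k\<in>?I. z k ^ m k)) has_sum state_marginal z (n - j)) (Pi\<^sub>E ?I (\<lambda>_. UNIV))"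
      by (rule has_sum_state_prob[of z, OF z])
    show "0 \<le> real j * log_coeff (i(v := j))" for i
      by (intro mult_nonneg_nonneg log_coeff_nonneg) simp
    show "0 \<le> P (i(v := n - j))" for i
      unfolding state_prob_def by (rule measure_nonneg)
    show "0 \<le> z k" if "k \<in> ?I" for k
      using z[OF that] by simp
  qed simp
  then have "((\<lambda>m. \<Sum>j=1..n. (\<Sum>i\<in>Pi\<^sub>E ?I (\<lambda>k. {0..m k}). real j * log_coeff (i(v := j)) * P ((\<lambda>k\<in>?I. m k - i k)(v := n - j)))
      * (\<Prod>k\<in>?I. z k ^ m k)) has_sum (\<Sum>j=1..n. real j * log_coeff_marginal z j * state_marginal z (n - j)))
      (Pi\<^sub>E ?I (\<lambda>_. UNIV))"
    by (intro has_sum_finite_sum) auto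
  also have "(\<Sum>j=1..n. real j * log_coeff_marginal z j * state_marginal z (n - j))
      = (\<Sum>j\<le>n. real j * log_coeff_marginal z j * state_marginal z (n - j))"
    by (rule sum.mono_neutral_left) (auto simp: not_less_eq_eq)
  also have "\<dots> = real n * state_marginal z n"
    by (rule exp_powser_recurrence[of "state_marginal z"
          "\<lambda>x. - (\<integral>\<tau>. 1 + \<kappa> * ln (marginal_denom z \<tau> - \<rho> * Q v \<tau> * x) \<partial>rate_measure)", symmetric])
      (rule state_marginal_powser[of z, OF z] log_coeff_marginal_powser[of z, OF z]; simp)+
  finally show "((\<lambda>m. (\<Sum>j=1..n. \<Sum>i\<in>Pi\<^sub>E ?I (\<lambda>k. {0..m k}).
      real j * log_coeff (i(v := j)) * P ((\<lambda>k\<in>?I. m k - i k)(v := n - j))) * (\<Prod>k\<in>?I. z k ^ m k))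
      has_sum (real n * state_marginal z n)) (Pi\<^sub>E ?I (\<lambda>_. UNIV))"
    by (simp only: sum_distrib_right)
qed (use m in simp_all)

theorem state_prob_recurrence:
  assumes n: "n v \<ge> 1"
  shows "P n = (\<Sum>i\<in>(\<Pi>\<^sub>E k\<in>{1..v}. if k < v then {0..n k} else {1..n k}).
    real (i v) / real (n v) * P (\<lambda>k. n k - i k) * log_coeff i)"
proof -
  let ?I = "{1..<v}" and ?B = "\<lambda>k. if k < v then {0..n k} else {1..n k}"
  have P_cong: "P m = P m'" if "\<And>k. k \<in> {1..v} \<Longrightarrow> m k = m' k" for m m'
  proof -
    have "(\<forall>k\<in>{1..J}. N k \<omega> = (if k \<le> v then m k else 0)) \<longleftrightarrow>
        (\<forall>k\<in>{1..J}. N k \<omega> = (if k \<le> v then m' k else 0))" for \<omega>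
      using that by (intro ball_cong refl) auto
    then show ?thesis
      unfolding state_prob_def by (simp only:)
  qed
  define g where "g i = real (i v) / real (n v) * P (\<lambda>k. n k - i k) * log_coeff i" for i
  have box: "Pi\<^sub>E ?I ?B = Pi\<^sub>E ?I (\<lambda>k. {0..restrict n ?I k})"
    by (rule PiE_cong) auto
  have "(\<Sum>i\<in>Pi\<^sub>E {1..v} ?B. g i) = (\<Sum>(j, i)\<in>?B v \<times> Pi\<^sub>E ?I ?B. g (i(v := j)))"
    unfolding insert_v(1) PiE_insert_eq
    by (subst sum.reindex[OF inj_combinator[OF insert_v(2)]]) (simp add: case_prod_unfold)
  also have "\<dots> = (\<Sum>j=1..n v. \<Sum>i\<in>Pi\<^sub>E ?I (\<lambda>k. {0..restrict n ?I k}). g (i(v := j)))"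
    unfolding box by (simp add: sum.cartesian_product)
  also have "\<dots> = (\<Sum>j=1..n v. \<Sum>i\<in>Pi\<^sub>E ?I (\<lambda>k. {0..restrict n ?I k}). real j * log_coeff (i(v := j)) *
      P ((\<lambda>k\<in>?I. restrict n ?I k - i k)(v := n v - j)) / real (n v))"
  proof (intro sum.cong refl)
    fix j i
    have "P (\<lambda>k. n k - (i(v := j)) k) = P ((\<lambda>k\<in>?I. restrict n ?I k - i k)(v := n v - j))"
      by (rule P_cong) auto
    then show "g (i(v := j)) = real j * log_coeff (i(v := j)) *
        P ((\<lambda>k\<in>?I. restrict n ?I k - i k)(v := n v - j)) / real (n v)"
      unfolding g_def by (simp only: fun_upd_same) simp
  qed
  also have "\<dots> = real (n v) * P ((restrict n ?I)(v := n v)) / real (n v)"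
    unfolding sum_divide_distrib[symmetric]
    by (subst state_prob_recurrence_fibre) auto
  also have "\<dots> = P ((restrict n ?I)(v := n v))"
    using n by simp
  also have "\<dots> = P n"
    by (rule P_cong) auto
  finally show ?thesis
    by (simp only: g_def)
qed

lemma log_coeff_eq:
  "log_coeff i = (LINT \<tau>:{0..t}|lborel.
     - rate \<tau> * (\<rho> ^ (\<Sum>k=1..v. i k) / ln (1 - \<rho>)) *
     (\<Prod>k=1..v. location_prob J p q k (t - \<tau>) ^ i k / fact (i k)) *
     (fact ((\<Sum>k=1..v. i k) - 1) /
       (1 - \<rho> * (1 - (\<Sum>k=1..J. location_prob J p q k (t - \<tau>)))) ^ (\<Sum>k=1..v. i k)))"
proof -
  let ?f = "\<lambda>\<tau>. \<kappa> * (\<rho> ^ (\<Sum>k=1..v. i k) * (\<Prod>k=1..v. Q k \<tau> ^ i k / fact (i k)) *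
     (fact ((\<Sum>k=1..v. i k) - 1) / denom \<tau> ^ (\<Sum>k=1..v. i k)))"
  have [measurable]: "(\<lambda>\<tau>. \<Prod>k=1..v. Q k \<tau> ^ i k / fact (i k)) \<in> borel_measurable borel"
    using v by (intro borel_measurable_prod borel_measurable_divide borel_measurable_power Q_measurable) auto
  have "log_coeff i = (LINT \<tau>:{0..t}|lborel. rate \<tau> * ?f \<tau>)"
    unfolding log_coeff_def by (rule rate_integral[symmetric]) measurable
  also have "\<dots> = (LINT \<tau>:{0..t}|lborel.
     - rate \<tau> * (\<rho> ^ (\<Sum>k=1..v. i k) / ln (1 - \<rho>)) *
     (\<Prod>k=1..v. location_prob J p q k (t - \<tau>) ^ i k / fact (i k)) *
     (fact ((\<Sum>k=1..v. i k) - 1) /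
       (1 - \<rho> * (1 - (\<Sum>k=1..J. location_prob J p q k (t - \<tau>)))) ^ (\<Sum>k=1..v. i k)))"
  proof (rule set_lebesgue_integral_cong, simp, intro allI impI)
    fix \<tau> assume "\<tau> \<in> {0..t}"
    then have Q_eq: "location_prob J p q k (t - \<tau>) = Q k \<tau>" for k
      by (simp add: Q_def max_absorb2)
    show "rate \<tau> * ?f \<tau> = - rate \<tau> * (\<rho> ^ (\<Sum>k=1..v. i k) / ln (1 - \<rho>)) *
     (\<Prod>k=1..v. location_prob J p q k (t - \<tau>) ^ i k / fact (i k)) *
     (fact ((\<Sum>k=1..v. i k) - 1) /
       (1 - \<rho> * (1 - (\<Sum>k=1..J. location_prob J p q k (t - \<tau>)))) ^ (\<Sum>k=1..v. i k))"
      unfolding Q_eq denom_def[symmetric] by (simp add: \<kappa>_def)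
  qed
  finally show ?thesis .
qed

end

theorem corollary5p1p4:
  fixes M :: "'a measure"
    and J v :: nat
    and rate :: "real \<Rightarrow> real"
    and T :: "nat \<Rightarrow> 'a \<Rightarrow> ennreal"
    and p :: "nat \<Rightarrow> real"
    and S :: "nat pmf"
    and Svec :: "(nat \<Rightarrow> nat) pmf"
    and batch :: "nat \<Rightarrow> nat \<Rightarrow> 'a \<Rightarrow> nat"
    and X :: "nat \<Rightarrow> nat \<Rightarrow> nat \<Rightarrow> real \<Rightarrow> 'a \<Rightarrow> nat"
    and q :: "nat \<Rightarrow> nat \<Rightarrow> real \<Rightarrow> real"
    and \<rho> t :: real
    and n :: "nat \<Rightarrow> nat"
  assumes network: "infinite_server_network M J rate T p S Svec batch X q"
    and \<rho>: "0 < \<rho>" "\<rho> < 1"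
    and S_Log: "\<And>m. m \<ge> 1 \<Longrightarrow> pmf S m = - (1 / ln (1 - \<rho>)) * (\<rho> ^ m / real m)"
    and t: "0 \<le> t"
    and v: "v \<in> {2..J}"
    and n_v: "n v \<ge> 1"
  shows "state_prob M J T batch X t (\<lambda>k. if k \<le> v then n k else 0) =
    (\<Sum>i\<in>(\<Pi>\<^sub>E k\<in>{1..v}. if k < v then {0..n k} else {1..n k}).
      real (i v) / real (n v) *
      state_prob M J T batch X t (\<lambda>k. if k \<le> v then n k - i k else 0) *
      (LINT \<tau>:{0..t}|lborel.
        - rate \<tau> * (\<rho> ^ (\<Sum>k=1..v. i k) / ln (1 - \<rho>)) *
        (\<Prod>k=1..v. location_prob J p q k (t - \<tau>) ^ i k / fact (i k)) *
        (fact ((\<Sum>k=1..v. i k) - 1) /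
          (1 - \<rho> * (1 - (\<Sum>k=1..J. location_prob J p q k (t - \<tau>)))) ^ (\<Sum>k=1..v. i k))))"
proof -
  interpret log_network M J rate T p S Svec batch X q \<rho> t v
  proof (intro log_network.intro log_network_axioms.intro network \<rho> S_Log t)
    show "v \<in> {1..J}"
      using v by simp
  qed
  show ?thesis
    unfolding log_coeff_eq[symmetric] using n_v by (rule state_prob_recurrence)
qed

end
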